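(* Fix $p_0\in\mathbb{R}$ and suppose that the sequences of estimators $\hat a^{(n)}$ and $\hat b^{(n)}$ satisfy Assumption A (root-$n$ consistency and local asymptotic discreteness, as stated in the context). Let $Q^{(n)\mathrm{eff}}_{p_0}(a,b)=\Delta^{(n)\mathrm{eff}}_p(p_0,a,b)/\sqrt{\Gamma^{\mathrm{eff}}_{p,p}(p_0,a,b)}$, let $\alpha\in(0,1)$ and let $z_{\alpha/2}$ be the upper $\alpha/2$-quantile of the standard normal distribution. Then: (i) for every $a>0$ and $b>0$, $Q^{(n)\mathrm{eff}}_{p_0}(\hat a^{(n)},\hat b^{(n)})$ is asymptotically standard normal under $\mathrm{P}^{(n)}_{p_0,a,b}$ as $n\to\infty$; (ii) for any $a>0$ and $b>0$, $Q^{(n)\mathrm{eff}}_{p_0}(\hat a^{(n)},\hat b^{(n)})$ is asymptotically normal with mean $\tau_1\sqrt{\Gamma^{\mathrm{eff}}_{p,p}(p_0,a,b)}$ and variance $1$ under $\mathrm{P}^{(n)}_{p_0+n^{-1/2}\tau^{(n)}_1,a,b}$, where $\tau_1^{(n)}\in\mathbb{R}$ is a bounded sequence with limit $\tau_1:=\lim_{n\to\infty}\tau_1^{(n)}$; (iii) the test $\phi^{(n)}_{p_0}(\hat a^{(n)},\hat b^{(n)})$, which rejects the null hypothesis $\mathcal H_0:=\bigcup_{a>0}\bigcup_{b>0}\mathrm{P}^{(n)}_{p_0,a,b}$ whenever $|Q^{(n)\mathrm{eff}}_{p_0}(\hat a^{(n)},\hat b^{(n)})|>z_{\alpha/2}$,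 has asymptotic level $\alpha$ under $\mathcal H_0$ and is locally and asymptotically maximin (in the sense given in the context) for testing $\mathcal H_0: p=p_0$ against $\mathcal H_1^{\neq}:=\bigcup_{a>0}\bigcup_{b>0}\bigcup_{p\neq p_0}\mathrm{P}^{(n)}_{p,a,b}$.
   Context: GIG model. $\mathrm{GIG}(p,a,b)$ ($p\in\mathbb{R}$, $a,b>0$) has density $\frac{(a/b)^{p/2}}{2K_p(\sqrt{ab})}x^{p-1}e^{-(ax+b/x)/2}$, $x>0$, where $K_p(z)=\frac12\int_0^\infty t^{p-1}e^{-z(t+1/t)/2}dt$ is the modified Bessel function of the third kind. $\mathrm{P}^{(n)}_{p,a,b}$ is the joint law of $n$ i.i.d. $\mathrm{GIG}(p,a,b)$ observations $X_1,\dots,X_n$. Write $\vartheta=(p,a,b)'$; partial derivatives below are those of $(p,a,b)\mapsto\log K_p(\sqrt{ab})$. Central sequence: $\Delta^{(n)}_p(\vartheta)=n^{-1/2}\sum_{i=1}^n\left(\frac12\log(a/b)-\partial_p\log K_p(\sqrt{ab})+\log X_i\right)$, $\Delta^{(n)}_a(\vartheta)=n^{-1/2}\sum_{i=1}^n\left(\frac p{2a}-\partial_a\log K_p(\sqrt{ab})-\frac{X_i}2\right)$, $\Delta^{(n)}_b(\vartheta)=n^{-1/2}\sum_{i=1}^n\left(-\frac p{2b}-\partial_b\log K_p(\sqrt{ab})-\frac1{2X_i}\right)$. Fisher information matrix $\Gamma(\vartheta)$ (symmetric, rows and columns indexed by $p,a,b$): $\Gamma_{p,p}=\partial^2_{pp}\log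 K_p(\sqrt{ab})$, $\Gamma_{a,a}=\frac p{2a^2}+\partial^2_{aa}\log K_p(\sqrt{ab})$, $\Gamma_{b,b}=-\frac p{2b^2}+\partial^2_{bb}\log K_p(\sqrt{ab})$, $\Gamma_{p,a}=-\frac1{2a}+\partial^2_{ap}\log K_p(\sqrt{ab})$, $\Gamma_{p,b}=\frac1{2b}+\partial^2_{bp}\log K_p(\sqrt{ab})$, $\Gamma_{a,b}=\partial^2_{ab}\log K_p(\sqrt{ab})$. Efficient central sequence and information for $p$ (all $\Gamma$'s and $\Delta$'s evaluated at $\vartheta$): $$\Delta^{(n)\mathrm{eff}}_p(\vartheta)=\Delta^{(n)}_p-\frac{(\Gamma_{p,a},\Gamma_{p,b})\begin{pmatrix}\Gamma_{b,b}&-\Gamma_{a,b}\\-\Gamma_{a,b}&\Gamma_{a,a}\end{pmatrix}(\Delta^{(n)}_a,\Delta^{(n)}_b)'}{\Gamma_{a,a}\Gamma_{b,b}-\Gamma_{a,b}^2},\qquad \Gamma^{\mathrm{eff}}_{p,p}(\vartheta)=\frac{\det\Gamma(\vartheta)}{\Gamma_{a,a}\Gamma_{b,b}-\Gamma_{a,b}^2}.$$ Assumption A. The sequences of $(0,\infty)$-valued estimators $\hat a^{(n)},\hat b^{(n)}$ (measurable functions of $X_1,\dots,X_n$) are (i) root-$n$ consistent: for all $a,b>0$, $n^{1/2}(\hat a^{(n)}-a)=O_{\mathrm P}(1)$ and $n^{1/2}(\hat b^{(n)}-b)=O_{\mathrm P}(1)$ as $n\to\infty$ under $\mathrm{P}^{(n)}_{p_0,a,b}$;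 and (ii) locally asymptotically discrete: for all $a,b>0$ and all $c>0$ there exists $M=M(c)>0$ such that the number of possible values of $\hat a^{(n)}$ in $\{t\in\mathbb{R}:n^{1/2}|t-a|\le c\}$ and of $\hat b^{(n)}$ in $\{t\in\mathbb{R}:n^{1/2}|t-b|\le c\}$ is bounded by $M$, uniformly as $n\to\infty$. Asymptotic level $\alpha$ under $\mathcal H_0$ means that for all $a,b>0$ the rejection probability under $\mathrm{P}^{(n)}_{p_0,a,b}$ converges to $\alpha$. Locally and asymptotically maximin at level $\alpha$. For $a,b>0$ and $\tau=(\tau_1,\tau_2,\tau_3)'\in\mathbb{R}^3$ let $\mathrm{E}^{(n)}_{\tau}$ be expectation under $\mathrm{P}^{(n)}_{(p_0,a,b)'+n^{-1/2}\tau}$ (defined for $n$ large). For fixed $a,b$, let $\mathcal C_\alpha$ be the class of sequences of tests $\psi^{(n)}$ (with values in $[0,1]$) such that $\limsup_{n\to\infty}\mathrm{E}^{(n)}_{(0,\tau_2,\tau_3)'}[\psi^{(n)}]\le\alpha$ for all $\tau_2,\tau_3\in\mathbb{R}$. A sequence of tests $\phi^{(n)}$ is locally and asymptotically maximin for $p=p_0$ against $p\neq p_0$ if, for all $a,b>0$, it belongs to $\mathcal C_\alpha$ and, for every $\delta>0$ and every $(\psi^{(n)})\in\mathcal C_\alpha$, $\inf_{\tau:|\tau_1|\ge\delta}\liminf_{n\to\infty}\mathrm{E}^{(n)}_\tau[\phi^{(n)}]\ \ge\ \inf_{\tau:|\tau_1|\ge\delta}\liminf_{n\to\infty}\mathrm{E}^{(n)}_\tau[\psi^{(n)}]$.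 *)

theory Defs
  imports "HOL-Probability.Probability"
begin

definition besselK :: "real \<Rightarrow> real \<Rightarrow> real" where
  "besselK p z = (1/2) * (LBINT t:{0<..}. t powr (p - 1) * exp (- z * (t + 1 / t) / 2))"

definition gig_density :: "real \<Rightarrow> real \<Rightarrow> real \<Rightarrow> real \<Rightarrow> real" where
  "gig_density p a b x =
     (a / b) powr (p / 2) / (2 * besselK p (sqrt (a * b)))
       * x powr (p - 1) * exp (- (a * x + b / x) / 2)"

text \<open>The observation space is the open half line, so that estimators and tests are functions
  on the positive orthant only; observations are indexed by \<open>0, \<dots>, n - 1\<close>.\<close>

definition sample_space :: "nat \<Rightarrow> (nat \<Rightarrow> real) measure" where
  "sample_space n = PiM {..<n} (\<lambda>_. restrict_space borel {0<..})"

definition gig :: "real \<Rightarrow> real \<Rightarrow> real \<Rightarrow> real measure" where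
  "gig p a b = density (restrict_space lborel {0<..}) (\<lambda>x. ennreal (gig_density p a b x))"

definition gig_sample :: "nat \<Rightarrow> real \<Rightarrow> real \<Rightarrow> real \<Rightarrow> (nat \<Rightarrow> real) measure" where
  "gig_sample n p a b = PiM {..<n} (\<lambda>_. gig p a b)"

definition logK :: "real \<Rightarrow> real \<Rightarrow> real \<Rightarrow> real" where
  "logK p a b = ln (besselK p (sqrt (a * b)))"


definition Delta_p :: "nat \<Rightarrow> real \<Rightarrow> real \<Rightarrow> real \<Rightarrow> (nat \<Rightarrow> real) \<Rightarrow> real" where
  "Delta_p n p a b x =
     (\<Sum>i<n. ln (a / b) / 2 - deriv (\<lambda>q. logK q a b) p + ln (x i)) / sqrt (real n)"

definition Delta_a :: "nat \<Rightarrow> real \<Rightarrow> real \<Rightarrow> real \<Rightarrow> (nat \<Rightarrow> real) \<Rightarrow> real" where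
  "Delta_a n p a b x =
     (\<Sum>i<n. p / (2 * a) - deriv (\<lambda>s. logK p s b) a - x i / 2) / sqrt (real n)"

definition Delta_b :: "nat \<Rightarrow> real \<Rightarrow> real \<Rightarrow> real \<Rightarrow> (nat \<Rightarrow> real) \<Rightarrow> real" where
  "Delta_b n p a b x =
     (\<Sum>i<n. - p / (2 * b) - deriv (\<lambda>s. logK p a s) b - 1 / (2 * x i)) / sqrt (real n)"


definition Gamma_pp :: "real \<Rightarrow> real \<Rightarrow> real \<Rightarrow> real" where
  "Gamma_pp p a b = deriv (\<lambda>q. deriv (\<lambda>r. logK r a b) q) p"

definition Gamma_aa :: "real \<Rightarrow> real \<Rightarrow> real \<Rightarrow> real" where
  "Gamma_aa p a b = p / (2 * a\<^sup>2) + deriv (\<lambda>s. deriv (\<lambda>t. logK p t b) s) a"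

definition Gamma_bb :: "real \<Rightarrow> real \<Rightarrow> real \<Rightarrow> real" where
  "Gamma_bb p a b = - p / (2 * b\<^sup>2) + deriv (\<lambda>s. deriv (\<lambda>t. logK p a t) s) b"

definition Gamma_pa :: "real \<Rightarrow> real \<Rightarrow> real \<Rightarrow> real" where
  "Gamma_pa p a b = - 1 / (2 * a) + deriv (\<lambda>s. deriv (\<lambda>q. logK q s b) p) a"

definition Gamma_pb :: "real \<Rightarrow> real \<Rightarrow> real \<Rightarrow> real" where
  "Gamma_pb p a b = 1 / (2 * b) + deriv (\<lambda>s. deriv (\<lambda>q. logK q a s) p) b"

definition Gamma_ab :: "real \<Rightarrow> real \<Rightarrow> real \<Rightarrow> real" where
  "Gamma_ab p a b = deriv (\<lambda>s. deriv (\<lambda>t. logK p s t) b) a"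

definition fisher_info :: "real \<Rightarrow> real \<Rightarrow> real \<Rightarrow> real ^ 3 ^ 3" where
  "fisher_info p a b = vector
     [vector [Gamma_pp p a b, Gamma_pa p a b, Gamma_pb p a b],
      vector [Gamma_pa p a b, Gamma_aa p a b, Gamma_ab p a b],
      vector [Gamma_pb p a b, Gamma_ab p a b, Gamma_bb p a b]]"


definition Delta_eff :: "nat \<Rightarrow> real \<Rightarrow> real \<Rightarrow> real \<Rightarrow> (nat \<Rightarrow> real) \<Rightarrow> real" where
  "Delta_eff n p a b x = Delta_p n p a b x -
     ((vector [Gamma_pa p a b, Gamma_pb p a b] :: real ^ 2) \<bullet>
        ((vector [vector [Gamma_bb p a b, - Gamma_ab p a b],
                  vector [- Gamma_ab p a b, Gamma_aa p a b]] :: real ^ 2 ^ 2)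
         *v vector [Delta_a n p a b x, Delta_b n p a b x]))
     / (Gamma_aa p a b * Gamma_bb p a b - (Gamma_ab p a b)\<^sup>2)"

definition Gamma_eff :: "real \<Rightarrow> real \<Rightarrow> real \<Rightarrow> real" where
  "Gamma_eff p a b =
     det (fisher_info p a b) / (Gamma_aa p a b * Gamma_bb p a b - (Gamma_ab p a b)\<^sup>2)"

definition Q_eff :: "nat \<Rightarrow> real \<Rightarrow> real \<Rightarrow> real \<Rightarrow> (nat \<Rightarrow> real) \<Rightarrow> real" where
  "Q_eff n p a b x = Delta_eff n p a b x / sqrt (Gamma_eff p a b)"


definition bounded_in_prob ::
    "(nat \<Rightarrow> 'a measure) \<Rightarrow> (nat \<Rightarrow> 'a \<Rightarrow> real) \<Rightarrow> bool" where
  "bounded_in_prob M X \<longleftrightarrow>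
     (\<forall>\<epsilon>>0. \<exists>C. \<forall>\<^sub>F n in sequentially. measure (M n) {x \<in> space (M n). \<bar>X n x\<bar> > C} \<le> \<epsilon>)"

definition estimator_seq :: "(nat \<Rightarrow> (nat \<Rightarrow> real) \<Rightarrow> real) \<Rightarrow> bool" where
  "estimator_seq T \<longleftrightarrow>
     (\<forall>n. T n \<in> borel_measurable (sample_space n) \<and> (\<forall>x\<in>space (sample_space n). T n x > 0))"

definition root_n_consistent ::
    "real \<Rightarrow> (nat \<Rightarrow> (nat \<Rightarrow> real) \<Rightarrow> real) \<Rightarrow> (nat \<Rightarrow> (nat \<Rightarrow> real) \<Rightarrow> real) \<Rightarrow> bool" where
  "root_n_consistent p0 ahat bhat \<longleftrightarrow>
     (\<forall>a>0. \<forall>b>0.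
        bounded_in_prob (\<lambda>n. gig_sample n p0 a b) (\<lambda>n x. sqrt (real n) * (ahat n x - a)) \<and>
        bounded_in_prob (\<lambda>n. gig_sample n p0 a b) (\<lambda>n x. sqrt (real n) * (bhat n x - b)))"

definition local_values ::
    "(nat \<Rightarrow> (nat \<Rightarrow> real) \<Rightarrow> real) \<Rightarrow> real \<Rightarrow> real \<Rightarrow> nat \<Rightarrow> real set" where
  "local_values T \<theta> c n =
     T n ` space (sample_space n) \<inter> {t. sqrt (real n) * \<bar>t - \<theta>\<bar> \<le> c}"

text \<open>The bound is required for all sufficiently large \<open>n\<close>. Finiteness is stated
  separately because \<open>card\<close> is zero on infinite sets.\<close>

definition locally_discrete ::
    "(nat \<Rightarrow> (nat \<Rightarrow> real) \<Rightarrow> real) \<Rightarrow> (nat \<Rightarrow> (nat \<Rightarrow> real) \<Rightarrow> real) \<Rightarrow> bool" where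
  "locally_discrete ahat bhat \<longleftrightarrow>
     (\<forall>a>0. \<forall>b>0. \<forall>c>0. \<exists>M>0. \<forall>\<^sub>F n in sequentially.
        finite (local_values ahat a c n) \<and> real (card (local_values ahat a c n)) \<le> M \<and>
        finite (local_values bhat b c n) \<and> real (card (local_values bhat b c n)) \<le> M)"

definition assumption_A ::
    "real \<Rightarrow> (nat \<Rightarrow> (nat \<Rightarrow> real) \<Rightarrow> real) \<Rightarrow> (nat \<Rightarrow> (nat \<Rightarrow> real) \<Rightarrow> real) \<Rightarrow> bool" where
  "assumption_A p0 ahat bhat \<longleftrightarrow>
     estimator_seq ahat \<and> estimator_seq bhat \<and>
     root_n_consistent p0 ahat bhat \<and> locally_discrete ahat bhat"


text \<open>Convergence in distribution of \<open>X n\<close> under \<open>M n\<close> to the normal law with mean \<open>\<mu>\<close> and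
  standard deviation \<open>\<sigma>\<close>.\<close>

definition asymp_normal ::
    "(nat \<Rightarrow> 'a measure) \<Rightarrow> (nat \<Rightarrow> 'a \<Rightarrow> real) \<Rightarrow> real \<Rightarrow> real \<Rightarrow> bool" where
  "asymp_normal M X \<mu> \<sigma> \<longleftrightarrow>
     (\<forall>n. X n \<in> borel_measurable (M n)) \<and>
     weak_conv_m (\<lambda>n. distr (M n) borel (X n)) (density lborel (\<lambda>x. ennreal (normal_density \<mu> \<sigma> x)))"

definition normal_upper_quantile :: "real \<Rightarrow> real" where
  "normal_upper_quantile \<beta> = (THE z. measure std_normal_distribution {z<..} = \<beta>)"

definition test_seq :: "(nat \<Rightarrow> (nat \<Rightarrow> real) \<Rightarrow> real) \<Rightarrow> bool" where
  "test_seq \<psi> \<longleftrightarrow>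
     (\<forall>n. \<psi> n \<in> borel_measurable (sample_space n) \<and>
          (\<forall>x\<in>space (sample_space n). 0 \<le> \<psi> n x \<and> \<psi> n x \<le> 1))"

definition phi_test ::
    "real \<Rightarrow> real \<Rightarrow> (nat \<Rightarrow> (nat \<Rightarrow> real) \<Rightarrow> real) \<Rightarrow> (nat \<Rightarrow> (nat \<Rightarrow> real) \<Rightarrow> real)
      \<Rightarrow> nat \<Rightarrow> (nat \<Rightarrow> real) \<Rightarrow> real" where
  "phi_test \<alpha> p0 ahat bhat n x =
     (if \<bar>Q_eff n p0 (ahat n x) (bhat n x) x\<bar> > normal_upper_quantile (\<alpha> / 2) then 1 else 0)"

definition has_asymptotic_level ::
    "real \<Rightarrow> real \<Rightarrow> (nat \<Rightarrow> (nat \<Rightarrow> real) \<Rightarrow> real) \<Rightarrow> bool" where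
  "has_asymptotic_level \<alpha> p0 \<phi> \<longleftrightarrow>
     (\<forall>a>0. \<forall>b>0. (\<lambda>n. integral\<^sup>L (gig_sample n p0 a b) (\<phi> n)) \<longlonglongrightarrow> \<alpha>)"

text \<open>The local parameters need not be positive for small \<open>n\<close>; only upper and lower limits in
  \<open>n\<close> of the following quantity are used.\<close>

definition local_expectation ::
    "real \<Rightarrow> real \<Rightarrow> real \<Rightarrow> real ^ 3 \<Rightarrow> nat \<Rightarrow> ((nat \<Rightarrow> real) \<Rightarrow> real) \<Rightarrow> real" where
  "local_expectation p0 a b \<tau> n f =
     integral\<^sup>L (gig_sample n (p0 + \<tau> $ 1 / sqrt (real n))
       (a + \<tau> $ 2 / sqrt (real n)) (b + \<tau> $ 3 / sqrt (real n))) f"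

definition level_class ::
    "real \<Rightarrow> real \<Rightarrow> real \<Rightarrow> real \<Rightarrow> (nat \<Rightarrow> (nat \<Rightarrow> real) \<Rightarrow> real) set" where
  "level_class \<alpha> p0 a b =
     {\<psi>. test_seq \<psi> \<and>
        (\<forall>\<tau>2 \<tau>3. limsup (\<lambda>n. ereal (local_expectation p0 a b (vector [0, \<tau>2, \<tau>3]) n (\<psi> n))) \<le> ereal \<alpha>)}"

definition maximin_power ::
    "real \<Rightarrow> real \<Rightarrow> real \<Rightarrow> real \<Rightarrow> (nat \<Rightarrow> (nat \<Rightarrow> real) \<Rightarrow> real) \<Rightarrow> ereal" where
  "maximin_power p0 a b \<delta> \<psi> =
     (INF \<tau>\<in>{\<tau> :: real ^ 3. \<bar>\<tau> $ 1\<bar> \<ge> \<delta>}. liminf (\<lambda>n. ereal (local_expectation p0 a b \<tau> n (\<psi> n))))"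

definition locally_asymptotically_maximin ::
    "real \<Rightarrow> real \<Rightarrow> (nat \<Rightarrow> (nat \<Rightarrow> real) \<Rightarrow> real) \<Rightarrow> bool" where
  "locally_asymptotically_maximin \<alpha> p0 \<phi> \<longleftrightarrow>
     (\<forall>a>0. \<forall>b>0. \<phi> \<in> level_class \<alpha> p0 a b \<and>
        (\<forall>\<delta>>0. \<forall>\<psi>\<in>level_class \<alpha> p0 a b. maximin_power p0 a b \<delta> \<phi> \<ge> maximin_power p0 a b \<delta> \<psi>))"

end

theory Submission
  imports Defs
begin

text \<open>
  The GIG laws form a three-parameter exponential family with natural parameter \<open>(p, a, b)\<close> and
  statistic \<open>(ln x, - x / 2, - 1 / (2 x))\<close> over the base measure \<open>dx / x\<close>, and \<open>\<Gamma>\<close> is the Hessian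
  of the log normaliser, i.e. the covariance of the statistic. So the central sequence \<open>S\<close> is the
  centred and scaled sufficient statistic, local likelihood ratios are exactly \<open>exp (h \<bullet> S - c)\<close>
  with \<open>c\<close> tending to \<open>h \<bullet> \<Gamma> h / 2\<close>, their second moments stay bounded (whence contiguity), and
  \<open>S\<close> is asymptotically normal with mean \<open>\<Gamma> h\<close> under local alternatives.

  The efficient score is \<open>v \<bullet> S\<close> with \<open>\<Gamma> v\<close> proportional to the first unit vector. Replacing
  \<open>(a, b)\<close> by estimators moves \<open>S\<close> by \<open>\<Gamma> \<eta>\<close> up to a negligible term, where \<open>\<eta>\<close> has first component
  zero; hence \<open>v \<bullet> \<Gamma> \<eta> = 0\<close> and, the direction \<open>v\<close> being continuous in the parameter, the plug-in
  costs nothing under the null and, by contiguity, under local alternatives. The maximin bound is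
  the Neyman--Pearson lemma for the null point against the symmetric mixture of two alternatives
  along \<open>v\<close>.
\<close>

section \<open>Exponential families\<close>

text \<open>The parameter enters the score only through the deterministic vector
  \<open>mean\<close>, so moving the centre changes the score by a nonrandom amount. An estimator
  can therefore be inserted pointwise in the sample, and the expansion at a random argument reduces
  to differentiability of \<open>mean\<close> at one point, on an event of probability close to one
  where the score and the scaled estimation error are bounded. The other obstacle is that under
  local alternatives the law of one observation changes with n, so a limit theorem for one fixed law
  does not apply. The characteristic function of a single observation is expanded instead, with a
  remainder that depends on the parameter only through continuous quantities. Recentring at the true
  parameter then yields the limit mean directly, and contiguity only has to carry the negligibility
  of the plug-in error from the null to the alternatives. Positive definiteness of the information,
  which makes the efficient information positive, rests on the linear independence of 1, ln x, x and
  1 / x on the half line.\<close>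

lemma power_one_plus_le_exp:
  fixes r y :: real
  assumes "0 < r" "0 \<le> y"
  shows "(1 + y) ^ k \<le> fact k / r ^ k * exp r * exp (r * y)"
proof -
  \<comment> \<open>One term of the exponential series at r (1 + y) is at most the whole series. As
    r is arbitrary, a polynomial factor costs only an arbitrarily small exponential rate; both the
    moments of the statistic and the GIG kernel are dominated in this way.\<close>
  have "(r * (1 + y)) ^ k / fact k \<le> exp (r * (1 + y))"
  proof -
    have s: "(\<lambda>n. (r * (1 + y)) ^ n / fact n) sums exp (r * (1 + y))"
      using exp_converges[of "r * (1 + y)"] by (simp add: divide_inverse_commute)
    have "sum (\<lambda>n. (r * (1 + y)) ^ n / fact n) {k} \<le> exp (r * (1 + y))"
      unfolding sums_unique[OF s]
      by (rule sum_le_suminf[OF sums_summable[OF s]]) (use assms in auto)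
    then show ?thesis by simp
  qed
  then show ?thesis
    using assms unfolding power_mult_distrib by (simp add: divide_simps distrib_left exp_add mult_ac)
qed

text \<open>The intermediate point of the Lagrange remainder is at most |y| in absolute value, which
  is where exp |y| comes from. This is the pointwise error when an exponential integral is
  differentiated.\<close>

lemma abs_exp_minus_linear_le:
  fixes y :: real
  shows "\<bar>exp y - 1 - y\<bar> \<le> y\<^sup>2 * exp \<bar>y\<bar>"
proof -
  obtain t where t: "\<bar>t\<bar> \<le> \<bar>y\<bar>" "exp y = (\<Sum>m<2. y ^ m / fact m) + exp t / fact 2 * y ^ 2"
    using Maclaurin_exp_le[of y 2] by auto
  have "exp y - 1 - y = exp t / 2 * y\<^sup>2"
    using t(2) by (simp add: numeral_2_eq_2)
  moreover have "exp t / 2 \<le> exp \<bar>y\<bar>"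
  proof -
    have "exp t \<le> exp \<bar>y\<bar>" using t(1) by simp
    then show ?thesis using exp_gt_zero[of "\<bar>y\<bar>"] by linarith
  qed
  ultimately show ?thesis
    by (simp only: abs_mult abs_power2 abs_divide abs_exp_cancel abs_numeral)
       (subst mult.commute, rule mult_left_mono, auto)
qed

lemma norm_integral_le:
  fixes f :: "'a \<Rightarrow> 'b::{banach, second_countable_topology}"
  assumes "integrable M f" "integrable M g" "AE x in M. norm (f x) \<le> g x"
  shows "norm (\<integral>x. f x \<partial>M) \<le> (\<integral>x. g x \<partial>M)"
  using integral_norm_bound[of M f]
    integral_mono_AE[OF integrable_norm[OF assms(1)] assms(2,3)] by linarith

lemma tendsto_imp_norm_bound:
  fixes X :: "nat \<Rightarrow> 'v::real_normed_vector"
  assumes "X \<longlonglongrightarrow> l"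
  shows "\<exists>K>0. \<forall>n. norm (X n) \<le> K"
  using convergent_imp_Bseq[OF convergentI[OF assms]] by (elim BseqE) blast

lemma sqrt_scaled_imp_null:
  fixes t :: "nat \<Rightarrow> 'v::real_normed_vector"
  assumes "(\<lambda>n. sqrt (real n) *\<^sub>R t n) \<longlonglongrightarrow> h"
  shows "t \<longlonglongrightarrow> 0"
proof -
  have "(\<lambda>n. inverse (sqrt (real n))) \<longlonglongrightarrow> 0"
    by (intro tendsto_inverse_0_at_top filterlim_compose[OF sqrt_at_top] filterlim_real_sequentially)
  from tendsto_scaleR[OF this assms]
  have "(\<lambda>n. inverse (sqrt (real n)) *\<^sub>R sqrt (real n) *\<^sub>R t n) \<longlonglongrightarrow> 0" by simp
  then show ?thesis
    by (rule Lim_transform_eventually) (auto intro!: eventually_sequentiallyI[of 1])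
qed

text \<open>A delta method for deterministic sequences: the first-order error is of smaller order
  than the increment, and the factor sqrt n keeps it small because the scaled increments converge
  and are therefore bounded.\<close>

lemma has_derivative_sqrt_scaled_limit:
  fixes f :: "'v::real_normed_vector \<Rightarrow> 'b::real_normed_vector"
  assumes f: "(f has_derivative f') (at \<theta>)"
    and lim: "(\<lambda>n. sqrt (real n) *\<^sub>R (t n - \<theta>)) \<longlonglongrightarrow> h"
  shows "(\<lambda>n. sqrt (real n) *\<^sub>R (f (t n) - f \<theta>)) \<longlonglongrightarrow> f' h"
proof -
  have bl: "bounded_linear f'" using f by (rule has_derivative_bounded_linear)
  obtain K where K: "K > 0" "\<And>n. norm (sqrt (real n) *\<^sub>R (t n - \<theta>)) \<le> K"
    using tendsto_imp_norm_bound[OF lim] by blast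
  have t: "(\<lambda>n. t n - \<theta>) \<longlonglongrightarrow> 0" by (rule sqrt_scaled_imp_null[OF lim])
  have "(\<lambda>n. sqrt (real n) *\<^sub>R (f (t n) - f \<theta>) - f' (sqrt (real n) *\<^sub>R (t n - \<theta>))) \<longlonglongrightarrow> 0"
  proof (rule tendstoI)
    fix e :: real assume e: "e > 0"
    then have "e / (2 * K) > 0" using K by simp
    then obtain d where d: "d > 0" "\<And>y. norm (y - \<theta>) < d \<Longrightarrow>
        norm (f y - f \<theta> - f' (y - \<theta>)) \<le> e / (2 * K) * norm (y - \<theta>)"
      using f unfolding has_derivative_at_alt by blast
    have "\<forall>\<^sub>F n in sequentially. norm (t n - \<theta>) < d"
      using tendstoD[OF t d(1)] by simp
    then show "\<forall>\<^sub>F n in sequentially.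
        dist (sqrt (real n) *\<^sub>R (f (t n) - f \<theta>) - f' (sqrt (real n) *\<^sub>R (t n - \<theta>))) 0 < e"
    proof eventually_elim
      case (elim n)
      have "norm (sqrt (real n) *\<^sub>R (f (t n) - f \<theta>) - f' (sqrt (real n) *\<^sub>R (t n - \<theta>)))
          = sqrt (real n) * norm (f (t n) - f \<theta> - f' (t n - \<theta>))"
        by (simp add: linear_cmul[OF bounded_linear.linear[OF bl]] flip: scaleR_diff_right)
      also have "\<dots> \<le> sqrt (real n) * (e / (2 * K) * norm (t n - \<theta>))"
        by (intro mult_left_mono d elim) auto
      also have "\<dots> = e / (2 * K) * norm (sqrt (real n) *\<^sub>R (t n - \<theta>))" by simp
      also have "\<dots> \<le> e / (2 * K) * K" using e K by (intro mult_left_mono) auto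
      also have "\<dots> < e" using e K by simp
      finally show ?case by simp
    qed
  qed
  from tendsto_add[OF this bounded_linear.tendsto[OF bl lim]] show ?thesis by simp
qed

section \<open>Exponential moments and differentiation under the integral\<close>

text \<open>Openness of \<open>\<Theta>\<close> lets a parameter be moved a little in every
  direction, which gives the norm of T an exponential moment; the nonzero base measure makes the
  normaliser positive.\<close>

locale exponential_family =
  fixes \<nu> :: "'a measure" and T :: "'a \<Rightarrow> 'v::euclidean_space" and \<Theta> :: "'v set"
  assumes T_measurable [measurable]: "T \<in> borel_measurable \<nu>"
    and open_\<Theta>: "open \<Theta>"
    and integrable_exp: "\<theta> \<in> \<Theta> \<Longrightarrow> integrable \<nu> (\<lambda>x. exp (\<theta> \<bullet> T x))"
    and base_nonzero: "emeasure \<nu> (space \<nu>) \<noteq> 0"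
begin

text \<open>The norm is at most d times the largest absolute coordinate, so exp (s |y|) is dominated
  by the sum of the exponentials of the 2 d linear forms along the vectors d s b and - d s b. Each
  of these merely shifts the parameter inside \<open>\<Theta>\<close>.\<close>

lemma integrable_exp_norm:
  assumes "\<theta> \<in> \<Theta>"
  shows "\<exists>r>0::real. ball \<theta> r \<subseteq> \<Theta> \<and>
    (\<forall>k. integrable \<nu> (\<lambda>x. (1 + norm (T x)) ^ k * exp (\<theta> \<bullet> T x + r * norm (T x))))"
proof -
  obtain \<rho> where \<rho>: "\<rho> > 0" "ball \<theta> \<rho> \<subseteq> \<Theta>"
    using open_\<Theta> assms open_contains_ball by blast
  define d where "d = real DIM('v)"
  have d: "d \<ge> 1" unfolding d_def using DIM_positive[where 'a='v] by linarith
  \<comment> \<open>d * s is half the radius, so the shifted parameters stay in the ball. Taking r =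
    s / 2 leaves the other half of the rate to absorb the polynomial factor.\<close>
  define s where "s = \<rho> / (2 * d)"
  define r where "r = s / 2"
  have s: "s > 0" "d * s < \<rho>" using \<rho> d by (auto simp: s_def field_simps)
  have "1 * s \<le> d * s" using d s(1) by (intro mult_right_mono) auto
  then have r: "r > 0" "r < \<rho>" unfolding r_def using s by linarith+
  have exp_norm_le: "exp (s * norm y) \<le> (\<Sum>b\<in>Basis. exp (((d * s) *\<^sub>R b) \<bullet> y) + exp (- ((d * s) *\<^sub>R b) \<bullet> y))"
    for y :: 'v
  proof -
    have "\<exists>b\<in>Basis. norm y \<le> d * \<bar>y \<bullet> b\<bar>"
    proof (rule ccontr)
      assume "\<not> ?thesis"
      then have *: "\<And>b. b \<in> Basis \<Longrightarrow> d * \<bar>y \<bullet> b\<bar> < norm y" by force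
      have "(\<Sum>b\<in>(Basis::'v set). d * \<bar>y \<bullet> b\<bar>) < (\<Sum>b\<in>(Basis::'v set). norm y)"
        by (rule sum_strict_mono) (use * in auto)
      then have "d * (\<Sum>b\<in>Basis. \<bar>y \<bullet> b\<bar>) < d * norm y" by (simp add: sum_distrib_left d_def)
      moreover have "norm y \<le> (\<Sum>b\<in>Basis. \<bar>y \<bullet> b\<bar>)" by (rule norm_le_l1)
      ultimately show False using d by (smt (verit) mult_left_mono)
    qed
    then obtain b where b: "b \<in> Basis" "norm y \<le> d * \<bar>y \<bullet> b\<bar>" by blast
    have "exp (s * norm y) \<le> exp (d * s * \<bar>b \<bullet> y\<bar>)"
      using b(2) s(1) by (simp add: inner_commute mult.commute mult.left_commute)
    also have "\<dots> \<le> exp (((d * s) *\<^sub>R b) \<bullet> y) + exp (- ((d * s) *\<^sub>R b) \<bullet> y)"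
      by (cases "b \<bullet> y \<ge> 0") (auto simp: add_increasing add_increasing2)
    also have "\<dots> \<le> (\<Sum>b\<in>Basis. exp (((d * s) *\<^sub>R b) \<bullet> y) + exp (- ((d * s) *\<^sub>R b) \<bullet> y))"
      by (rule member_le_sum[where f = "\<lambda>b. exp (((d * s) *\<^sub>R b) \<bullet> y) + exp (- ((d * s) *\<^sub>R b) \<bullet> y)"])
         (use b(1) in \<open>auto simp: add_nonneg_nonneg\<close>)
    finally show ?thesis .
  qed
  have int_s: "integrable \<nu> (\<lambda>x. \<Sum>b\<in>Basis. exp ((\<theta> + (d * s) *\<^sub>R b) \<bullet> T x) + exp ((\<theta> - (d * s) *\<^sub>R b) \<bullet> T x))"
  proof (intro Bochner_Integration.integrable_sum Bochner_Integration.integrable_add integrable_exp)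
    fix b :: 'v assume "b \<in> Basis"
    then have "norm ((d * s) *\<^sub>R b) < \<rho>" using s d by simp
    then show "\<theta> + (d * s) *\<^sub>R b \<in> \<Theta>" "\<theta> - (d * s) *\<^sub>R b \<in> \<Theta>"
      using \<rho>(2) by (auto simp: subset_eq dist_norm)
  qed
  have "integrable \<nu> (\<lambda>x. (1 + norm (T x)) ^ k * exp (\<theta> \<bullet> T x + r * norm (T x)))" for k
  proof (rule Bochner_Integration.integrable_bound)
    show "integrable \<nu> (\<lambda>x. (fact k / r ^ k * exp r) *
        (\<Sum>b\<in>Basis. exp ((\<theta> + (d * s) *\<^sub>R b) \<bullet> T x) + exp ((\<theta> - (d * s) *\<^sub>R b) \<bullet> T x)))"
      using int_s by simp
    show "AE x in \<nu>. norm ((1 + norm (T x)) ^ k * exp (\<theta> \<bullet> T x + r * norm (T x)))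
        \<le> norm ((fact k / r ^ k * exp r) *
        (\<Sum>b\<in>Basis. exp ((\<theta> + (d * s) *\<^sub>R b) \<bullet> T x) + exp ((\<theta> - (d * s) *\<^sub>R b) \<bullet> T x)))"
    proof (rule AE_I2)
      fix x
      have "(1 + norm (T x)) ^ k * exp (\<theta> \<bullet> T x + r * norm (T x))
        \<le> (fact k / r ^ k * exp r * exp (r * norm (T x))) * exp (\<theta> \<bullet> T x + r * norm (T x))"
        by (intro mult_right_mono power_one_plus_le_exp r) auto
      also have "\<dots> = (fact k / r ^ k * exp r) * (exp (\<theta> \<bullet> T x) * exp (s * norm (T x)))"
        by (simp add: r_def flip: exp_add)
      also have "\<dots> \<le> (fact k / r ^ k * exp r) * (exp (\<theta> \<bullet> T x) *
          (\<Sum>b\<in>Basis. exp (((d * s) *\<^sub>R b) \<bullet> T x) + exp (- ((d * s) *\<^sub>R b) \<bullet> T x)))"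
        by (intro mult_left_mono exp_norm_le) (use r in auto)
      also have "\<dots> = (fact k / r ^ k * exp r) *
        (\<Sum>b\<in>Basis. exp ((\<theta> + (d * s) *\<^sub>R b) \<bullet> T x) + exp ((\<theta> - (d * s) *\<^sub>R b) \<bullet> T x))"
        by (simp add: sum_distrib_left exp_add[symmetric] inner_add_left inner_diff_left distrib_left)
      finally show "norm ((1 + norm (T x)) ^ k * exp (\<theta> \<bullet> T x + r * norm (T x)))
        \<le> norm ((fact k / r ^ k * exp r) *
        (\<Sum>b\<in>Basis. exp ((\<theta> + (d * s) *\<^sub>R b) \<bullet> T x) + exp ((\<theta> - (d * s) *\<^sub>R b) \<bullet> T x)))"
        unfolding real_norm_def by (intro order_trans[OF _ abs_ge_self]) simp
    qed
  qed auto
  moreover have "ball \<theta> r \<subseteq> \<Theta>" using \<rho>(2) r by (auto simp: subset_eq)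
  ultimately show ?thesis using r by blast
qed

text \<open>The integrands whose moments may be differentiated. Differentiation multiplies an
  integrand by a linear form of T, and the class is closed under that, so the derivative formula can
  be iterated.\<close>

definition poly_growth :: "('a \<Rightarrow> 'b::{banach, second_countable_topology}) \<Rightarrow> bool" where
  "poly_growth g \<longleftrightarrow> g \<in> borel_measurable \<nu> \<and> (\<exists>C k. \<forall>x. norm (g x) \<le> C * (1 + norm (T x)) ^ k)"

lemma poly_growth_const: "poly_growth (\<lambda>_. c)"
  unfolding poly_growth_def by (auto intro!: exI[of _ "norm c"] exI[of _ "0::nat"])

lemma poly_growth_T: "poly_growth T"
  unfolding poly_growth_def by (auto intro!: exI[of _ 1])

lemma poly_growth_scaleR:
  fixes f :: "'a \<Rightarrow> real"
  assumes "poly_growth f" "poly_growth g"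
  shows "poly_growth (\<lambda>x. f x *\<^sub>R g x)"
proof -
  obtain C k C' k' where *: "\<And>x. norm (f x) \<le> C * (1 + norm (T x)) ^ k" "\<And>x. norm (g x) \<le> C' * (1 + norm (T x)) ^ k'"
    using assms unfolding poly_growth_def by blast
  have "norm (f x *\<^sub>R g x) \<le> (C * C') * (1 + norm (T x)) ^ (k + k')" for x
  proof -
    have "norm (f x *\<^sub>R g x) \<le> (C * (1 + norm (T x)) ^ k) * (C' * (1 + norm (T x)) ^ k')"
      unfolding norm_scaleR using *[of x] by (intro mult_mono) (auto intro: order_trans[OF norm_ge_zero] order_trans[OF abs_ge_zero])
    then show ?thesis by (simp add: power_add algebra_simps)
  qed
  then show ?thesis using assms unfolding poly_growth_def by auto
qed

lemma poly_growth_inner: "poly_growth (\<lambda>x. u \<bullet> T x)"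
  unfolding poly_growth_def
proof (intro conjI exI[of _ "norm u"] exI[of _ 1] allI)
  fix x show "norm (u \<bullet> T x) \<le> norm u * (1 + norm (T x)) ^ 1"
    using Cauchy_Schwarz_ineq2[of u "T x"] by (simp add: distrib_left) (smt (verit) norm_ge_zero)
qed auto

text \<open>Unnormalised moments. The normaliser, the mean and the covariance are all built from
  them, so one differentiation lemma serves all three.\<close>

definition expint :: "('a \<Rightarrow> 'b::{banach, second_countable_topology}) \<Rightarrow> 'v \<Rightarrow> 'b" where
  "expint g \<theta> = (\<integral>x. exp (\<theta> \<bullet> T x) *\<^sub>R g x \<partial>\<nu>)"

lemma integrable_poly_growth:
  assumes "\<theta> \<in> \<Theta>" "poly_growth g"
  shows "integrable \<nu> (\<lambda>x. exp (\<theta> \<bullet> T x) *\<^sub>R g x)"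
proof -
  obtain r where r: "r > 0" "ball \<theta> r \<subseteq> \<Theta>"
    "\<And>k. integrable \<nu> (\<lambda>x. (1 + norm (T x)) ^ k * exp (\<theta> \<bullet> T x + r * norm (T x)))"
    using integrable_exp_norm[OF assms(1)] by blast
  obtain C k where *: "\<And>x. norm (g x) \<le> C * (1 + norm (T x)) ^ k" 
    using assms(2) unfolding poly_growth_def by blast
  have [measurable]: "g \<in> borel_measurable \<nu>" using assms(2) unfolding poly_growth_def by blast
  show ?thesis
  proof (rule Bochner_Integration.integrable_bound)
    show "integrable \<nu> (\<lambda>x. C * ((1 + norm (T x)) ^ k * exp (\<theta> \<bullet> T x + r * norm (T x))))"
      using r(3)[of k] by simp
    show "AE x in \<nu>. norm (exp (\<theta> \<bullet> T x) *\<^sub>R g x) \<le>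
        norm (C * ((1 + norm (T x)) ^ k * exp (\<theta> \<bullet> T x + r * norm (T x))))"
    proof (rule AE_I2)
      fix x
      have "norm (exp (\<theta> \<bullet> T x) *\<^sub>R g x) \<le> exp (\<theta> \<bullet> T x + r * norm (T x)) * (C * (1 + norm (T x)) ^ k)"
        unfolding norm_scaleR using r(1) *[of x] by (intro mult_mono) auto
      then show "norm (exp (\<theta> \<bullet> T x) *\<^sub>R g x) \<le>
        norm (C * ((1 + norm (T x)) ^ k * exp (\<theta> \<bullet> T x + r * norm (T x))))"
        by (simp add: algebra_simps)
    qed
  qed auto
qed

text \<open>For norm u < r the pointwise error exp (u . T) - 1 - u . T is at most the square of norm
  u times a function free of u and integrable against the weight, so the remainder is quadratic in
  the increment.\<close>

lemma expint_has_derivative: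
  assumes \<theta>: "\<theta> \<in> \<Theta>" and g: "poly_growth g"
  shows "(expint g has_derivative (\<lambda>u. expint (\<lambda>x. (u \<bullet> T x) *\<^sub>R g x) \<theta>)) (at \<theta>)"
proof -
  obtain r where r: "r > 0" "ball \<theta> r \<subseteq> \<Theta>"
    "\<And>k. integrable \<nu> (\<lambda>x. (1 + norm (T x)) ^ k * exp (\<theta> \<bullet> T x + r * norm (T x)))"
    using integrable_exp_norm[OF assms(1)] by blast
  obtain C k where gC: "\<And>x. norm (g x) \<le> C * (1 + norm (T x)) ^ k" 
    using assms(2) unfolding poly_growth_def by blast
  \<comment> \<open>The growth bound holds at every point of the type, so evaluating it at any one
    of them shows that C is nonnegative.\<close>
  have "0 \<le> C * (1 + norm (T undefined)) ^ k" using gC[of undefined] norm_ge_zero order_trans by blast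
  moreover have "0 < (1 + norm (T undefined)) ^ k" by (intro zero_less_power) (simp add: add_pos_nonneg)
  ultimately have C: "C \<ge> 0" by (simp add: zero_le_mult_iff)
  have gm[measurable]: "g \<in> borel_measurable \<nu>" using assms(2) unfolding poly_growth_def by blast
  define B where "B = C * (\<integral>x. (1 + norm (T x)) ^ (k + 2) * exp (\<theta> \<bullet> T x + r * norm (T x)) \<partial>\<nu>)"
  have B: "B \<ge> 0" unfolding B_def using C by (intro mult_nonneg_nonneg Bochner_Integration.integral_nonneg) auto
  let ?D = "\<lambda>u. expint (\<lambda>x. (u \<bullet> T x) *\<^sub>R g x) \<theta>"
  have gu: "poly_growth (\<lambda>x. (u \<bullet> T x) *\<^sub>R g x)" for u
    by (intro poly_growth_scaleR poly_growth_inner g)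
  note int = integrable_poly_growth[OF _ g] integrable_poly_growth[OF \<theta> gu]
  have "linear ?D"
  proof (rule linearI)
    fix u v
    show "?D (u + v) = ?D u + ?D v"
      unfolding expint_def inner_add_left scaleR_add_left scaleR_add_right
      by (rule Bochner_Integration.integral_add[OF int(2) int(2)])
  next
    fix c u
    show "?D (c *\<^sub>R u) = c *\<^sub>R ?D u"
      unfolding expint_def inner_scaleR_left Bochner_Integration.integral_scaleR_right[symmetric]
      by (intro Bochner_Integration.integral_cong refl) (simp add: mult_ac)
  qed
  then have "bounded_linear ?D" by (simp add: linear_conv_bounded_linear)
  moreover have "\<exists>d>0. \<forall>y. norm (y - \<theta>) < d \<longrightarrow>
      norm (expint g y - expint g \<theta> - ?D (y - \<theta>)) \<le> e * norm (y - \<theta>)" if "e > 0" for e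
  \<comment> \<open>The radius r keeps the domination valid, and e / (B + 1) turns the quadratic
    bound into e * norm u; the added 1 covers B = 0.\<close>
  proof (intro exI[of _ "min r (e / (B + 1))"] conjI allI impI)
    show "min r (e / (B + 1)) > 0" using r that B by simp
    fix y assume y: "norm (y - \<theta>) < min r (e / (B + 1))"
    define u where "u = y - \<theta>"
    have yu: "y = \<theta> + u" by (simp add: u_def)
    have u: "norm u < r" "norm u < e / (B + 1)" using y by (auto simp: u_def)
    have y\<Theta>: "y \<in> \<Theta>" using u(1) r(2) by (auto simp: yu subset_eq dist_norm)
    have "expint g y - expint g \<theta> - ?D u =
       (\<integral>x. (exp (\<theta> \<bullet> T x) * (exp (u \<bullet> T x) - 1 - u \<bullet> T x)) *\<^sub>R g x \<partial>\<nu>)"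
    proof -
      have "expint g y - expint g \<theta> - ?D u = (\<integral>x. exp (y \<bullet> T x) *\<^sub>R g x - exp (\<theta> \<bullet> T x) *\<^sub>R g x
          - exp (\<theta> \<bullet> T x) *\<^sub>R (u \<bullet> T x) *\<^sub>R g x \<partial>\<nu>)"
        unfolding expint_def
        by (subst Bochner_Integration.integral_diff Bochner_Integration.integral_diff[OF int(1)[OF y\<Theta>] int(1)[OF \<theta>]];
            (intro Bochner_Integration.integrable_diff int y\<Theta> \<theta>)?; simp)+
      also have "\<dots> = (\<integral>x. (exp (\<theta> \<bullet> T x) * (exp (u \<bullet> T x) - 1 - u \<bullet> T x)) *\<^sub>R g x \<partial>\<nu>)"
        by (intro Bochner_Integration.integral_cong refl) (simp add: yu inner_add_left exp_add algebra_simps)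
      finally show ?thesis .
    qed
    also have "norm \<dots> \<le> (\<integral>x. (norm u)\<^sup>2 * (C * ((1 + norm (T x)) ^ (k + 2) * exp (\<theta> \<bullet> T x + r * norm (T x)))) \<partial>\<nu>)"
    proof (rule norm_integral_le)
      show "integrable \<nu> (\<lambda>x. (norm u)\<^sup>2 * (C * ((1 + norm (T x)) ^ (k + 2) * exp (\<theta> \<bullet> T x + r * norm (T x)))))"
        using r(3)[of "k + 2"] by simp
      have bd: "norm ((exp (\<theta> \<bullet> T x) * (exp (u \<bullet> T x) - 1 - u \<bullet> T x)) *\<^sub>R g x)
          \<le> (norm u)\<^sup>2 * (C * ((1 + norm (T x)) ^ (k + 2) * exp (\<theta> \<bullet> T x + r * norm (T x))))" for x
      proof -
        have ut: "\<bar>u \<bullet> T x\<bar> \<le> norm u * norm (T x)" by (rule Cauchy_Schwarz_ineq2)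
        have "\<bar>exp (u \<bullet> T x) - 1 - u \<bullet> T x\<bar> \<le> (u \<bullet> T x)\<^sup>2 * exp \<bar>u \<bullet> T x\<bar>"
          by (rule abs_exp_minus_linear_le)
        also have "\<dots> \<le> (norm u * (1 + norm (T x)))\<^sup>2 * exp (r * norm (T x))"
        proof (rule mult_mono)
          have "\<bar>u \<bullet> T x\<bar> \<le> norm u * (1 + norm (T x))"
            using ut by (simp add: distrib_left) (smt (verit) norm_ge_zero)
          then show "(u \<bullet> T x)\<^sup>2 \<le> (norm u * (1 + norm (T x)))\<^sup>2"
            by (metis abs_ge_zero power2_abs power_mono)
          have "\<bar>u \<bullet> T x\<bar> \<le> r * norm (T x)"
            by (rule order_trans[OF ut]) (use u(1) in \<open>auto intro!: mult_right_mono\<close>)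
          then show "exp \<bar>u \<bullet> T x\<bar> \<le> exp (r * norm (T x))" by simp
        qed auto
        finally have *: "\<bar>exp (u \<bullet> T x) - 1 - u \<bullet> T x\<bar> \<le> (norm u * (1 + norm (T x)))\<^sup>2 * exp (r * norm (T x))" .
        have "norm ((exp (\<theta> \<bullet> T x) * (exp (u \<bullet> T x) - 1 - u \<bullet> T x)) *\<^sub>R g x)
           \<le> (exp (\<theta> \<bullet> T x) * ((norm u * (1 + norm (T x)))\<^sup>2 * exp (r * norm (T x)))) * (C * (1 + norm (T x)) ^ k)"
          unfolding norm_scaleR real_norm_def abs_mult
          by (intro mult_mono * gC) auto
        also have "\<dots> = (norm u)\<^sup>2 * (C * ((1 + norm (T x)) ^ (k + 2) * exp (\<theta> \<bullet> T x + r * norm (T x))))"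
          by (simp add: power_add exp_add power_mult_distrib power2_eq_square)
        finally show ?thesis .
      qed
      then show "AE x in \<nu>. norm ((exp (\<theta> \<bullet> T x) * (exp (u \<bullet> T x) - 1 - u \<bullet> T x)) *\<^sub>R g x)
          \<le> (norm u)\<^sup>2 * (C * ((1 + norm (T x)) ^ (k + 2) * exp (\<theta> \<bullet> T x + r * norm (T x))))" by simp
      then show "integrable \<nu> (\<lambda>x. (exp (\<theta> \<bullet> T x) * (exp (u \<bullet> T x) - 1 - u \<bullet> T x)) *\<^sub>R g x)"
        by (intro Bochner_Integration.integrable_bound[OF \<open>integrable \<nu> (\<lambda>x. (norm u)\<^sup>2 * (C * ((1 + norm (T x)) ^ (k + 2) * exp (\<theta> \<bullet> T x + r * norm (T x)))))\<close>])
           (auto elim!: eventually_mono intro: order_trans[OF _ abs_ge_self])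
    qed
    also have "\<dots> = (norm u)\<^sup>2 * B" by (simp add: B_def)
    also have "\<dots> \<le> norm u * e"
    proof -
      have "norm u * (B + 1) \<le> e" using u(2) B by (simp add: field_simps)
      then have "norm u * B \<le> e" by (smt (verit) B mult_left_mono norm_ge_zero)
      then show ?thesis unfolding power2_eq_square mult.assoc by (intro mult_left_mono) auto
    qed
    finally show "norm (expint g y - expint g \<theta> - ?D (y - \<theta>)) \<le> e * norm (y - \<theta>)"
      by (simp add: u_def mult.commute)
  qed
  ultimately show ?thesis unfolding has_derivative_at_alt by blast
qed

section \<open>Normaliser, mean and covariance\<close>

definition Z :: "'v \<Rightarrow> real" where "Z = expint (\<lambda>_. 1)"

definition L :: "'v \<Rightarrow> real" where "L \<theta> = ln (Z \<theta>)"

definition P :: "'v \<Rightarrow> 'a measure" where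
  "P \<theta> = density \<nu> (\<lambda>x. ennreal (exp (\<theta> \<bullet> T x - L \<theta>)))"

definition mean :: "'v \<Rightarrow> 'v" where "mean \<theta> = expint T \<theta> /\<^sub>R Z \<theta>"

text \<open>The covariance of T as a linear map rather than a matrix, so that
  \<open>cov \<theta>\<close> is literally the Frechet derivative of \<open>mean\<close> at
  \<open>\<theta>\<close>, that is, the Hessian of \<open>L\<close>.\<close>

definition cov :: "'v \<Rightarrow> 'v \<Rightarrow> 'v" where
  "cov \<theta> u = expint (\<lambda>x. (u \<bullet> T x) *\<^sub>R T x) \<theta> /\<^sub>R Z \<theta> - (u \<bullet> mean \<theta>) *\<^sub>R mean \<theta>"

lemma sets_P [simp, measurable_cong]: "sets (P \<theta>) = sets \<nu>"
  by (simp add: P_def)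

lemma space_P [simp]: "space (P \<theta>) = space \<nu>"
  by (simp add: P_def)

lemma Z_pos:
  assumes "\<theta> \<in> \<Theta>"
  shows "Z \<theta> > 0"
proof -
  have int: "integrable \<nu> (\<lambda>x. exp (\<theta> \<bullet> T x))" using integrable_exp assms .
  have "Z \<theta> \<ge> 0" unfolding Z_def expint_def by (intro Bochner_Integration.integral_nonneg) auto
  moreover have "Z \<theta> \<noteq> 0"
  proof
    assume "Z \<theta> = 0"
    then have "AE x in \<nu>. exp (\<theta> \<bullet> T x) = 0"
      using integral_nonneg_eq_0_iff_AE[OF int] by (simp add: Z_def expint_def)
    then have "AE x in \<nu>. False" by simp
    then show False using base_nonzero by (simp add: AE_iff_measurable[OF sets.top])
  qed
  ultimately show ?thesis by simp
qed

lemma exp_L: "\<theta> \<in> \<Theta> \<Longrightarrow> exp (L \<theta>) = Z \<theta>"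
  using Z_pos by (simp add: L_def)

lemma integral_P:
  fixes g :: "'a \<Rightarrow> 'b::{banach, second_countable_topology}"
  assumes "\<theta> \<in> \<Theta>" "g \<in> borel_measurable \<nu>"
  shows "integral\<^sup>L (P \<theta>) g = expint g \<theta> /\<^sub>R Z \<theta>"
proof -
  have "integral\<^sup>L (P \<theta>) g = (\<integral>x. exp (\<theta> \<bullet> T x - L \<theta>) *\<^sub>R g x \<partial>\<nu>)"
    unfolding P_def by (rule integral_density) (use assms in auto)
  also have "\<dots> = (\<integral>x. inverse (Z \<theta>) *\<^sub>R (exp (\<theta> \<bullet> T x) *\<^sub>R g x) \<partial>\<nu>)"
    by (intro Bochner_Integration.integral_cong refl) (simp add: exp_diff exp_L assms divide_inverse mult.commute)
  also have "\<dots> = expint g \<theta> /\<^sub>R Z \<theta>"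
    unfolding expint_def by (rule Bochner_Integration.integral_scaleR_right)
  finally show ?thesis .
qed

lemma integrable_P:
  fixes g :: "'a \<Rightarrow> 'b::{banach, second_countable_topology}"
  assumes "\<theta> \<in> \<Theta>" "poly_growth g"
  shows "integrable (P \<theta>) g"
proof -
  have "integrable \<nu> (\<lambda>x. exp (\<theta> \<bullet> T x - L \<theta>) *\<^sub>R g x)"
    using Bochner_Integration.integrable_scaleR_right[OF integrable_poly_growth[OF assms], of "exp (- L \<theta>)"]
    by (simp add: exp_diff exp_minus divide_inverse mult.commute)
  then show ?thesis
    unfolding P_def using assms(2) by (subst integrable_density) (auto simp: poly_growth_def)
qed

lemma prob_space_P:
  assumes "\<theta> \<in> \<Theta>"
  shows "prob_space (P \<theta>)"
proof
  have "integrable \<nu> (\<lambda>x. exp (\<theta> \<bullet> T x - L \<theta>))"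
    using integrable_exp[OF assms] by (simp add: exp_diff)
  then have "emeasure (P \<theta>) (space (P \<theta>)) = ennreal (\<integral>x. exp (\<theta> \<bullet> T x - L \<theta>) \<partial>\<nu>)"
    unfolding P_def by (simp add: emeasure_density nn_integral_eq_integral cong: nn_integral_cong)
  also have "(\<integral>x. exp (\<theta> \<bullet> T x - L \<theta>) \<partial>\<nu>) = 1"
    using Z_pos[OF assms] by (simp add: exp_diff exp_L assms) (simp add: Z_def expint_def)
  finally show "emeasure (P \<theta>) (space (P \<theta>)) = 1" by simp
qed

lemma mean_eq_integral:
  assumes "\<theta> \<in> \<Theta>"
  shows "mean \<theta> = (\<integral>x. T x \<partial>P \<theta>)"
  unfolding mean_def by (rule integral_P[OF assms, symmetric]) simp

lemma expint_inner:
  assumes "\<theta> \<in> \<Theta>" "poly_growth g"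
  shows "expint (\<lambda>x. u \<bullet> g x) \<theta> = u \<bullet> expint g \<theta>"
  unfolding expint_def
  using integral_inner_right[of u \<nu> "\<lambda>x. exp (\<theta> \<bullet> T x) *\<^sub>R g x"] integrable_poly_growth[OF assms]
  by simp

lemma Z_has_derivative:
  assumes "\<theta> \<in> \<Theta>"
  shows "(Z has_derivative (\<lambda>u. Z \<theta> * (u \<bullet> mean \<theta>))) (at \<theta>)"
proof -
  have "expint (\<lambda>x. (u \<bullet> T x) *\<^sub>R 1) \<theta> = Z \<theta> * (u \<bullet> mean \<theta>)" for u
    using expint_inner[OF assms poly_growth_T, of u] Z_pos[OF assms] by (simp add: mean_def)
  then show ?thesis
    using expint_has_derivative[OF assms poly_growth_const[of "1::real"]] unfolding Z_def by simp
qed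

lemma L_has_derivative:
  assumes "\<theta> \<in> \<Theta>"
  shows "(L has_derivative (\<lambda>u. u \<bullet> mean \<theta>)) (at \<theta>)"
proof -
  have "((\<lambda>\<theta>. ln (Z \<theta>)) has_derivative (\<lambda>u. Z \<theta> * (u \<bullet> mean \<theta>) * inverse (Z \<theta>))) (at \<theta>)"
    using Z_pos[OF assms] Z_has_derivative[OF assms] by (auto intro!: derivative_eq_intros)
  moreover have "Z \<theta> * y * inverse (Z \<theta>) = y" for y using Z_pos[OF assms] by simp
  ultimately show ?thesis by (simp only: L_def[abs_def])
qed

lemma mean_has_derivative:
  assumes "\<theta> \<in> \<Theta>"
  shows "(mean has_derivative cov \<theta>) (at \<theta>)"
proof -
  have Z: "Z \<theta> \<noteq> 0" using Z_pos[OF assms] by simp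
  have "((\<lambda>\<theta>. inverse (Z \<theta>) *\<^sub>R expint T \<theta>) has_derivative
     (\<lambda>u. inverse (Z \<theta>) *\<^sub>R expint (\<lambda>x. (u \<bullet> T x) *\<^sub>R T x) \<theta> +
       (- (inverse (Z \<theta>) * (Z \<theta> * (u \<bullet> mean \<theta>)) * inverse (Z \<theta>))) *\<^sub>R expint T \<theta>)) (at \<theta>)"
    by (rule has_derivative_scaleR[OF Deriv.has_derivative_inverse[OF Z Z_has_derivative[OF assms]]
        expint_has_derivative[OF assms poly_growth_T]])
  moreover have "- (inverse (Z \<theta>) * (Z \<theta> * y) * inverse (Z \<theta>)) = - (y * inverse (Z \<theta>))" for y
    using Z by simp
  ultimately show ?thesis
    by (simp add: mean_def[abs_def, symmetric] cov_def[abs_def]) (simp add: mean_def[abs_def])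
qed

lemma linear_cov: "\<theta> \<in> \<Theta> \<Longrightarrow> linear (cov \<theta>)"
  using mean_has_derivative has_derivative_linear by blast

lemma continuous_on_mean: "continuous_on \<Theta> mean"
  using mean_has_derivative by (intro continuous_at_imp_continuous_on ballI has_derivative_continuous)

lemma continuous_on_cov: "continuous_on \<Theta> (\<lambda>\<theta>. cov \<theta> u)"
proof -
  have "continuous_on \<Theta> (expint g)" if "poly_growth g" for g :: "'a \<Rightarrow> 'v"
    using expint_has_derivative[OF _ that]
    by (intro continuous_at_imp_continuous_on ballI has_derivative_continuous)
  moreover have "continuous_on \<Theta> Z"
    using Z_has_derivative by (intro continuous_at_imp_continuous_on ballI has_derivative_continuous)
  moreover have "Z \<theta> \<noteq> 0" if "\<theta> \<in> \<Theta>" for \<theta> using Z_pos[OF that] by simp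
  moreover have "poly_growth (\<lambda>x. (u \<bullet> T x) *\<^sub>R T x)"
    by (intro poly_growth_scaleR poly_growth_inner poly_growth_T)
  ultimately show ?thesis unfolding cov_def
    by (intro continuous_intros continuous_on_mean) auto
qed

lemma inner_cov:
  assumes "\<theta> \<in> \<Theta>"
  shows "w \<bullet> cov \<theta> u = (\<integral>x. (u \<bullet> (T x - mean \<theta>)) * (w \<bullet> (T x - mean \<theta>)) \<partial>P \<theta>)"
proof -
  interpret prob_space "P \<theta>" by (rule prob_space_P[OF assms])
  have pg: "poly_growth (\<lambda>x. (u \<bullet> T x) *\<^sub>R T x)"
    by (intro poly_growth_scaleR poly_growth_inner poly_growth_T)
  have iT: "integrable (P \<theta>) T" by (rule integrable_P[OF assms poly_growth_T])
  have iTT: "integrable (P \<theta>) (\<lambda>x. (u \<bullet> T x) *\<^sub>R T x)" by (rule integrable_P[OF assms pg])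
  have "(\<integral>x. (u \<bullet> (T x - mean \<theta>)) * (w \<bullet> (T x - mean \<theta>)) \<partial>P \<theta>)
     = (\<integral>x. w \<bullet> ((u \<bullet> T x) *\<^sub>R T x) - (u \<bullet> mean \<theta>) * (w \<bullet> T x) - (w \<bullet> mean \<theta>) * (u \<bullet> T x)
         + (u \<bullet> mean \<theta>) * (w \<bullet> mean \<theta>) \<partial>P \<theta>)"
    by (intro Bochner_Integration.integral_cong refl) (simp add: inner_diff_right algebra_simps)
  also have "\<dots> = (\<integral>x. w \<bullet> ((u \<bullet> T x) *\<^sub>R T x) \<partial>P \<theta>) - (\<integral>x. (u \<bullet> mean \<theta>) * (w \<bullet> T x) \<partial>P \<theta>)
      - (\<integral>x. (w \<bullet> mean \<theta>) * (u \<bullet> T x) \<partial>P \<theta>) + (\<integral>x. (u \<bullet> mean \<theta>) * (w \<bullet> mean \<theta>) \<partial>P \<theta>)"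
    using iT iTT by (simp del: inner_scaleR_right)
  also have "\<dots> = w \<bullet> (\<integral>x. (u \<bullet> T x) *\<^sub>R T x \<partial>P \<theta>) - (u \<bullet> mean \<theta>) * (w \<bullet> mean \<theta>)
      - (w \<bullet> mean \<theta>) * (u \<bullet> mean \<theta>) + (u \<bullet> mean \<theta>) * (w \<bullet> mean \<theta>)"
    using iT iTT by (simp add: mean_eq_integral[OF assms] prob_space[simplified] del: inner_scaleR_right)
  also have "\<dots> = w \<bullet> cov \<theta> u"
    using integral_P[OF assms, of "\<lambda>x. (u \<bullet> T x) *\<^sub>R T x"] by (simp add: cov_def inner_diff_right)
  finally show ?thesis by simp
qed

lemma cov_commute: "\<theta> \<in> \<Theta> \<Longrightarrow> w \<bullet> cov \<theta> u = u \<bullet> cov \<theta> w"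
  by (simp add: inner_cov mult.commute)

lemma cov_nonneg: "\<theta> \<in> \<Theta> \<Longrightarrow> 0 \<le> u \<bullet> cov \<theta> u"
  by (simp add: inner_cov)

section \<open>Second-order behaviour of the log normaliser\<close>

text \<open>The Bregman divergence of \<open>L\<close>, which for parameters in
  \<open>\<Theta>\<close> is the Kullback-Leibler divergence of \<open>P \<theta>\<close> from
  \<open>P \<theta>'\<close>.\<close>

definition bregman :: "'v \<Rightarrow> 'v \<Rightarrow> real" where
  "bregman \<theta> \<theta>' = L \<theta>' - L \<theta> - (\<theta>' - \<theta>) \<bullet> mean \<theta>"

text \<open>The mean value theorem along the segment reduces the second-order claim for
  \<open>L\<close> to the first-order expansion of its gradient \<open>mean\<close> at the single
  point \<open>\<theta>\<close>.\<close>

lemma bregman_taylor: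
  assumes "\<theta> \<in> \<Theta>" "e > 0"
  shows "\<exists>d>0. \<forall>u. norm u < d \<longrightarrow> \<bar>bregman \<theta> (\<theta> + u) - u \<bullet> cov \<theta> u / 2\<bar> \<le> e * (norm u)\<^sup>2"
proof -
  obtain \<rho> where \<rho>: "\<rho> > 0" "ball \<theta> \<rho> \<subseteq> \<Theta>"
    using open_\<Theta> assms open_contains_ball by blast
  obtain d where d: "d > 0" "\<And>y. norm (y - \<theta>) < d \<Longrightarrow>
      norm (mean y - mean \<theta> - cov \<theta> (y - \<theta>)) \<le> e * norm (y - \<theta>)"
    using mean_has_derivative[OF assms(1)] assms(2) unfolding has_derivative_at_alt by blast
  show ?thesis
  proof (intro exI[of _ "min d \<rho>"] conjI allI impI)
    show "min d \<rho> > 0" using d \<rho> by simp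
    fix u :: 'v assume u: "norm u < min d \<rho>"
    have lin: "cov \<theta> (t *\<^sub>R u) = t *\<^sub>R cov \<theta> u" for t
      by (rule linear_cmul[OF linear_cov[OF assms(1)]])
    \<comment> \<open>\<open>L\<close> on the segment minus its linear and quadratic model; the
      increment from 0 to 1 is exactly the error to be bounded.\<close>
    let ?f = "\<lambda>t. L (\<theta> + t *\<^sub>R u) - t * (u \<bullet> mean \<theta>) - t\<^sup>2 * (u \<bullet> cov \<theta> u) / 2"
    let ?f' = "\<lambda>t. u \<bullet> mean (\<theta> + t *\<^sub>R u) - u \<bullet> mean \<theta> - t * (u \<bullet> cov \<theta> u)"
    have tu: "norm (t *\<^sub>R u) \<le> norm u" if "0 \<le> t" "t \<le> 1" for t :: real
      using that by (simp add: mult_left_le_one_le)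
    have der: "(?f has_real_derivative ?f' t) (at t)" if "0 \<le> t" "t \<le> 1" for t
    proof -
      have "norm (t *\<^sub>R u) < \<rho>" using tu[OF that] u by linarith
      then have "\<theta> + t *\<^sub>R u \<in> \<Theta>" using \<rho>(2) by (auto simp: subset_eq dist_norm)
      from L_has_derivative[OF this]
      have "((\<lambda>t. L (\<theta> + t *\<^sub>R u)) has_derivative (\<lambda>s. (s *\<^sub>R u) \<bullet> mean (\<theta> + t *\<^sub>R u))) (at t)"
        by (rule has_derivative_compose[rotated]) (auto intro!: derivative_eq_intros)
      then have "((\<lambda>t. L (\<theta> + t *\<^sub>R u)) has_real_derivative u \<bullet> mean (\<theta> + t *\<^sub>R u)) (at t)"
        by (simp add: has_field_derivative_def mult.commute[of _ "u \<bullet> _"])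
      then show ?thesis by (auto intro!: derivative_eq_intros)
    qed
    obtain t where t: "0 < t" "t < 1" "?f 1 - ?f 0 = (1 - 0) * ?f' t"
      using MVT2[of 0 1 ?f ?f'] der by auto
    have "\<bar>?f' t\<bar> = \<bar>u \<bullet> (mean (\<theta> + t *\<^sub>R u) - mean \<theta> - cov \<theta> (t *\<^sub>R u))\<bar>"
      by (simp add: lin inner_diff_right)
    also have "\<dots> \<le> norm u * norm (mean (\<theta> + t *\<^sub>R u) - mean \<theta> - cov \<theta> (t *\<^sub>R u))"
      by (rule Cauchy_Schwarz_ineq2)
    also have "\<dots> \<le> norm u * (e * norm u)"
    proof (rule mult_left_mono)
      have "norm (t *\<^sub>R u) < d" using tu[of t] t u by linarith
      then have "norm (mean (\<theta> + t *\<^sub>R u) - mean \<theta> - cov \<theta> (t *\<^sub>R u)) \<le> e * norm (t *\<^sub>R u)"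
        using d(2)[of "\<theta> + t *\<^sub>R u"] by simp
      also have "\<dots> \<le> e * norm u" using tu[of t] t assms(2) by (intro mult_left_mono) auto
      finally show "norm (mean (\<theta> + t *\<^sub>R u) - mean \<theta> - cov \<theta> (t *\<^sub>R u)) \<le> e * norm u" .
    qed auto
    finally show "\<bar>bregman \<theta> (\<theta> + u) - u \<bullet> cov \<theta> u / 2\<bar> \<le> e * (norm u)\<^sup>2"
      using t(3) by (simp add: bregman_def power2_eq_square mult_ac)
  qed
qed

text \<open>The quadratic form of \<open>cov \<theta>\<close> picks up exactly the factor n when the
  increment is multiplied by sqrt n, so only the Taylor error has to vanish.\<close>

lemma bregman_limit:
  assumes \<theta>: "\<theta> \<in> \<Theta>" and lim: "(\<lambda>n. sqrt (real n) *\<^sub>R (t n - \<theta>)) \<longlonglongrightarrow> h"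
  shows "(\<lambda>n. real n * bregman \<theta> (t n)) \<longlonglongrightarrow> h \<bullet> cov \<theta> h / 2"
proof -
  obtain K where K: "K > 0" "\<And>n. norm (sqrt (real n) *\<^sub>R (t n - \<theta>)) \<le> K"
    using tendsto_imp_norm_bound[OF lim] by blast
  have t: "(\<lambda>n. t n - \<theta>) \<longlonglongrightarrow> 0" by (rule sqrt_scaled_imp_null[OF lim])
  let ?q = "\<lambda>u. u \<bullet> cov \<theta> u / 2"
  have lin: "cov \<theta> (c *\<^sub>R u) = c *\<^sub>R cov \<theta> u" for c u
    by (rule linear_cmul[OF linear_cov[OF \<theta>]])
  have "(\<lambda>n. real n * bregman \<theta> (t n) - ?q (sqrt (real n) *\<^sub>R (t n - \<theta>))) \<longlonglongrightarrow> 0"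
  proof (rule tendstoI)
    fix e :: real assume e: "e > 0"
    then have "e / (2 * K\<^sup>2) > 0" using K by simp
    then obtain d where d: "d > 0" "\<And>u. norm u < d \<Longrightarrow>
        \<bar>bregman \<theta> (\<theta> + u) - ?q u\<bar> \<le> e / (2 * K\<^sup>2) * (norm u)\<^sup>2"
      using bregman_taylor[OF \<theta>] by blast
    have "\<forall>\<^sub>F n in sequentially. norm (t n - \<theta>) < d"
      using tendstoD[OF t d(1)] by simp
    then show "\<forall>\<^sub>F n in sequentially.
        dist (real n * bregman \<theta> (t n) - ?q (sqrt (real n) *\<^sub>R (t n - \<theta>))) 0 < e"
    proof eventually_elim
      case (elim n)
      have "\<bar>real n * bregman \<theta> (t n) - ?q (sqrt (real n) *\<^sub>R (t n - \<theta>))\<bar>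
          = real n * \<bar>bregman \<theta> (\<theta> + (t n - \<theta>)) - ?q (t n - \<theta>)\<bar>"
      proof -
        have "?q (sqrt (real n) *\<^sub>R (t n - \<theta>)) = real n * ?q (t n - \<theta>)"
          by (simp add: lin flip: mult.assoc)
        moreover have "\<bar>real n * a - real n * b\<bar> = real n * \<bar>a - b\<bar>" for a b
          by (simp add: abs_mult flip: right_diff_distrib)
        ultimately show ?thesis by (simp only: add.commute[of \<theta>] diff_add_cancel)
      qed
      also have "\<dots> \<le> real n * (e / (2 * K\<^sup>2) * (norm (t n - \<theta>))\<^sup>2)"
        by (intro mult_left_mono d elim) auto
      also have "\<dots> = e / (2 * K\<^sup>2) * (norm (sqrt (real n) *\<^sub>R (t n - \<theta>)))\<^sup>2"
        by (simp add: power_mult_distrib)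
      also have "\<dots> \<le> e / (2 * K\<^sup>2) * K\<^sup>2" using e K by (intro mult_left_mono power_mono) auto
      also have "\<dots> < e" using e K by simp
      finally show ?case by simp
    qed
  qed
  moreover have "(\<lambda>n. ?q (sqrt (real n) *\<^sub>R (t n - \<theta>))) \<longlonglongrightarrow> ?q h"
  proof -
    have "bounded_linear (cov \<theta>)" using linear_cov[OF \<theta>] by (simp add: linear_conv_bounded_linear)
    from tendsto_inner[OF lim bounded_linear.tendsto[OF this lim]]
    show ?thesis by (intro tendsto_divide tendsto_const) auto
  qed
  ultimately have "(\<lambda>n. (real n * bregman \<theta> (t n) - ?q (sqrt (real n) *\<^sub>R (t n - \<theta>)))
      + ?q (sqrt (real n) *\<^sub>R (t n - \<theta>))) \<longlonglongrightarrow> 0 + ?q h"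
    by (rule tendsto_add)
  then show ?thesis by simp
qed

end

section \<open>Likelihood ratios, contiguity and the score\<close>

text \<open>The two measures are compared on rectangles, where the integral of a product of
  densities factorises.\<close>

lemma PiM_density_finite:
  assumes I: "finite I" and M: "\<And>i. prob_space (M i)" and N: "\<And>i. prob_space (density (M i) (f i))"
    and f[measurable]: "\<And>i. f i \<in> borel_measurable (M i)"
  shows "PiM I (\<lambda>i. density (M i) (f i)) = density (PiM I M) (\<lambda>x. \<Prod>i\<in>I. f i (x i))"
proof -
  interpret M: product_sigma_finite M
    using M by (auto simp: product_sigma_finite_def intro: prob_space_imp_sigma_finite)
  interpret N: product_sigma_finite "\<lambda>i. density (M i) (f i)"
    using N by (auto simp: product_sigma_finite_def intro: prob_space_imp_sigma_finite)
  have "density (PiM I M) (\<lambda>x. \<Prod>i\<in>I. f i (x i)) = PiM I (\<lambda>i. density (M i) (f i))"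
  proof (rule N.PiM_eqI[OF I])
    show "sets (density (PiM I M) (\<lambda>x. \<Prod>i\<in>I. f i (x i))) = sets (PiM I (\<lambda>i. density (M i) (f i)))"
      by (simp cong: sets_PiM_cong)
    fix A assume "\<And>i. i \<in> I \<Longrightarrow> A i \<in> sets (density (M i) (f i))"
    then have A: "\<And>i. i \<in> I \<Longrightarrow> A i \<in> sets (M i)" by simp
    have [measurable]: "Pi\<^sub>E I A \<in> sets (PiM I M)" using A I by (intro sets_PiM_I_finite) auto
    have "emeasure (density (PiM I M) (\<lambda>x. \<Prod>i\<in>I. f i (x i))) (Pi\<^sub>E I A)
        = (\<integral>\<^sup>+x. (\<Prod>i\<in>I. f i (x i)) * indicator (Pi\<^sub>E I A) x \<partial>PiM I M)"
      by (rule emeasure_density) measurable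
    also have "\<dots> = (\<integral>\<^sup>+x. (\<Prod>i\<in>I. f i (x i) * indicator (A i) (x i)) \<partial>PiM I M)"
    proof (rule nn_integral_cong)
      fix x assume "x \<in> space (PiM I M)"
      then have "indicator (Pi\<^sub>E I A) x = (\<Prod>i\<in>I. indicator (A i) (x i) :: ennreal)"
        using I by (auto simp: indicator_def space_PiM PiE_def Pi_def prod.If_cases)
      then show "(\<Prod>i\<in>I. f i (x i)) * indicator (Pi\<^sub>E I A) x = (\<Prod>i\<in>I. f i (x i) * indicator (A i) (x i))"
        by (simp add: prod.distrib)
    qed
    also have "\<dots> = (\<Prod>i\<in>I. \<integral>\<^sup>+x. f i x * indicator (A i) x \<partial>M i)"
      by (rule M.product_nn_integral_prod[OF I]) (use A in auto)
    also have "\<dots> = (\<Prod>i\<in>I. emeasure (density (M i) (f i)) (A i))"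
      by (intro prod.cong refl) (simp add: emeasure_density A)
    finally show "emeasure (density (PiM I M) (\<lambda>x. \<Prod>i\<in>I. f i (x i))) (Pi\<^sub>E I A)
        = (\<Prod>i\<in>I. emeasure (density (M i) (f i)) (A i))" .
  qed
  then show ?thesis by simp
qed

lemma char_normal:
  "char (density lborel (\<lambda>x. ennreal (normal_density \<mu> 1 x))) s = iexp (s * \<mu>) * complex_of_real (exp (- s\<^sup>2 / 2))"
proof -
  have "char (density lborel (\<lambda>x. ennreal (normal_density \<mu> 1 x))) s
      = (\<integral>x. normal_density \<mu> 1 x *\<^sub>R iexp (s * x) \<partial>lborel)"
    unfolding char_def by (subst integral_density) auto
  also have "\<dots> = (\<integral>x. normal_density \<mu> 1 (\<mu> + 1 * x) *\<^sub>R iexp (s * (\<mu> + 1 * x)) \<partial>lborel)"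
    using lborel_integral_real_affine[of 1 "\<lambda>x. normal_density \<mu> 1 x *\<^sub>R iexp (s * x)" \<mu>] by simp
  also have "\<dots> = (\<integral>x. iexp (s * \<mu>) * (std_normal_density x *\<^sub>R iexp (s * x)) \<partial>lborel)"
    by (intro Bochner_Integration.integral_cong refl)
       (simp add: normal_density_def distrib_left exp_add)
  also have "\<dots> = iexp (s * \<mu>) * (\<integral>x. std_normal_density x *\<^sub>R iexp (s * x) \<partial>lborel)"
    by (rule integral_mult_right_zero)
  also have "(\<integral>x. std_normal_density x *\<^sub>R iexp (s * x) \<partial>lborel) = char std_normal_distribution s"
    unfolding char_def by (subst integral_density) auto
  finally show ?thesis by (simp add: char_std_normal_distribution)
qed

text \<open>Stated at one argument of the characteristic function, the form that Levy continuity
  consumes, and for laws that change with n. The two exponentials differ by at most |s| |Y - X|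
  where X and Y are close and by at most 2 elsewhere.\<close>

lemma slutsky_char:
  fixes X Y :: "nat \<Rightarrow> 'a \<Rightarrow> real"
  assumes M: "\<And>n. prob_space (M n)"
    and X[measurable]: "\<And>n. X n \<in> borel_measurable (M n)"
    and Y[measurable]: "\<And>n. Y n \<in> borel_measurable (M n)"
    and diff: "\<And>e. e > 0 \<Longrightarrow> (\<lambda>n. measure (M n) {x \<in> space (M n). \<bar>Y n x - X n x\<bar> > e}) \<longlonglongrightarrow> 0"
    and lim: "(\<lambda>n. \<integral>x. iexp (s * X n x) \<partial>M n) \<longlonglongrightarrow> l"
  shows "(\<lambda>n. \<integral>x. iexp (s * Y n x) \<partial>M n) \<longlonglongrightarrow> l"
proof -
  have "(\<lambda>n. (\<integral>x. iexp (s * Y n x) \<partial>M n) - (\<integral>x. iexp (s * X n x) \<partial>M n)) \<longlonglongrightarrow> 0"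
  proof (rule tendstoI)
    fix e :: real assume e: "e > 0"
    \<comment> \<open>Distance d costs at most e / 2, the added 1 covering s = 0. The exceptional
      set costs twice its probability, hence the bound e / 4 below.\<close>
    define d where "d = e / (2 * (\<bar>s\<bar> + 1))"
    have d: "d > 0" using e by (simp add: d_def)
    have sd: "\<bar>s\<bar> * d \<le> e / 2" unfolding d_def using e by (simp add: field_simps)
    have "\<forall>\<^sub>F n in sequentially. measure (M n) {x \<in> space (M n). \<bar>Y n x - X n x\<bar> > d} < e / 4"
      using order_tendstoD(2)[OF diff[OF d], of "e/4"] e by simp
    then show "\<forall>\<^sub>F n in sequentially.
        dist ((\<integral>x. iexp (s * Y n x) \<partial>M n) - (\<integral>x. iexp (s * X n x) \<partial>M n)) 0 < e"
    proof eventually_elim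
      case (elim n)
      interpret prob_space "M n" by (rule M)
      let ?A = "{x \<in> space (M n). \<bar>Y n x - X n x\<bar> > d}"
      have iX: "integrable (M n) (\<lambda>x. iexp (s * X n x))" and iY: "integrable (M n) (\<lambda>x. iexp (s * Y n x))"
        by (auto intro!: integrable_const_bound[where B=1])
      have "norm ((\<integral>x. iexp (s * Y n x) \<partial>M n) - (\<integral>x. iexp (s * X n x) \<partial>M n))
          = norm (\<integral>x. iexp (s * Y n x) - iexp (s * X n x) \<partial>M n)"
        by (subst Bochner_Integration.integral_diff[OF iY iX]) (rule refl)
      also have "\<dots> \<le> (\<integral>x. e / 2 + 2 * indicator ?A x \<partial>M n)"
      proof (rule norm_integral_le)
        show "integrable (M n) (\<lambda>x. iexp (s * Y n x) - iexp (s * X n x))" using iX iY by simp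
        show "integrable (M n) (\<lambda>x. e / 2 + 2 * indicator ?A x)"
          by (intro Bochner_Integration.integrable_add integrable_mult_right) (auto simp: integrable_indicator_iff emeasure_eq_measure)
        show "AE x in M n. norm (iexp (s * Y n x) - iexp (s * X n x)) \<le> e / 2 + 2 * indicator ?A x"
        proof (rule AE_I2)
          fix x assume x: "x \<in> space (M n)"
          show "norm (iexp (s * Y n x) - iexp (s * X n x)) \<le> e / 2 + 2 * indicator ?A x"
          proof (cases "x \<in> ?A")
            case True
            have "norm (iexp (s * Y n x) - iexp (s * X n x)) \<le> norm (iexp (s * Y n x)) + norm (iexp (s * X n x))"
              by (rule norm_triangle_ineq4)
            then show ?thesis using True e by simp
          next
            case False
            then have le: "\<bar>Y n x - X n x\<bar> \<le> d" using x by simp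
            have "iexp (s * Y n x) - iexp (s * X n x) = iexp (s * X n x) * (iexp (s * (Y n x - X n x)) - 1)"
              by (simp add: right_diff_distrib exp_add[symmetric] algebra_simps)
            then have "norm (iexp (s * Y n x) - iexp (s * X n x)) = norm (iexp (s * (Y n x - X n x)) - 1)"
              by (simp add: norm_mult)
            also have "\<dots> \<le> \<bar>s * (Y n x - X n x)\<bar>"
              using iexp_approx1[of "s * (Y n x - X n x)" 0] by simp
            also have "\<dots> \<le> \<bar>s\<bar> * d" unfolding abs_mult using le by (intro mult_left_mono) auto
            finally show ?thesis using sd False by simp
          qed
        qed
      qed
      also have "\<dots> = e / 2 + 2 * measure (M n) ?A"
        by (subst Bochner_Integration.integral_add) (auto simp: prob_space emeasure_eq_measure)
      also have "\<dots> < e" using elim by simp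
      finally show ?case by simp
    qed
  qed
  from tendsto_add[OF this lim] show ?thesis by simp
qed

section \<open>Product laws, likelihood ratios and contiguity\<close>

context exponential_family
begin

definition Pn :: "nat \<Rightarrow> 'v \<Rightarrow> (nat \<Rightarrow> 'a) measure" where
  "Pn n \<theta> = PiM {..<n} (\<lambda>_. P \<theta>)"

definition S :: "nat \<Rightarrow> 'v \<Rightarrow> (nat \<Rightarrow> 'a) \<Rightarrow> 'v" where
  "S n \<theta> x = (\<Sum>i<n. T (x i) - mean \<theta>) /\<^sub>R sqrt (real n)"

lemma sets_Pn [measurable_cong]: "sets (Pn n \<theta>) = sets (PiM {..<n} (\<lambda>_. \<nu>))"
  unfolding Pn_def by (intro sets_PiM_cong) auto

lemma space_Pn: "space (Pn n \<theta>) = space (PiM {..<n} (\<lambda>_. \<nu>))"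
  by (rule sets_eq_imp_space_eq[OF sets_Pn])

lemma prob_space_Pn: "\<theta> \<in> \<Theta> \<Longrightarrow> prob_space (Pn n \<theta>)"
  unfolding Pn_def by (intro prob_space_PiM prob_space_P)

lemma S_measurable [measurable]: "S n \<theta> \<in> borel_measurable (PiM {..<n} (\<lambda>_. \<nu>))"
  unfolding S_def by measurable

text \<open>The parameter enters the score only as an additive centring, so the correction does not
  depend on the sample. The identity may thus be used with a data-dependent
  \<open>\<theta>'\<close>, pointwise in x.\<close>

lemma S_shift: "S n \<theta>' x = S n \<theta> x - sqrt (real n) *\<^sub>R (mean \<theta>' - mean \<theta>)"
proof (cases "n = 0")
  case False
  have "S n \<theta> x - S n \<theta>' x = (\<Sum>i<n. mean \<theta>' - mean \<theta>) /\<^sub>R sqrt (real n)"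
    unfolding S_def scaleR_diff_right[symmetric] sum_subtractf[symmetric] by simp
  also have "\<dots> = (real n / sqrt (real n)) *\<^sub>R (mean \<theta>' - mean \<theta>)"
    by (simp add: sum_constant_scaleR divide_inverse mult.commute)
  also have "real n / sqrt (real n) = sqrt (real n)" by (simp add: real_div_sqrt)
  finally show ?thesis by (simp add: algebra_simps)
qed (simp add: S_def)

text \<open>The density of \<open>Pn n \<theta>'\<close> with respect to
  \<open>Pn n \<theta>\<close>, arranged so that all randomness sits in one linear form of the
  score; each observation then leaves the constant
  \<open>bregman \<theta> \<theta>'\<close>.\<close>

definition lr :: "nat \<Rightarrow> 'v \<Rightarrow> 'v \<Rightarrow> (nat \<Rightarrow> 'a) \<Rightarrow> real" where
  "lr n \<theta> \<theta>' x = exp (sqrt (real n) * ((\<theta>' - \<theta>) \<bullet> S n \<theta> x) - real n * bregman \<theta> \<theta>')"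

lemma lr_measurable [measurable]: "lr n \<theta> \<theta>' \<in> borel_measurable (PiM {..<n} (\<lambda>_. \<nu>))"
  unfolding lr_def by measurable

lemma lr_pos [simp]: "lr n \<theta> \<theta>' x > 0"
  by (simp add: lr_def)

lemma Pn_eq_density:
  assumes "\<theta> \<in> \<Theta>" "\<theta>' \<in> \<Theta>"
  shows "Pn n \<theta>' = density (Pn n \<theta>) (\<lambda>x. ennreal (lr n \<theta> \<theta>' x))"
proof -
  let ?f = "\<lambda>y. exp ((\<theta>' - \<theta>) \<bullet> (T y - mean \<theta>) - bregman \<theta> \<theta>')"
  have eq: "P \<theta>' = density (P \<theta>) (\<lambda>y. ennreal (?f y))"
  proof -
    have "density (P \<theta>) (\<lambda>y. ennreal (?f y))
       = density \<nu> (\<lambda>y. ennreal (exp (\<theta> \<bullet> T y - L \<theta>)) * ennreal (?f y))"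
      unfolding P_def by (rule density_density_eq) auto
    also have "\<dots> = P \<theta>'"
      unfolding P_def
      by (intro density_cong) (auto simp: ennreal_mult[symmetric] exp_add[symmetric] bregman_def inner_diff_left inner_diff_right)
    finally show ?thesis by simp
  qed
  have "Pn n \<theta>' = PiM {..<n} (\<lambda>_. density (P \<theta>) (\<lambda>y. ennreal (?f y)))"
    unfolding Pn_def eq[symmetric] ..
  also have "\<dots> = density (PiM {..<n} (\<lambda>_. P \<theta>)) (\<lambda>x. \<Prod>i\<in>{..<n}. ennreal (?f (x i)))"
    by (rule PiM_density_finite) (use prob_space_P assms in \<open>auto simp: eq[symmetric]\<close>)
  also have "(\<lambda>x. \<Prod>i\<in>{..<n}. ennreal (?f (x i))) = (\<lambda>x. ennreal (lr n \<theta> \<theta>' x))"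
  proof
    fix x
    have "(\<Prod>i\<in>{..<n}. ennreal (?f (x i))) = ennreal (exp (\<Sum>i<n. (\<theta>' - \<theta>) \<bullet> (T (x i) - mean \<theta>) - bregman \<theta> \<theta>'))"
      by (simp add: prod_ennreal exp_sum)
    also have "(\<Sum>i<n. (\<theta>' - \<theta>) \<bullet> (T (x i) - mean \<theta>) - bregman \<theta> \<theta>')
        = sqrt (real n) * ((\<theta>' - \<theta>) \<bullet> S n \<theta> x) - real n * bregman \<theta> \<theta>'"
      by (cases "n = 0") (simp_all add: S_def inner_sum_right
        sum_subtractf[of "\<lambda>i. (\<theta>' - \<theta>) \<bullet> (T (x i) - mean \<theta>)" "\<lambda>_. bregman \<theta> \<theta>'"])
    finally show "(\<Prod>i\<in>{..<n}. ennreal (?f (x i))) = ennreal (lr n \<theta> \<theta>' x)" by (simp add: lr_def)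
  qed
  finally show ?thesis by (simp add: Pn_def)
qed

lemma integral_Pn:
  fixes f :: "(nat \<Rightarrow> 'a) \<Rightarrow> real"
  assumes "\<theta> \<in> \<Theta>" "\<theta>' \<in> \<Theta>" and [measurable]: "f \<in> borel_measurable (PiM {..<n} (\<lambda>_. \<nu>))"
  shows "integral\<^sup>L (Pn n \<theta>') f = (\<integral>x. lr n \<theta> \<theta>' x * f x \<partial>Pn n \<theta>)"
  unfolding Pn_eq_density[OF assms(1,2)]
  by (subst integral_real_density) (auto simp: less_imp_le)

lemma lr_integrable: "\<theta> \<in> \<Theta> \<Longrightarrow> \<theta>' \<in> \<Theta> \<Longrightarrow> integrable (Pn n \<theta>) (lr n \<theta> \<theta>')"
  and integral_lr: "\<theta> \<in> \<Theta> \<Longrightarrow> \<theta>' \<in> \<Theta> \<Longrightarrow> (\<integral>x. lr n \<theta> \<theta>' x \<partial>Pn n \<theta>) = 1"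
proof -
  assume \<theta>: "\<theta> \<in> \<Theta>" "\<theta>' \<in> \<Theta>"
  interpret prob_space "Pn n \<theta>'" by (rule prob_space_Pn[OF \<theta>(2)])
  have "integrable (density (Pn n \<theta>) (\<lambda>x. ennreal (lr n \<theta> \<theta>' x))) (\<lambda>_. 1::real)"
    unfolding Pn_eq_density[OF \<theta>, symmetric] by simp
  then show "integrable (Pn n \<theta>) (lr n \<theta> \<theta>')"
    by (subst (asm) integrable_real_density) (auto simp: less_imp_le)
  show "(\<integral>x. lr n \<theta> \<theta>' x \<partial>Pn n \<theta>) = 1"
    using integral_Pn[OF \<theta>, of "\<lambda>_. 1" n] prob_space by simp
qed

lemma eventually_in_\<Theta>:
  assumes "\<theta> \<in> \<Theta>" "(\<lambda>n. sqrt (real n) *\<^sub>R (t n - \<theta>)) \<longlonglongrightarrow> h"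
  shows "\<forall>\<^sub>F n in sequentially. t n \<in> \<Theta>"
proof -
  have "t \<longlonglongrightarrow> \<theta>" using sqrt_scaled_imp_null[OF assms(2)] by (simp add: LIM_zero_iff)
  then show ?thesis using topological_tendstoD open_\<Theta> assms(1) by blast
qed

text \<open>The second moment of the likelihood ratio is \<open>exp\<close> of a bounded sequence, because its
  square is again a likelihood ratio, at the reflected parameter \<open>2 t - \<theta>\<close>, up to a constant.\<close>

lemma contiguity:
  assumes \<theta>: "\<theta> \<in> \<Theta>" and t: "\<And>n. t n \<in> \<Theta>"
    and lim: "(\<lambda>n. sqrt (real n) *\<^sub>R (t n - \<theta>)) \<longlonglongrightarrow> h"
    and A: "\<And>n. A n \<in> sets (PiM {..<n} (\<lambda>_. \<nu>))"
    and null: "(\<lambda>n. measure (Pn n \<theta>) (A n)) \<longlonglongrightarrow> 0"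
  shows "(\<lambda>n. measure (Pn n (t n)) (A n)) \<longlonglongrightarrow> 0"
proof -
  define r where "r n = 2 *\<^sub>R t n - \<theta>" for n
  define c where "c n = real n * bregman \<theta> (r n) - 2 * (real n * bregman \<theta> (t n))" for n
  have rt: "r n - \<theta> = 2 *\<^sub>R (t n - \<theta>)" for n by (simp add: r_def scaleR_2 algebra_simps)
  have limr: "(\<lambda>n. sqrt (real n) *\<^sub>R (r n - \<theta>)) \<longlonglongrightarrow> 2 *\<^sub>R h"
    unfolding rt using tendsto_scaleR[OF tendsto_const[of 2] lim] by (simp add: mult.commute)
  have "c \<longlonglongrightarrow> (2 *\<^sub>R h) \<bullet> cov \<theta> (2 *\<^sub>R h) / 2 - 2 * (h \<bullet> cov \<theta> h / 2)"
    unfolding c_def by (intro tendsto_intros bregman_limit \<theta> lim limr)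
  then have "(\<lambda>n. exp (c n)) \<longlonglongrightarrow> exp ((2 *\<^sub>R h) \<bullet> cov \<theta> (2 *\<^sub>R h) / 2 - 2 * (h \<bullet> cov \<theta> h / 2))"
    by (rule tendsto_exp)
  from tendsto_imp_norm_bound[OF this] obtain C where C: "C > 0" "\<And>n. exp (c n) \<le> C" by auto
  have bound: "\<forall>\<^sub>F n in sequentially. measure (Pn n (t n)) (A n) \<le> K * measure (Pn n \<theta>) (A n) + C / K"
    if K: "K > 0" for K
    \<comment> \<open>The reflected parameter \<open>r n\<close> may lie outside
      \<open>\<Theta>\<close> for small n, although \<open>t n\<close> never does; hence the bound
      only for large n.\<close>
    using eventually_in_\<Theta>[OF \<theta> limr]
  proof eventually_elim
    case (elim n)
    interpret prob_space "Pn n \<theta>" by (rule prob_space_Pn[OF \<theta>])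
    have An[measurable]: "A n \<in> sets (Pn n \<theta>)" "A n \<in> sets (PiM {..<n} (\<lambda>_. \<nu>))" using A by (simp_all add: sets_Pn)
    have sq: "(lr n \<theta> (t n) x)\<^sup>2 = exp (c n) * lr n \<theta> (r n) x" for x
      unfolding lr_def rt c_def power2_eq_square exp_add[symmetric] by (simp add: algebra_simps)
    have isq: "integrable (Pn n \<theta>) (\<lambda>x. (lr n \<theta> (t n) x)\<^sup>2)"
      unfolding sq using lr_integrable[OF \<theta> elim] by simp
    have "measure (Pn n (t n)) (A n) = integral\<^sup>L (Pn n (t n)) (indicator (A n))"
      using An by (simp add: sets_Pn space_Pn sets.Int_space_eq2 flip: space_Pn)
    also have "\<dots> = (\<integral>x. lr n \<theta> (t n) x * indicator (A n) x \<partial>Pn n \<theta>)"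
      by (rule integral_Pn[OF \<theta> t]) measurable
    \<comment> \<open>Truncation at K: a ratio up to K contributes at most K on \<open>A n\<close>,
      and a larger one is at most its square divided by K.\<close>
    also have "\<dots> \<le> (\<integral>x. K * indicator (A n) x + (lr n \<theta> (t n) x)\<^sup>2 / K \<partial>Pn n \<theta>)"
    proof (rule integral_mono)
      show "integrable (Pn n \<theta>) (\<lambda>x. lr n \<theta> (t n) x * indicator (A n) x)"
        using integrable_real_mult_indicator[OF An(1) lr_integrable[OF \<theta> t]] .
      show "integrable (Pn n \<theta>) (\<lambda>x. K * indicator (A n) x + (lr n \<theta> (t n) x)\<^sup>2 / K)"
        using isq by (intro Bochner_Integration.integrable_add integrable_mult_right) (auto simp: integrable_indicator_iff less_top[symmetric])
      fix x
      show "lr n \<theta> (t n) x * indicator (A n) x \<le> K * indicator (A n) x + (lr n \<theta> (t n) x)\<^sup>2 / K"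
      proof (cases "lr n \<theta> (t n) x \<le> K")
        case True
        moreover have "0 \<le> (lr n \<theta> (t n) x)\<^sup>2 / K" using K by simp
        ultimately have "lr n \<theta> (t n) x \<le> K + (lr n \<theta> (t n) x)\<^sup>2 / K" by linarith
        then show ?thesis using K by (auto simp: indicator_def)
      next
        case False
        then have "K * lr n \<theta> (t n) x \<le> lr n \<theta> (t n) x * lr n \<theta> (t n) x" using K by (intro mult_right_mono) auto
        then have "lr n \<theta> (t n) x \<le> (lr n \<theta> (t n) x)\<^sup>2 / K" using K by (simp add: field_simps power2_eq_square)
        then show ?thesis using K by (auto simp: indicator_def)
      qed
    qed
    also have "\<dots> = K * measure (Pn n \<theta>) (A n) + exp (c n) / K"
    proof -
      have "(\<integral>x. (lr n \<theta> (t n) x)\<^sup>2 \<partial>Pn n \<theta>) = exp (c n)"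
        unfolding sq using integral_lr[OF \<theta> elim] by simp
      then show ?thesis
        using isq by (subst Bochner_Integration.integral_add) (auto simp: integrable_indicator_iff less_top[symmetric])
    qed
    also have "\<dots> \<le> K * measure (Pn n \<theta>) (A n) + C / K" using C(2)[of n] K by (simp add: divide_right_mono)
    finally show ?case .
  qed
  show ?thesis
  proof (rule tendstoI)
    fix e :: real assume e: "e > 0"
    \<comment> \<open>With this K the second-moment term is e / 2, and the null probability of
      \<open>A n\<close> only has to fall below e / (2 * K).\<close>
    define K where "K = 2 * C / e"
    have K: "K > 0" using C e by (simp add: K_def)
    have CK: "C / K = e / 2" using C e by (simp add: K_def)
    have "\<forall>\<^sub>F n in sequentially. measure (Pn n \<theta>) (A n) < e / (2 * K)"
      using order_tendstoD(2)[OF null, of "e / (2 * K)"] e K by simp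
    with bound[OF K] show "\<forall>\<^sub>F n in sequentially. dist (measure (Pn n (t n)) (A n)) 0 < e"
    proof eventually_elim
      case (elim n)
      have "K * measure (Pn n \<theta>) (A n) < e / 2" using elim(2) K by (simp add: field_simps)
      then show ?case using elim(1) CK by simp
    qed
  qed
qed

section \<open>Central limit theorem along a moving parameter\<close>

lemma poly_growth_norm_power: "poly_growth (\<lambda>x. (1 + norm (T x)) ^ k)"
  unfolding poly_growth_def by (auto intro!: exI[of _ 1] exI[of _ k])

text \<open>The third-moment remainder is kept explicit, in terms continuous in the parameter, so
  that it can be bounded uniformly along a convergent parameter sequence.\<close>

lemma char_single_bound:
  assumes \<theta>: "\<theta> \<in> \<Theta>"
  shows "cmod (char (distr (P \<theta>) borel (\<lambda>x. u \<bullet> (T x - mean \<theta>))) s - complex_of_real (1 - s\<^sup>2 * (u \<bullet> cov \<theta> u) / 2))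
    \<le> \<bar>s\<bar> ^ 3 / 6 * ((norm u * (1 + norm (mean \<theta>))) ^ 3 * (\<integral>x. (1 + norm (T x)) ^ 3 \<partial>P \<theta>))"
proof -
  interpret prob_space "P \<theta>" by (rule prob_space_P[OF \<theta>])
  let ?X = "\<lambda>x. u \<bullet> (T x - mean \<theta>)"
  let ?b = "(norm u * (1 + norm (mean \<theta>)))"
  have [measurable]: "?X \<in> borel_measurable (P \<theta>)" by simp
  have Xb: "\<bar>?X x\<bar> \<le> ?b * (1 + norm (T x))" for x
  proof -
    have "\<bar>?X x\<bar> \<le> norm u * norm (T x - mean \<theta>)" by (rule Cauchy_Schwarz_ineq2)
    also have "\<dots> \<le> norm u * ((1 + norm (mean \<theta>)) * (1 + norm (T x)))"
    proof (rule mult_left_mono)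
      have "norm (T x - mean \<theta>) \<le> norm (T x) + norm (mean \<theta>)" by (rule norm_triangle_ineq4)
      also have "\<dots> \<le> (1 + norm (mean \<theta>)) * (1 + norm (T x))" by (simp add: algebra_simps)
      finally show "norm (T x - mean \<theta>) \<le> (1 + norm (mean \<theta>)) * (1 + norm (T x))" .
    qed auto
    finally show ?thesis by (simp add: mult.assoc)
  qed
  have iX: "integrable (P \<theta>) (\<lambda>x. (?X x) ^ k)" for k
  proof (rule Bochner_Integration.integrable_bound)
    show "integrable (P \<theta>) (\<lambda>x. ?b ^ k * (1 + norm (T x)) ^ k)"
      using integrable_P[OF \<theta> poly_growth_norm_power[of k]] by simp
    show "AE x in P \<theta>. norm (?X x ^ k) \<le> norm (?b ^ k * (1 + norm (T x)) ^ k)"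
    proof (rule AE_I2)
      fix x
      have "norm (?X x ^ k) \<le> (?b * (1 + norm (T x))) ^ k"
        unfolding real_norm_def power_abs by (intro power_mono Xb) auto
      then show "norm (?X x ^ k) \<le> norm (?b ^ k * (1 + norm (T x)) ^ k)"
        unfolding power_mult_distrib real_norm_def by linarith
    qed
  qed simp
  have E0: "expectation ?X = 0"
    using integrable_P[OF \<theta> poly_growth_T] by (simp add: mean_eq_integral[OF \<theta>] prob_space[simplified])
  have V: "variance ?X = u \<bullet> cov \<theta> u"
    using E0 by (simp add: inner_cov[OF \<theta>] power2_eq_square)
  have "cmod (char (distr (P \<theta>) borel ?X) s - (1 - s\<^sup>2 * (u \<bullet> cov \<theta> u) / 2))
      \<le> (s\<^sup>2 / 6) * expectation (\<lambda>x. min (6 * (?X x)\<^sup>2) (\<bar>s\<bar> * \<bar>?X x\<bar> ^ 3))"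
    using char_approx3'[OF _ _ iX[of 2] E0 V refl, of s] iX[of 1] by simp
  also have "\<dots> \<le> (s\<^sup>2 / 6) * expectation (\<lambda>x. \<bar>s\<bar> * (?b ^ 3 * (1 + norm (T x)) ^ 3))"
  proof (intro mult_left_mono integral_mono)
    have i3: "integrable (P \<theta>) (\<lambda>x. \<bar>s\<bar> * \<bar>?X x\<bar> ^ 3)"
      using integrable_abs[OF iX[of 3]] by (simp add: power_abs)
    show "integrable (P \<theta>) (\<lambda>x. min (6 * (?X x)\<^sup>2) (\<bar>s\<bar> * \<bar>?X x\<bar> ^ 3))"
      using i3 iX[of 2] by (intro integrable_min) auto
    show "integrable (P \<theta>) (\<lambda>x. \<bar>s\<bar> * (?b ^ 3 * (1 + norm (T x)) ^ 3))"
      using integrable_P[OF \<theta> poly_growth_norm_power[of 3]] by simp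
    fix x
    have "\<bar>?X x\<bar> ^ 3 \<le> (?b * (1 + norm (T x))) ^ 3" by (intro power_mono Xb) auto
    then have "\<bar>s\<bar> * \<bar>?X x\<bar> ^ 3 \<le> \<bar>s\<bar> * (?b ^ 3 * (1 + norm (T x)) ^ 3)"
      unfolding power_mult_distrib by (intro mult_left_mono) auto
    then show "min (6 * (?X x)\<^sup>2) (\<bar>s\<bar> * \<bar>?X x\<bar> ^ 3) \<le> \<bar>s\<bar> * (?b ^ 3 * (1 + norm (T x)) ^ 3)" by linarith
  qed auto
  also have "\<dots> = \<bar>s\<bar> ^ 3 / 6 * (?b ^ 3 * (\<integral>x. (1 + norm (T x)) ^ 3 \<partial>P \<theta>))"
    by (simp add: power3_eq_cube power2_eq_square abs_mult_self_eq)
  finally show ?thesis by simp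
qed

lemma char_score:
  assumes \<theta>: "\<theta> \<in> \<Theta>"
  shows "(\<integral>x. iexp (u \<bullet> S n \<theta> x) \<partial>Pn n \<theta>)
     = (char (distr (P \<theta>) borel (\<lambda>x. u \<bullet> (T x - mean \<theta>))) (1 / sqrt (real n))) ^ n"
proof -
  interpret prob_space "P \<theta>" by (rule prob_space_P[OF \<theta>])
  interpret product_sigma_finite "\<lambda>_::nat. P \<theta>"
    by (simp add: product_sigma_finite_def sigma_finite_measure_axioms)
  let ?f = "\<lambda>y. iexp ((1 / sqrt (real n)) * (u \<bullet> (T y - mean \<theta>)))"
  have "iexp (u \<bullet> S n \<theta> x) = (\<Prod>i<n. ?f (x i))" for x
  proof -
    have "u \<bullet> S n \<theta> x = (\<Sum>i<n. (1 / sqrt (real n)) * (u \<bullet> (T (x i) - mean \<theta>)))"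
      unfolding S_def by (simp add: inner_sum_right sum_distrib_left divide_inverse)
    then show ?thesis by (simp only: of_real_sum sum_distrib_left exp_sum[OF finite_lessThan])
  qed
  then have "(\<integral>x. iexp (u \<bullet> S n \<theta> x) \<partial>Pn n \<theta>) = (\<integral>x. (\<Prod>i<n. ?f (x i)) \<partial>PiM {..<n} (\<lambda>_. P \<theta>))"
    by (simp only: Pn_def)
  also have "\<dots> = (\<Prod>i<n. \<integral>y. ?f y \<partial>P \<theta>)"
    by (rule product_integral_prod) (auto intro!: integrable_const_bound[where B=1])
  also have "\<dots> = (\<integral>y. ?f y \<partial>P \<theta>) ^ n" by simp
  also have "(\<integral>y. ?f y \<partial>P \<theta>) = char (distr (P \<theta>) borel (\<lambda>x. u \<bullet> (T x - mean \<theta>))) (1 / sqrt (real n))"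
    unfolding char_def by (subst integral_distr) auto
  finally show ?thesis .
qed

text \<open>A triangular-array limit theorem. Two numbers in the unit disc have n-th powers that
  differ by at most n times their distance, and here n times the distance is of order n to the -1/2
  plus the change in the variance.\<close>

lemma score_clt_center:
  assumes \<theta>: "\<theta> \<in> \<Theta>" and t: "\<And>n. t n \<in> \<Theta>" and lim: "t \<longlonglongrightarrow> \<theta>"
  shows "(\<lambda>n. \<integral>x. iexp (u \<bullet> S n (t n) x) \<partial>Pn n (t n)) \<longlonglongrightarrow> complex_of_real (exp (- (u \<bullet> cov \<theta> u) / 2))"
proof -
  define \<psi> where "\<psi> n = char (distr (P (t n)) borel (\<lambda>x. u \<bullet> (T x - mean (t n)))) (1 / sqrt (real n))" for n
  let ?v = "u \<bullet> cov \<theta> u"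
  define B where "B n = (norm u * (1 + norm (mean (t n)))) ^ 3 * (\<integral>x. (1 + norm (T x)) ^ 3 \<partial>P (t n))" for n
  have cont: "(\<lambda>n. f (t n)) \<longlonglongrightarrow> f \<theta>" if "continuous_on \<Theta> f" for f :: "'v \<Rightarrow> 'b::real_normed_vector"
    using that open_\<Theta> \<theta> lim continuous_on_eq_continuous_at isCont_tendsto_compose by blast
  have m: "(\<lambda>n. mean (t n)) \<longlonglongrightarrow> mean \<theta>" by (rule cont[OF continuous_on_mean])
  have e: "(\<lambda>n. \<integral>x. (1 + norm (T x)) ^ 3 \<partial>P (t n)) \<longlonglongrightarrow> expint (\<lambda>x. (1 + norm (T x)) ^ 3) \<theta> /\<^sub>R Z \<theta>"
  proof -
    have "continuous_on \<Theta> (expint (\<lambda>x. (1 + norm (T x)) ^ 3))"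
      using expint_has_derivative[OF _ poly_growth_norm_power[of 3]]
      by (intro continuous_at_imp_continuous_on ballI has_derivative_continuous)
    moreover have "continuous_on \<Theta> Z"
      using Z_has_derivative by (intro continuous_at_imp_continuous_on ballI has_derivative_continuous)
    ultimately have "(\<lambda>n. expint (\<lambda>x. (1 + norm (T x)) ^ 3) (t n) /\<^sub>R Z (t n)) \<longlonglongrightarrow> expint (\<lambda>x. (1 + norm (T x)) ^ 3) \<theta> /\<^sub>R Z \<theta>"
      using Z_pos[OF \<theta>] by (intro tendsto_intros cont) auto
    then show ?thesis using t by (simp add: integral_P)
  qed
  have "B \<longlonglongrightarrow> (norm u * (1 + norm (mean \<theta>))) ^ 3 * (expint (\<lambda>x. (1 + norm (T x)) ^ 3) \<theta> /\<^sub>R Z \<theta>)"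
    unfolding B_def by (intro tendsto_intros m e)
  from tendsto_imp_norm_bound[OF this] obtain K where K: "K > 0" "\<And>n. B n \<le> K"
    by (auto intro: order_trans[OF abs_ge_self])
  \<comment> \<open>The comparison uses the limiting variance rather than that at
    \<open>t n\<close>, so that the n-th power has the standard exponential limit.\<close>
  let ?w = "\<lambda>n. complex_of_real (1 + (- ?v / 2) / real n)"
  have c: "(\<lambda>n. u \<bullet> cov (t n) u) \<longlonglongrightarrow> ?v"
    by (intro tendsto_intros cont continuous_on_cov)
  let ?e = "\<lambda>n. \<bar>u \<bullet> cov (t n) u - ?v\<bar> / 2 + K / 6 * inverse (sqrt (real n))"
  have "\<forall>\<^sub>F n in sequentially. norm (\<psi> n ^ n - ?w n ^ n) \<le> ?e n"
  proof (rule eventually_sequentiallyI)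
    \<comment> \<open>From here on ?v / n lies between 0 and 1, which keeps the comparison value 1 -
      ?v / (2 n) in the unit disc.\<close>
    fix n assume "n \<ge> max 1 (nat \<lceil>?v\<rceil>)"
    then have n: "n \<ge> 1" "real n \<ge> ?v" by linarith+
    have sn: "sqrt (real n) > 0" using n by simp
    interpret prob_space "P (t n)" by (rule prob_space_P[OF t])
    interpret D: real_distribution "distr (P (t n)) borel (\<lambda>x. u \<bullet> (T x - mean (t n)))"
      by (rule real_distribution_distr) simp
    have "norm (\<psi> n ^ n - ?w n ^ n) \<le> real n * norm (\<psi> n - ?w n)"
    proof (rule norm_power_diff)
      show "norm (\<psi> n) \<le> 1" unfolding \<psi>_def by (rule D.cmod_char_le_1)
      have "\<bar>1 + (- ?v / 2) / real n\<bar> \<le> 1" using n cov_nonneg[OF \<theta>, of u] by (simp add: field_simps abs_le_iff)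
      then show "norm (?w n) \<le> 1" by (simp only: norm_of_real)
    qed
    also have "norm (\<psi> n - ?w n) \<le> norm (\<psi> n - complex_of_real (1 - (1 / sqrt (real n))\<^sup>2 * (u \<bullet> cov (t n) u) / 2))
       + norm (complex_of_real (1 - (1 / sqrt (real n))\<^sup>2 * (u \<bullet> cov (t n) u) / 2) - ?w n)"
      by (rule norm_diff_triangle_le) (rule order_refl)+
    also have "norm (\<psi> n - complex_of_real (1 - (1 / sqrt (real n))\<^sup>2 * (u \<bullet> cov (t n) u) / 2)) \<le> \<bar>1 / sqrt (real n)\<bar> ^ 3 / 6 * B n"
      unfolding \<psi>_def B_def by (rule char_single_bound[OF t])
    also have "\<dots> \<le> \<bar>1 / sqrt (real n)\<bar> ^ 3 / 6 * K" by (intro mult_left_mono K) auto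
    also have "\<bar>1 / sqrt (real n)\<bar> ^ 3 = inverse (real n) * inverse (sqrt (real n))"
      using n by (simp add: power3_eq_cube field_simps)
    also have "norm (complex_of_real (1 - (1 / sqrt (real n))\<^sup>2 * (u \<bullet> cov (t n) u) / 2) - ?w n)
        = inverse (real n) * (\<bar>u \<bullet> cov (t n) u - ?v\<bar> / 2)"
    proof -
      have "(1 - (1 / sqrt (real n))\<^sup>2 * (u \<bullet> cov (t n) u) / 2) - (1 + (- ?v / 2) / real n)
         = inverse (real n) * ((?v - u \<bullet> cov (t n) u) / 2)"
        using n by (simp add: power_divide field_simps)
      then show ?thesis
        by (simp only: of_real_diff[symmetric] norm_of_real abs_mult abs_divide) (simp add: abs_minus_commute)
    qed
    finally have "norm (\<psi> n ^ n - ?w n ^ n) \<le> real n * (inverse (real n) * inverse (sqrt (real n)) / 6 * K + inverse (real n) * (\<bar>u \<bullet> cov (t n) u - ?v\<bar> / 2))"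
      by (simp add: mult_left_mono)
    also have "\<dots> = ?e n" using n by (simp add: field_simps)
    finally show "norm (\<psi> n ^ n - ?w n ^ n) \<le> ?e n" .
  qed
  moreover have "?e \<longlonglongrightarrow> 0"
  proof -
    have i: "(\<lambda>n. inverse (sqrt (real n))) \<longlonglongrightarrow> 0"
      by (intro tendsto_inverse_0_at_top filterlim_compose[OF sqrt_at_top] filterlim_real_sequentially)
    have "?e \<longlonglongrightarrow> \<bar>?v - ?v\<bar> / 2 + K / 6 * 0"
      by (intro tendsto_intros c i) auto
    then show ?thesis by simp
  qed
  ultimately have "(\<lambda>n. \<psi> n ^ n - ?w n ^ n) \<longlonglongrightarrow> 0" by (rule Lim_null_comparison)
  moreover have "(\<lambda>n. ?w n ^ n) \<longlonglongrightarrow> complex_of_real (exp (- ?v / 2))"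
    unfolding of_real_power[symmetric]
    by (rule isCont_tendsto_compose[OF _ tendsto_exp_limit_sequentially]) auto
  ultimately have "(\<lambda>n. \<psi> n ^ n) \<longlonglongrightarrow> complex_of_real (exp (- ?v / 2))"
    by (rule Lim_transform[rotated])
  then show ?thesis using t by (simp add: char_score \<psi>_def)
qed

text \<open>The conclusion of Le Cam's third lemma, obtained by recentring: the score at
  \<open>t n\<close> is centred under its own law, and the score at \<open>\<theta>\<close> differs
  from it by sqrt n times an increment of \<open>mean\<close>, which converges to
  \<open>cov \<theta> h\<close>.\<close>

lemma score_clt:
  assumes \<theta>: "\<theta> \<in> \<Theta>" and t: "\<And>n. t n \<in> \<Theta>"
    and lim: "(\<lambda>n. sqrt (real n) *\<^sub>R (t n - \<theta>)) \<longlonglongrightarrow> h"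
  shows "(\<lambda>n. \<integral>x. iexp (u \<bullet> S n \<theta> x) \<partial>Pn n (t n))
    \<longlonglongrightarrow> iexp (u \<bullet> cov \<theta> h) * complex_of_real (exp (- (u \<bullet> cov \<theta> u) / 2))"
proof -
  have t\<theta>: "t \<longlonglongrightarrow> \<theta>" using sqrt_scaled_imp_null[OF lim] by (simp add: LIM_zero_iff)
  let ?s = "\<lambda>n. u \<bullet> (sqrt (real n) *\<^sub>R (mean (t n) - mean \<theta>))"
  have s: "?s \<longlonglongrightarrow> u \<bullet> cov \<theta> h"
    by (intro tendsto_intros has_derivative_sqrt_scaled_limit[OF mean_has_derivative[OF \<theta>] lim])
  have "(\<integral>x. iexp (u \<bullet> S n \<theta> x) \<partial>Pn n (t n)) = iexp (?s n) * (\<integral>x. iexp (u \<bullet> S n (t n) x) \<partial>Pn n (t n))" for n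
  proof -
    have "iexp (u \<bullet> S n \<theta> x) = iexp (?s n) * iexp (u \<bullet> S n (t n) x)" for x
    proof -
      have "u \<bullet> S n \<theta> x = ?s n + u \<bullet> S n (t n) x"
        by (subst S_shift[of n "t n" x \<theta>]) (simp add: inner_diff_right)
      then show ?thesis by (simp only: of_real_add distrib_left exp_add)
    qed
    then show ?thesis by (simp only: integral_mult_right_zero)
  qed
  moreover have "(\<lambda>n. iexp (?s n) * (\<integral>x. iexp (u \<bullet> S n (t n) x) \<partial>Pn n (t n)))
     \<longlonglongrightarrow> iexp (u \<bullet> cov \<theta> h) * complex_of_real (exp (- (u \<bullet> cov \<theta> u) / 2))"
    by (intro tendsto_mult score_clt_center[OF \<theta> t t\<theta>] tendsto_exp tendsto_of_real tendsto_const s)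
  ultimately show ?thesis by simp
qed

end

section \<open>Two-sided normal power and plug-in scores\<close>

abbreviation normal_law :: "real \<Rightarrow> real measure" where
  "normal_law \<mu> \<equiv> density lborel (\<lambda>x. ennreal (normal_density \<mu> 1 x))"

abbreviation std_cdf :: "real \<Rightarrow> real" where
  "std_cdf \<equiv> cdf std_normal_distribution"

lemma real_distribution_normal_law: "real_distribution (normal_law \<mu>)"
  using prob_space_normal_density[of 1 \<mu>] by (simp add: real_distribution_def real_distribution_axioms_def)

lemma normal_law_eq_distr: "normal_law \<mu> = distr std_normal_distribution borel ((+) \<mu>)"
proof -
  have "normal_law \<mu> = density (distr lborel borel ((+) \<mu>)) (\<lambda>x. ennreal (normal_density \<mu> 1 x))"
    by (simp add: lborel_distr_plus)
  also have "\<dots> = distr (density lborel (\<lambda>x. ennreal (normal_density \<mu> 1 (\<mu> + x)))) borel ((+) \<mu>)"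
    by (rule density_distr) auto
  also have "(\<lambda>x. normal_density \<mu> 1 (\<mu> + x)) = std_normal_density"
    by (rule ext) (simp add: normal_density_def)
  finally show ?thesis .
qed

lemma normal_law_countable:
  assumes "countable A"
  shows "emeasure (normal_law \<mu>) A = 0"
proof -
  have [measurable]: "A \<in> sets borel" using assms by (rule sets.countable[rotated]) auto
  have "A \<in> null_sets lborel" using assms by (rule countable_imp_null_set_lborel)
  then have "A \<in> null_sets (normal_law \<mu>)"
    by (subst null_sets_density_iff) (auto dest: AE_not_in elim!: eventually_mono)
  then show ?thesis by auto
qed

text \<open>Any antiderivative of the continuous density has the same increments as the distribution
  function, by the fundamental theorem of calculus on intervals, so the two differ by a
  constant.\<close>

lemma std_cdf_DERIV: "(std_cdf has_real_derivative std_normal_density x) (at x)"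
proof -
  interpret N: real_distribution std_normal_distribution by (rule real_distribution_normal_law)
  have cont: "isCont std_normal_density y" for y
    unfolding normal_density_def by (intro continuous_intros) auto
  obtain F where F: "\<And>x. (F has_real_derivative std_normal_density x) (at x)"
    using einterval_antiderivative[of "-\<infinity>" "\<infinity>" std_normal_density] cont
    by (auto simp: has_real_derivative_iff_has_vector_derivative)
  have diff: "std_cdf b - std_cdf a = F b - F a" if "a < b" for a b
  proof -
    have nn: "F a \<le> F b"
      by (rule DERIV_nonneg_imp_nondecreasing[of a b F]) (use that F in \<open>auto intro!: exI[of _ "std_normal_density _"]\<close>)
    have "std_cdf b - std_cdf a = measure std_normal_distribution {a<..b}"
      by (rule N.cdf_diff_eq[OF that])
    also have "\<dots> = measure std_normal_distribution {a..b}"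
    proof -
      have "measure std_normal_distribution {a} = 0" using normal_law_countable[of "{a}" 0] by (simp add: measure_def)
      moreover have "{a..b} = {a} \<union> {a<..b}" using that by auto
      moreover have "N.prob ({a} \<union> {a<..b}) = N.prob {a} + N.prob {a<..b}"
        by (rule N.finite_measure_Union) auto
      ultimately show ?thesis by simp
    qed
    also have "emeasure std_normal_distribution {a..b} = ennreal (F b - F a)"
      by (subst emeasure_density) (use that F in \<open>auto intro!: nn_integral_FTC_Icc\<close>)
    then have "measure std_normal_distribution {a..b} = F b - F a" using nn by (simp add: measure_def)
    finally show ?thesis .
  qed
  define c where "c = std_cdf 0 - F 0"
  have "std_cdf y = F y + c" for y
    using diff[of 0 y] diff[of y 0] unfolding c_def by (cases y "0::real" rule: linorder_cases) auto
  then have "std_cdf = (\<lambda>y. F y + c)" by auto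
  moreover have "((\<lambda>y. F y + c) has_real_derivative std_normal_density x + 0) (at x)"
    by (intro DERIV_add F DERIV_const)
  ultimately show ?thesis by simp
qed

text \<open>The density is even, so the sum of the values at x and - x has derivative zero; its
  limit at infinity identifies the constant as 1.\<close>

lemma std_cdf_minus: "std_cdf (- x) = 1 - std_cdf x"
proof -
  interpret N: real_distribution std_normal_distribution by (rule real_distribution_normal_law)
  let ?h = "\<lambda>x. std_cdf x + std_cdf (- x)"
  have "(?h has_real_derivative 0) (at y)" for y
  proof -
    have "(?h has_real_derivative std_normal_density y + std_normal_density (- y) * (- 1)) (at y)"
      by (intro DERIV_add std_cdf_DERIV DERIV_chain2[of std_cdf] DERIV_minus DERIV_ident)
    then show ?thesis by (simp add: normal_density_def)
  qed
  then have const: "?h y = ?h z" for y z using DERIV_isconst_all[of ?h y z] by blast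
  have "(?h \<longlongrightarrow> 1 + 0) at_top"
    by (intro tendsto_add N.cdf_lim_at_top_prob filterlim_compose[OF N.cdf_lim_at_bot filterlim_uminus_at_bot_at_top])
  moreover have "(?h \<longlongrightarrow> ?h x) at_top"
    by (rule tendsto_eventually) (use const in auto)
  ultimately have "1 + 0 = ?h x" by (rule tendsto_unique[OF trivial_limit_at_top_linorder])
  then show ?thesis by simp
qed

lemma std_cdf_strict_mono: "strict_mono std_cdf"
proof (rule strict_monoI)
  fix x y :: real assume "x < y"
  then show "std_cdf x < std_cdf y"
    by (rule DERIV_pos_imp_increasing) (use std_cdf_DERIV in \<open>auto intro!: exI[of _ "std_normal_density _"] simp: normal_density_pos\<close>)
qed

definition two_sided_power :: "real \<Rightarrow> real \<Rightarrow> real" where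
  "two_sided_power z \<mu> = 1 - (std_cdf (z - \<mu>) - std_cdf (- z - \<mu>))"

lemma measure_normal_law_two_sided:
  assumes "z > 0"
  shows "measure (normal_law \<mu>) {x. \<bar>x\<bar> > z} = two_sided_power z \<mu>"
proof -
  interpret N: real_distribution std_normal_distribution by (rule real_distribution_normal_law)
  have "measure (normal_law \<mu>) {x. \<bar>x\<bar> > z} = measure std_normal_distribution {x. \<bar>\<mu> + x\<bar> > z}"
    by (subst normal_law_eq_distr[of \<mu>], subst measure_distr) auto
  also have "{x. \<bar>\<mu> + x\<bar> > z} = space std_normal_distribution - ({- z - \<mu>} \<union> {- z - \<mu> <.. z - \<mu>})"
    using assms by (auto simp: abs_real_def)
  also have "measure std_normal_distribution \<dots> = 1 - measure std_normal_distribution ({- z - \<mu>} \<union> {- z - \<mu> <.. z - \<mu>})"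
    by (rule N.prob_compl) simp
  also have "measure std_normal_distribution ({- z - \<mu>} \<union> {- z - \<mu> <.. z - \<mu>}) = measure std_normal_distribution {- z - \<mu> <.. z - \<mu>}"
    using normal_law_countable[of "{- z - \<mu>}" 0] by (subst N.finite_measure_Union) (auto simp: measure_def)
  also have "\<dots> = std_cdf (z - \<mu>) - std_cdf (- z - \<mu>)"
    using assms by (intro N.cdf_diff_eq[symmetric]) simp
  finally show ?thesis by (simp add: two_sided_power_def)
qed

lemma two_sided_power_abs: "two_sided_power z \<bar>\<mu>\<bar> = two_sided_power z \<mu>"
  using std_cdf_minus[of "z + \<mu>"] std_cdf_minus[of "z - \<mu>"]
  by (simp add: two_sided_power_def abs_real_def)

text \<open>For nonnegative z and x the point z - x is at least as close to the origin as - z - x,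
  so the derivative, a difference of normal densities, is nonnegative. This makes the boundary
  alternatives the least favourable ones.\<close>

lemma two_sided_power_mono:
  assumes "z \<ge> 0" "0 \<le> a" "a \<le> b"
  shows "two_sided_power z a \<le> two_sided_power z b"
proof (rule DERIV_nonneg_imp_nondecreasing[OF assms(3)])
  fix x assume x: "a \<le> x" "x \<le> b"
  have "(two_sided_power z has_real_derivative std_normal_density (z - x) - std_normal_density (- z - x)) (at x)"
    unfolding two_sided_power_def[abs_def]
    by (auto intro!: derivative_eq_intros DERIV_chain2[of std_cdf] std_cdf_DERIV)
  moreover have "std_normal_density (- z - x) \<le> std_normal_density (z - x)"
  proof -
    have "(z - x)\<^sup>2 \<le> (- z - x)\<^sup>2" using assms x by (simp add: power2_eq_square algebra_simps)
    then show ?thesis by (simp add: normal_density_def divide_right_mono)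
  qed
  ultimately show "\<exists>y. (two_sided_power z has_real_derivative y) (at x) \<and> 0 \<le> y" by force
qed

text \<open>The quantile is a definite description, so it can be evaluated only after existence
  (intermediate values) and uniqueness (strict monotonicity) are established.\<close>

lemma normal_upper_quantile:
  assumes "0 < \<beta>" "\<beta> < 1"
  shows "std_cdf (normal_upper_quantile \<beta>) = 1 - \<beta>"
proof -
  interpret N: real_distribution std_normal_distribution by (rule real_distribution_normal_law)
  have U: "measure std_normal_distribution {z<..} = 1 - std_cdf z" for z
  proof -
    have "{z<..} = space std_normal_distribution - {..z}" by auto
    then show ?thesis using N.prob_compl[of "{..z}"] by (simp add: cdf_def)
  qed
  obtain l where l: "std_cdf l < 1 - \<beta>"
    using eventually_happens'[OF trivial_limit_at_bot_linorder order_tendstoD(2)[OF N.cdf_lim_at_bot, of "1 - \<beta>"]] assms by auto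
  obtain u where u: "std_cdf u > 1 - \<beta>"
    using eventually_happens'[OF trivial_limit_at_top_linorder order_tendstoD(1)[OF N.cdf_lim_at_top_prob, of "1 - \<beta>"]] assms by auto
  have "std_cdf l < std_cdf u" using l u by (rule less_trans)
  then have "l < u" by (simp only: strict_mono_less[OF std_cdf_strict_mono])
  then have "\<exists>z\<ge>l. z \<le> u \<and> std_cdf z = 1 - \<beta>"
    by (intro IVT) (use l u DERIV_isCont[OF std_cdf_DERIV] in simp_all)
  then obtain z where z: "std_cdf z = 1 - \<beta>" by blast
  have "normal_upper_quantile \<beta> = z"
    unfolding normal_upper_quantile_def
  proof (rule the_equality)
    show "measure std_normal_distribution {z<..} = \<beta>" using U z by simp
    show "w = z" if "measure std_normal_distribution {w<..} = \<beta>" for w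
      using that U[of w] z std_cdf_strict_mono strict_mono_eq by fastforce
  qed
  then show ?thesis using z by simp
qed

lemma two_sided_power_quantile:
  assumes "0 < \<alpha>" "\<alpha> < 1"
  shows "normal_upper_quantile (\<alpha> / 2) > 0" "two_sided_power (normal_upper_quantile (\<alpha> / 2)) 0 = \<alpha>"
proof -
  let ?z = "normal_upper_quantile (\<alpha> / 2)"
  have z: "std_cdf ?z = 1 - \<alpha> / 2" by (rule normal_upper_quantile) (use assms in auto)
  have "std_cdf 0 = 1 / 2" using std_cdf_minus[of 0] by simp
  then have "std_cdf 0 < std_cdf ?z" using z assms by simp
  then show "?z > 0" using std_cdf_strict_mono by (simp add: strict_mono_less)
  show "two_sided_power ?z 0 = \<alpha>" using z std_cdf_minus[of ?z] by (simp add: two_sided_power_def)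
qed

text \<open>The rejection region has at most the two boundary points z and - z, a null set of the
  limit law, so weak convergence passes to its probability.\<close>

lemma weak_conv_two_sided:
  assumes "\<And>n. real_distribution (M n)" "weak_conv_m M (normal_law \<mu>)" "z > 0"
  shows "(\<lambda>n. measure (M n) {x. \<bar>x\<bar> > z}) \<longlonglongrightarrow> two_sided_power z \<mu>"
proof -
  have "{x. \<bar>x\<bar> > z} = {..<- z} \<union> {z<..}" using assms(3) by (auto simp: abs_real_def)
  then have "frontier {x. \<bar>x\<bar> > z} \<subseteq> {- z} \<union> {z}"
    using frontier_Un_subset[of "{..<- z}" "{z<..}"] by simp
  then have "countable (frontier {x. \<bar>x\<bar> > z})" by (rule countable_subset) simp
  then have "(\<lambda>n. measure (M n) {x. \<bar>x\<bar> > z}) \<longlonglongrightarrow> measure (normal_law \<mu>) {x. \<bar>x\<bar> > z}"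
    by (intro weak_conv_imp_continuity_set_conv assms real_distribution_normal_law normal_law_countable) auto
  then show ?thesis by (simp only: measure_normal_law_two_sided[OF assms(3)])
qed

section \<open>Tightness of the score and the plug-in expansion\<close>

context exponential_family
begin

text \<open>exp (u . S) is a constant multiple of the likelihood ratio at \<open>\<theta>\<close> +
  u / sqrt n, so its expectation is exactly exp (n * bregman), which converges; the 1 is
  slack.\<close>

lemma exp_score_moment:
  assumes \<theta>: "\<theta> \<in> \<Theta>"
  shows "\<forall>\<^sub>F n in sequentially. integrable (Pn n \<theta>) (\<lambda>x. exp (u \<bullet> S n \<theta> x)) \<and>
    (\<integral>x. exp (u \<bullet> S n \<theta> x) \<partial>Pn n \<theta>) \<le> exp (u \<bullet> cov \<theta> u / 2) + 1"
proof -
  define t where "t n = \<theta> + u /\<^sub>R sqrt (real n)" for n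
  have lim: "(\<lambda>n. sqrt (real n) *\<^sub>R (t n - \<theta>)) \<longlonglongrightarrow> u"
    by (rule tendsto_eventually) (auto simp: t_def intro!: eventually_sequentiallyI[of 1])
  have "(\<lambda>n. exp (real n * bregman \<theta> (t n))) \<longlonglongrightarrow> exp (u \<bullet> cov \<theta> u / 2)"
    by (intro tendsto_exp bregman_limit \<theta> lim)
  then have "\<forall>\<^sub>F n in sequentially. exp (real n * bregman \<theta> (t n)) < exp (u \<bullet> cov \<theta> u / 2) + 1"
    by (rule order_tendstoD(2)) simp
  with eventually_in_\<Theta>[OF \<theta> lim] eventually_ge_at_top[of 1] show ?thesis
  proof eventually_elim
    case (elim n)
    have "exp (u \<bullet> S n \<theta> x) = exp (real n * bregman \<theta> (t n)) * lr n \<theta> (t n) x" for x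
      using elim by (simp add: lr_def t_def exp_add[symmetric])
    then show ?case
      using elim lr_integrable[OF \<theta> elim(1)] integral_lr[OF \<theta> elim(1)] by simp
  qed
qed

lemma score_tight:
  assumes \<theta>: "\<theta> \<in> \<Theta>" and e: "e > 0"
  shows "\<exists>C>0. \<forall>\<^sub>F n in sequentially. measure (Pn n \<theta>) {x \<in> space (Pn n \<theta>). norm (S n \<theta> x) > C} \<le> e"
proof -
  define X where "X n x = (\<Sum>b\<in>Basis. exp (b \<bullet> S n \<theta> x) + exp ((- b) \<bullet> S n \<theta> x))" for n x
  define K where "K = (\<Sum>b\<in>(Basis :: 'v set). 2 * (exp (b \<bullet> cov \<theta> b / 2) + 1))"
  have K: "K > 0" unfolding K_def by (intro sum_pos) (auto simp: add_pos_pos)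
  \<comment> \<open>Chosen for Markov's inequality, K / c being at most e; c at least 1 makes ln c
    nonnegative.\<close>
  define c where "c = max 1 (K / e)"
  have c: "c \<ge> 1" "K / c \<le> e" using K e by (auto simp: c_def field_simps max_def)
  define d where "d = real DIM('v)"
  have d: "d > 0" by (simp add: d_def)
  have neg: "(- b) \<bullet> cov \<theta> (- b) = b \<bullet> cov \<theta> b" for b
    using linear_neg[OF linear_cov[OF \<theta>], of b] by simp
  have ev: "\<forall>\<^sub>F n in sequentially. \<forall>b\<in>Basis.
     (integrable (Pn n \<theta>) (\<lambda>x. exp (b \<bullet> S n \<theta> x)) \<and>
       (\<integral>x. exp (b \<bullet> S n \<theta> x) \<partial>Pn n \<theta>) \<le> exp (b \<bullet> cov \<theta> b / 2) + 1) \<and>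
     (integrable (Pn n \<theta>) (\<lambda>x. exp ((- b) \<bullet> S n \<theta> x)) \<and>
       (\<integral>x. exp ((- b) \<bullet> S n \<theta> x) \<partial>Pn n \<theta>) \<le> exp (b \<bullet> cov \<theta> b / 2) + 1)"
    by (intro eventually_ball_finite finite_Basis ballI, rule eventually_conj)
       (rule exp_score_moment[OF \<theta>], rule exp_score_moment[OF \<theta>, of "- _", unfolded neg])
  have "\<forall>\<^sub>F n in sequentially. measure (Pn n \<theta>) {x \<in> space (Pn n \<theta>). norm (S n \<theta> x) > d * ln c + 1} \<le> e"
    using ev
  proof eventually_elim
    case (elim n)
    interpret prob_space "Pn n \<theta>" by (rule prob_space_Pn[OF \<theta>])
    have int: "integrable (Pn n \<theta>) (X n)"
      unfolding X_def using elim by (intro Bochner_Integration.integrable_sum Bochner_Integration.integrable_add) auto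
    have "(\<integral>x. X n x \<partial>Pn n \<theta>) = (\<Sum>b\<in>Basis. (\<integral>x. exp (b \<bullet> S n \<theta> x) \<partial>Pn n \<theta>) + (\<integral>x. exp ((- b) \<bullet> S n \<theta> x) \<partial>Pn n \<theta>))"
      unfolding X_def using elim
      by (subst Bochner_Integration.integral_sum) (auto intro!: sum.cong Bochner_Integration.integral_add)
    also have "\<dots> \<le> K" unfolding K_def
    proof (rule sum_mono)
      fix b :: 'v assume "b \<in> Basis"
      with elim have "(\<integral>x. exp (b \<bullet> S n \<theta> x) \<partial>Pn n \<theta>) \<le> exp (b \<bullet> cov \<theta> b / 2) + 1"
        "(\<integral>x. exp ((- b) \<bullet> S n \<theta> x) \<partial>Pn n \<theta>) \<le> exp (b \<bullet> cov \<theta> b / 2) + 1" by blast+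
      from add_mono[OF this]
      show "(\<integral>x. exp (b \<bullet> S n \<theta> x) \<partial>Pn n \<theta>) + (\<integral>x. exp ((- b) \<bullet> S n \<theta> x) \<partial>Pn n \<theta>)
         \<le> 2 * (exp (b \<bullet> cov \<theta> b / 2) + 1)" by (simp only: mult_2)
    qed
    finally have EX: "(\<integral>x. X n x \<partial>Pn n \<theta>) \<le> K" .
    have "measure (Pn n \<theta>) {x \<in> space (Pn n \<theta>). norm (S n \<theta> x) > d * ln c + 1}
       \<le> measure (Pn n \<theta>) {x \<in> space (Pn n \<theta>). X n x \<ge> c}"
    proof (rule finite_measure_mono)
      show "{x \<in> space (Pn n \<theta>). X n x \<ge> c} \<in> events" unfolding X_def by measurable
      show "{x \<in> space (Pn n \<theta>). norm (S n \<theta> x) > d * ln c + 1} \<subseteq> {x \<in> space (Pn n \<theta>). X n x \<ge> c}"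
      proof safe
        fix x assume "d * ln c + 1 < norm (S n \<theta> x)"
        then have n: "d * ln c < norm (S n \<theta> x)" by simp
        \<comment> \<open>Otherwise the sum of the absolute coordinates, and with it the norm, would
          be at most d * ln c. The extra 1 in the threshold keeps it positive when c = 1.\<close>
        have "\<exists>b\<in>Basis. ln c \<le> \<bar>S n \<theta> x \<bullet> b\<bar>"
        proof (rule ccontr)
          assume "\<not> ?thesis"
          then have "(\<Sum>b\<in>(Basis::'v set). \<bar>S n \<theta> x \<bullet> b\<bar>) \<le> (\<Sum>b\<in>(Basis::'v set). ln c)"
            by (intro sum_mono) force
          then show False using n norm_le_l1[of "S n \<theta> x"] by (simp add: d_def)
        qed
        then obtain b where b: "b \<in> Basis" "ln c \<le> \<bar>S n \<theta> x \<bullet> b\<bar>" by blast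
        have "c = exp (ln c)" using c by simp
        also have "\<dots> \<le> exp \<bar>b \<bullet> S n \<theta> x\<bar>" using b by (simp only: exp_le_cancel_iff inner_commute)
        also have "\<dots> \<le> exp (b \<bullet> S n \<theta> x) + exp ((- b) \<bullet> S n \<theta> x)"
          by (cases "b \<bullet> S n \<theta> x \<ge> 0") (auto simp: add_increasing add_increasing2)
        also have "\<dots> \<le> X n x" unfolding X_def
          by (rule member_le_sum[where f="\<lambda>b. exp (b \<bullet> S n \<theta> x) + exp ((- b) \<bullet> S n \<theta> x)"])
             (use b(1) in \<open>auto simp: add_nonneg_nonneg\<close>)
        finally show "c \<le> X n x" .
      qed
    qed
    also have "\<dots> \<le> (\<integral>x. X n x \<partial>Pn n \<theta>) / c"
      by (rule integral_Markov_inequality_measure[OF int, of "{}"])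
         (use c in \<open>auto simp: X_def intro!: sum_nonneg add_nonneg_nonneg\<close>)
    also have "\<dots> \<le> K / c" using EX c by (intro divide_right_mono) auto
    also have "\<dots> \<le> e" by (rule c)
    finally show ?case .
  qed
  moreover have "d * ln c + 1 > 0" using c d by (intro add_nonneg_pos mult_nonneg_nonneg ln_ge_zero) auto
  ultimately show ?thesis by blast
qed

text \<open>On the event where the score and the scaled error of \<open>est\<close> are bounded, the
  change splits into the movement of \<open>v\<close> against the score, the Taylor error of
  \<open>mean\<close>, the movement of \<open>v\<close> against \<open>cov \<theta>\<close>, and a
  main term. The first three are small; \<open>dir\<close> makes the fourth vanish exactly.\<close>

lemma plugin_null:
  assumes \<theta>: "\<theta> \<in> \<Theta>" and v: "isCont v \<theta>"
    and est[measurable]: "\<And>n. est n \<in> borel_measurable (PiM {..<n} (\<lambda>_. \<nu>))"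
    and dir: "\<And>n x. x \<in> space (PiM {..<n} (\<lambda>_. \<nu>)) \<Longrightarrow> (est n x - \<theta>) \<bullet> cov \<theta> (v \<theta>) = 0"
    and tight: "bounded_in_prob (\<lambda>n. Pn n \<theta>) (\<lambda>n x. sqrt (real n) * norm (est n x - \<theta>))"
    and e: "e > 0"
  shows "(\<lambda>n. measure (Pn n \<theta>) {x \<in> space (Pn n \<theta>).
      \<bar>v (est n x) \<bullet> S n (est n x) x - v \<theta> \<bullet> S n \<theta> x\<bar> > e}) \<longlonglongrightarrow> 0"
proof (rule tendstoI)
  fix \<epsilon> :: real assume \<epsilon>: "\<epsilon> > 0"
  obtain C1 where C1: "C1 > 0" "\<forall>\<^sub>F n in sequentially. measure (Pn n \<theta>) {x \<in> space (Pn n \<theta>). norm (S n \<theta> x) > C1} \<le> \<epsilon> / 3"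
    using score_tight[OF \<theta>, of "\<epsilon> / 3"] \<epsilon> by auto
  obtain C2 where C2: "\<forall>\<^sub>F n in sequentially. measure (Pn n \<theta>) {x \<in> space (Pn n \<theta>). \<bar>sqrt (real n) * norm (est n x - \<theta>)\<bar> > C2} \<le> \<epsilon> / 3"
    using tight[unfolded bounded_in_prob_def, rule_format, of "\<epsilon> / 3"] \<epsilon> by auto
  define C where "C = max C1 C2"
  have C: "C > 0" "C1 \<le> C" "C2 \<le> C" using C1 by (auto simp: C_def)
  have lin: "linear (cov \<theta>)" by (rule linear_cov[OF \<theta>])
  obtain B where B: "B > 0" "\<And>u. norm (cov \<theta> u) \<le> B * norm u"
    using linear_bounded_pos[OF lin] by blast
  have abs3: "\<bar>a - r * b - r * c\<bar> \<le> \<bar>a\<bar> + r * \<bar>b\<bar> + r * \<bar>c\<bar>" if "0 \<le> r" for a b c r :: real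
  proof -
    have "\<bar>r * b\<bar> = r * \<bar>b\<bar>" "\<bar>r * c\<bar> = r * \<bar>c\<bar>" using that by (simp_all add: abs_mult)
    then show ?thesis by linarith
  qed
  \<comment> \<open>The coefficients of \<open>\<kappa>\<close> in the bounds for the three error
    terms add up to D, so \<open>\<kappa>\<close> below is taken at most e / D.\<close>
  define D where "D = C + (norm (v \<theta>) + 1) * C + B * C"
  have D: "D > 0" using C B by (auto simp: D_def intro!: add_pos_pos mult_pos_pos add_nonneg_pos)
  define \<kappa> where "\<kappa> = min 1 (e / D)"
  have \<kappa>: "\<kappa> > 0" "\<kappa> \<le> 1" "\<kappa> * D \<le> e" using D e by (auto simp: \<kappa>_def field_simps min_def)
  obtain d1 where d1: "d1 > 0" "\<And>y. norm (y - \<theta>) < d1 \<Longrightarrow> norm (v y - v \<theta>) < \<kappa>"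
    using v \<kappa>(1) unfolding continuous_at_eps_delta dist_norm by blast
  obtain d2 where d2: "d2 > 0" "\<And>y. norm (y - \<theta>) < d2 \<Longrightarrow>
      norm (mean y - mean \<theta> - cov \<theta> (y - \<theta>)) \<le> \<kappa> * norm (y - \<theta>)"
    using mean_has_derivative[OF \<theta>] \<kappa>(1) unfolding has_derivative_at_alt by blast
  have "\<forall>\<^sub>F n in sequentially. C * inverse (sqrt (real n)) < min d1 d2"
  proof -
    have "(\<lambda>n. C * inverse (sqrt (real n))) \<longlonglongrightarrow> C * 0"
      by (intro tendsto_intros tendsto_inverse_0_at_top filterlim_compose[OF sqrt_at_top] filterlim_real_sequentially)
    then show ?thesis by (rule order_tendstoD(2)) (use d1 d2 in auto)
  qed
  with C1(2) C2 eventually_ge_at_top[of 1]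
  show "\<forall>\<^sub>F n in sequentially. dist (measure (Pn n \<theta>) {x \<in> space (Pn n \<theta>).
      \<bar>v (est n x) \<bullet> S n (est n x) x - v \<theta> \<bullet> S n \<theta> x\<bar> > e}) 0 < \<epsilon>"
  proof eventually_elim
    case (elim n)
    interpret prob_space "Pn n \<theta>" by (rule prob_space_Pn[OF \<theta>])
    let ?A1 = "{x \<in> space (Pn n \<theta>). norm (S n \<theta> x) > C1}"
    let ?A2 = "{x \<in> space (Pn n \<theta>). \<bar>sqrt (real n) * norm (est n x - \<theta>)\<bar> > C2}"
    have sn: "sqrt (real n) > 0" using elim by simp
    have "\<bar>v (est n x) \<bullet> S n (est n x) x - v \<theta> \<bullet> S n \<theta> x\<bar> \<le> e"
      if x: "x \<in> space (Pn n \<theta>)" "norm (S n \<theta> x) \<le> C1" "\<bar>sqrt (real n) * norm (est n x - \<theta>)\<bar> \<le> C2" for x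
    proof -
      define \<eta> where "\<eta> = est n x - \<theta>"
      let ?r = "sqrt (real n)"
      let ?v' = "v (est n x)"
      let ?R = "mean (est n x) - mean \<theta> - cov \<theta> \<eta>"
      have S: "norm (S n \<theta> x) \<le> C" using x(2) C by simp
      have \<eta>: "?r * norm \<eta> \<le> C" using x(3) C by (simp add: \<eta>_def)
      then have "norm \<eta> \<le> C * inverse ?r" using sn by (simp add: field_simps)
      then have small: "norm (est n x - \<theta>) < d1" "norm (est n x - \<theta>) < d2" using elim by (auto simp: \<eta>_def)
      have v': "norm (?v' - v \<theta>) \<le> \<kappa>" using d1(2)[OF small(1)] by simp
      have nv': "norm ?v' \<le> norm (v \<theta>) + 1"
        using v' \<kappa> norm_triangle_ineq[of "?v' - v \<theta>" "v \<theta>"] by simp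
      have R: "norm ?R \<le> \<kappa> * norm \<eta>" using d2(2)[OF small(2)] by (simp add: \<eta>_def)
      have zero: "v \<theta> \<bullet> cov \<theta> \<eta> = 0"
        using dir[of x n] x(1) cov_commute[OF \<theta>, of "v \<theta>" \<eta>] by (simp add: \<eta>_def space_Pn)
      \<comment> \<open>Only the first term involves the score; the others split the deterministic
        shift sqrt n times the increment of \<open>mean\<close>, and the last one is zero.\<close>
      have "?v' \<bullet> S n (est n x) x - v \<theta> \<bullet> S n \<theta> x
          = (?v' - v \<theta>) \<bullet> S n \<theta> x - ?r * (?v' \<bullet> ?R) - ?r * ((?v' - v \<theta>) \<bullet> cov \<theta> \<eta>) - ?r * (v \<theta> \<bullet> cov \<theta> \<eta>)"
        by (subst S_shift[of n "est n x" x \<theta>]) (simp add: inner_diff_left inner_diff_right algebra_simps)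
      then have "\<bar>?v' \<bullet> S n (est n x) x - v \<theta> \<bullet> S n \<theta> x\<bar>
          \<le> \<bar>(?v' - v \<theta>) \<bullet> S n \<theta> x\<bar> + ?r * \<bar>?v' \<bullet> ?R\<bar> + ?r * \<bar>(?v' - v \<theta>) \<bullet> cov \<theta> \<eta>\<bar>"
        unfolding zero using abs3[of ?r] by simp
      also have "\<dots> \<le> \<kappa> * C + (norm (v \<theta>) + 1) * (\<kappa> * C) + \<kappa> * (B * C)"
      proof (intro add_mono)
        have "\<bar>(?v' - v \<theta>) \<bullet> S n \<theta> x\<bar> \<le> norm (?v' - v \<theta>) * norm (S n \<theta> x)" by (rule Cauchy_Schwarz_ineq2)
        also have "\<dots> \<le> \<kappa> * C" using v' S \<kappa> by (intro mult_mono) auto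
        finally show "\<bar>(?v' - v \<theta>) \<bullet> S n \<theta> x\<bar> \<le> \<kappa> * C" .
        have "?r * \<bar>?v' \<bullet> ?R\<bar> \<le> ?r * (norm ?v' * norm ?R)"
          by (intro mult_left_mono Cauchy_Schwarz_ineq2) auto
        also have "\<dots> \<le> ?r * ((norm (v \<theta>) + 1) * (\<kappa> * norm \<eta>))"
          using nv' R by (intro mult_left_mono mult_mono) auto
        also have "\<dots> = (norm (v \<theta>) + 1) * (\<kappa> * (?r * norm \<eta>))" by simp
        also have "\<dots> \<le> (norm (v \<theta>) + 1) * (\<kappa> * C)"
          using \<eta> \<kappa> by (intro mult_left_mono) auto
        finally show "?r * \<bar>?v' \<bullet> ?R\<bar> \<le> (norm (v \<theta>) + 1) * (\<kappa> * C)" .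
        have "?r * \<bar>(?v' - v \<theta>) \<bullet> cov \<theta> \<eta>\<bar> \<le> ?r * (norm (?v' - v \<theta>) * norm (cov \<theta> \<eta>))"
          by (intro mult_left_mono Cauchy_Schwarz_ineq2) auto
        also have "\<dots> \<le> ?r * (\<kappa> * (B * norm \<eta>))"
          using v' B \<kappa> by (intro mult_left_mono mult_mono) auto
        also have "\<dots> = \<kappa> * (B * (?r * norm \<eta>))" by simp
        also have "\<dots> \<le> \<kappa> * (B * C)"
          using \<eta> \<kappa> B by (intro mult_left_mono) auto
        finally show "?r * \<bar>(?v' - v \<theta>) \<bullet> cov \<theta> \<eta>\<bar> \<le> \<kappa> * (B * C)" .
      qed
      also have "\<dots> = \<kappa> * D" by (simp add: D_def algebra_simps)
      also have "\<dots> \<le> e" by (rule \<kappa>)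
      finally show ?thesis .
    qed
    then have "{x \<in> space (Pn n \<theta>). \<bar>v (est n x) \<bullet> S n (est n x) x - v \<theta> \<bullet> S n \<theta> x\<bar> > e} \<subseteq> ?A1 \<union> ?A2"
      by force
    moreover have [measurable]: "?A1 \<in> events" "?A2 \<in> events" by measurable
    ultimately have "measure (Pn n \<theta>) {x \<in> space (Pn n \<theta>). \<bar>v (est n x) \<bullet> S n (est n x) x - v \<theta> \<bullet> S n \<theta> x\<bar> > e}
        \<le> measure (Pn n \<theta>) (?A1 \<union> ?A2)" by (intro finite_measure_mono) auto
    also have "\<dots> \<le> measure (Pn n \<theta>) ?A1 + measure (Pn n \<theta>) ?A2"
      by (rule measure_Un_le) measurable
    also have "\<dots> \<le> \<epsilon> / 3 + \<epsilon> / 3" using elim by (intro add_mono)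
    also have "\<dots> < \<epsilon>" using \<epsilon> by simp
    finally show ?case by simp
  qed
qed

text \<open>Contiguity transfers the negligible plug-in error to the alternatives, where the limit
  of the score at the fixed \<open>\<theta>\<close> is known. Measurability of the statistic is a
  separate assumption because \<open>v\<close> is only continuous at one point. With a constant
  estimator the lemma also covers the score itself.\<close>

lemma plugin_score_normal:
  assumes \<theta>: "\<theta> \<in> \<Theta>" and v: "isCont v \<theta>"
    and est[measurable]: "\<And>n. est n \<in> borel_measurable (PiM {..<n} (\<lambda>_. \<nu>))"
    and Q[measurable]: "\<And>n. (\<lambda>x. v (est n x) \<bullet> S n (est n x) x) \<in> borel_measurable (PiM {..<n} (\<lambda>_. \<nu>))"
    and dir: "\<And>n x. x \<in> space (PiM {..<n} (\<lambda>_. \<nu>)) \<Longrightarrow> (est n x - \<theta>) \<bullet> cov \<theta> (v \<theta>) = 0"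
    and tight: "bounded_in_prob (\<lambda>n. Pn n \<theta>) (\<lambda>n x. sqrt (real n) * norm (est n x - \<theta>))"
    and unit: "v \<theta> \<bullet> cov \<theta> (v \<theta>) = 1"
    and t: "\<And>n. t n \<in> \<Theta>" and lim: "(\<lambda>n. sqrt (real n) *\<^sub>R (t n - \<theta>)) \<longlonglongrightarrow> h"
  shows "weak_conv_m (\<lambda>n. distr (Pn n (t n)) borel (\<lambda>x. v (est n x) \<bullet> S n (est n x) x))
    (normal_law (v \<theta> \<bullet> cov \<theta> h))"
proof (rule levy_continuity)
  show "real_distribution (distr (Pn n (t n)) borel (\<lambda>x. v (est n x) \<bullet> S n (est n x) x))" for n
  proof -
    interpret prob_space "Pn n (t n)" by (rule prob_space_Pn[OF t])
    show ?thesis by (rule real_distribution_distr) measurable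
  qed
  show "real_distribution (normal_law (v \<theta> \<bullet> cov \<theta> h))" by (rule real_distribution_normal_law)
  fix s
  let ?Q = "\<lambda>n x. v (est n x) \<bullet> S n (est n x) x"
  have lin: "cov \<theta> (s *\<^sub>R v \<theta>) = s *\<^sub>R cov \<theta> (v \<theta>)" by (rule linear_cmul[OF linear_cov[OF \<theta>]])
  have "(\<lambda>n. \<integral>x. iexp (s * ?Q n x) \<partial>Pn n (t n))
     \<longlonglongrightarrow> iexp ((s *\<^sub>R v \<theta>) \<bullet> cov \<theta> h) * complex_of_real (exp (- ((s *\<^sub>R v \<theta>) \<bullet> cov \<theta> (s *\<^sub>R v \<theta>)) / 2))"
  proof (rule slutsky_char[where X="\<lambda>n x. v \<theta> \<bullet> S n \<theta> x"])
    show "prob_space (Pn n (t n))" for n by (rule prob_space_Pn[OF t])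
    show "(\<lambda>n. \<integral>x. iexp (s * (v \<theta> \<bullet> S n \<theta> x)) \<partial>Pn n (t n))
     \<longlonglongrightarrow> iexp ((s *\<^sub>R v \<theta>) \<bullet> cov \<theta> h) * complex_of_real (exp (- ((s *\<^sub>R v \<theta>) \<bullet> cov \<theta> (s *\<^sub>R v \<theta>)) / 2))"
      using score_clt[OF \<theta> t lim, of "s *\<^sub>R v \<theta>"] by simp
    fix e :: real assume e: "e > 0"
    show "(\<lambda>n. measure (Pn n (t n)) {x \<in> space (Pn n (t n)). e < \<bar>?Q n x - v \<theta> \<bullet> S n \<theta> x\<bar>}) \<longlonglongrightarrow> 0"
    proof (rule contiguity[OF \<theta> t lim])
      show "{x \<in> space (Pn n (t n)). e < \<bar>?Q n x - v \<theta> \<bullet> S n \<theta> x\<bar>} \<in> sets (PiM {..<n} (\<lambda>_. \<nu>))" for n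
        unfolding space_Pn by measurable
      show "(\<lambda>n. measure (Pn n \<theta>) {x \<in> space (Pn n (t n)). e < \<bar>?Q n x - v \<theta> \<bullet> S n \<theta> x\<bar>}) \<longlonglongrightarrow> 0"
        using plugin_null[OF \<theta> v est dir tight e] by (simp add: space_Pn)
    qed
  qed measurable
  moreover have "char (distr (Pn n (t n)) borel (?Q n)) s = (\<integral>x. iexp (s * ?Q n x) \<partial>Pn n (t n))" for n
    unfolding char_def by (subst integral_distr) auto
  ultimately show "(\<lambda>n. char (distr (Pn n (t n)) borel (?Q n)) s) \<longlonglongrightarrow> char (normal_law (v \<theta> \<bullet> cov \<theta> h)) s"
    unfolding char_normal by (simp add: lin unit power2_eq_square)
qed

section \<open>A two-sided Neyman-Pearson inequality\<close>

text \<open>With both log-likelihood constants replaced by their limit q, the sum of the ratios at w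
  and - w is exp (- q) times 2 cosh (w . S), increasing in |w . S|. So \<open>\<phi>\<close> is a
  threshold test for it, and pointwise comparison bounds the power of every competitor by the
  difference in level and a vanishing error.\<close>

lemma neyman_pearson_two_sided:
  assumes \<theta>: "\<theta> \<in> \<Theta>" and t: "\<And>n. t n \<in> \<Theta>" "\<And>n. t' n \<in> \<Theta>"
    and tw: "\<forall>\<^sub>F n in sequentially. sqrt (real n) *\<^sub>R (t n - \<theta>) = w"
    and tw': "\<forall>\<^sub>F n in sequentially. sqrt (real n) *\<^sub>R (t' n - \<theta>) = - w"
    and \<psi>[measurable]: "\<And>n. \<psi> n \<in> borel_measurable (PiM {..<n} (\<lambda>_. \<nu>))"
    and \<psi>01: "\<And>n x. x \<in> space (PiM {..<n} (\<lambda>_. \<nu>)) \<Longrightarrow> 0 \<le> \<psi> n x \<and> \<psi> n x \<le> 1"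
    and z: "z \<ge> 0"
  defines "\<phi> \<equiv> \<lambda>n x. indicator {x. \<bar>w \<bullet> S n \<theta> x\<bar> > z} x :: real"
    and "E \<equiv> \<lambda>n \<theta> f. integral\<^sup>L (Pn n \<theta>) f"
  shows "\<exists>r k. r \<longlonglongrightarrow> 0 \<and> k \<ge> 0 \<and> (\<forall>\<^sub>F n in sequentially.
     E n (t n) (\<psi> n) + E n (t' n) (\<psi> n) \<le> E n (t n) (\<phi> n) + E n (t' n) (\<phi> n) + k * (E n \<theta> (\<psi> n) - E n \<theta> (\<phi> n)) + r n)"
proof -
  define q where "q = w \<bullet> cov \<theta> w / 2"
  define c where "c n = real n * bregman \<theta> (t n)" for n
  define c' where "c' n = real n * bregman \<theta> (t' n)" for n
  \<comment> \<open>The cost of replacing \<open>c n\<close> and \<open>c' n\<close> by q: the tests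
    differ by at most 1 and a likelihood ratio integrates to 1.\<close>
  define r where "r n = \<bar>1 - exp (c n - q)\<bar> + \<bar>1 - exp (c' n - q)\<bar>" for n
  \<comment> \<open>The value of the limiting sum of ratios on the boundary |w . S| = z of the
    rejection region.\<close>
  define k where "k = exp (- q) * (2 * cosh z)"
  have c: "c \<longlonglongrightarrow> q" unfolding c_def q_def by (rule bregman_limit[OF \<theta> tendsto_eventually[OF tw]])
  have c': "c' \<longlonglongrightarrow> q"
    using bregman_limit[OF \<theta> tendsto_eventually[OF tw']] linear_neg[OF linear_cov[OF \<theta>], of w]
    by (simp add: c'_def[abs_def] q_def)
  have "r \<longlonglongrightarrow> \<bar>1 - exp (q - q)\<bar> + \<bar>1 - exp (q - q)\<bar>"
    unfolding r_def by (intro tendsto_intros c c')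
  then have r: "r \<longlonglongrightarrow> 0" by simp
  have k: "k \<ge> 0" by (simp add: k_def)
  have dm: "a * l * d \<le> \<bar>a\<bar> * l" if "\<bar>d\<bar> \<le> 1" "0 < l" for a d l :: real
  proof -
    have "a * l * d \<le> (\<bar>a\<bar> * l) * \<bar>d\<bar>"
      using abs_ge_self[of "a * l * d"] that(2) by (simp add: abs_mult)
    also have "\<dots> \<le> (\<bar>a\<bar> * l) * 1" using that by (intro mult_left_mono) auto
    finally show ?thesis by simp
  qed
  have \<phi>m[measurable]: "\<phi> n \<in> borel_measurable (PiM {..<n} (\<lambda>_. \<nu>))" for n
    unfolding \<phi>_def by measurable
  have "\<forall>\<^sub>F n in sequentially.
     E n (t n) (\<psi> n) + E n (t' n) (\<psi> n) \<le> E n (t n) (\<phi> n) + E n (t' n) (\<phi> n) + k * (E n \<theta> (\<psi> n) - E n \<theta> (\<phi> n)) + r n"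
    using tw tw'
  proof eventually_elim
    case (elim n)
    interpret prob_space "Pn n \<theta>" by (rule prob_space_Pn[OF \<theta>])
    let ?l = "lr n \<theta> (t n)" and ?l' = "lr n \<theta> (t' n)"
    let ?d = "\<lambda>x. \<psi> n x - \<phi> n x"
    have l: "?l x = exp (w \<bullet> S n \<theta> x - c n)" for x
      unfolding lr_def c_def elim(1)[symmetric] by simp
    have l': "?l' x = exp (- (w \<bullet> S n \<theta> x) - c' n)" for x
      using arg_cong[OF elim(2), of "\<lambda>y. y \<bullet> S n \<theta> x"] unfolding lr_def c'_def by simp
    have d1: "\<bar>?d x\<bar> \<le> 1" if "x \<in> space (Pn n \<theta>)" for x
      using \<psi>01[of x n] that by (auto simp: \<phi>_def indicator_def space_Pn)
    have bnd: "(?l x + ?l' x) * ?d x \<le> k * ?d x + (\<bar>1 - exp (c n - q)\<bar> * ?l x + \<bar>1 - exp (c' n - q)\<bar> * ?l' x)"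
      if x: "x \<in> space (Pn n \<theta>)" for x
    proof -
      let ?y = "w \<bullet> S n \<theta> x"
      have a: "(1 - exp (c n - q)) * ?l x = ?l x - exp (?y - q)"
        unfolding l by (simp add: left_diff_distrib exp_add[symmetric])
      have a': "(1 - exp (c' n - q)) * ?l' x = ?l' x - exp (- ?y - q)"
        unfolding l' by (simp add: left_diff_distrib exp_add[symmetric])
      \<comment> \<open>The two factors have opposite signs: where the sum of ratios exceeds k,
        \<open>\<phi>\<close> is 1 and cannot be exceeded; elsewhere it is 0.\<close>
      have "(exp (?y - q) + exp (- ?y - q) - k) * ?d x \<le> 0"
      proof -
        have eq: "exp (?y - q) + exp (- ?y - q) = exp (- q) * (2 * cosh \<bar>?y\<bar>)"
          by (simp add: cosh_def exp_diff exp_minus field_simps abs_real_def)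
        show ?thesis
        proof (cases "\<bar>?y\<bar> > z")
          case True
          then have "cosh z \<le> cosh \<bar>?y\<bar>" using z by (intro cosh_real_nonneg_le_iff[THEN iffD2]) auto
          moreover have "?d x \<le> 0" using True \<psi>01[of x n] x by (simp add: \<phi>_def space_Pn)
          ultimately show ?thesis
            unfolding eq k_def right_diff_distrib[symmetric]
            by (intro mult_nonneg_nonpos mult_nonneg_nonneg) (simp_all only: diff_ge_0_iff_ge zero_le_numeral exp_ge_zero)
        next
          case False
          then have "cosh \<bar>?y\<bar> \<le> cosh z" using z by (intro cosh_real_nonneg_le_iff[THEN iffD2]) auto
          moreover have "?d x \<ge> 0" using False \<psi>01[of x n] x by (simp add: \<phi>_def space_Pn)
          ultimately show ?thesis
            unfolding eq k_def right_diff_distrib[symmetric]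
            by (intro mult_nonpos_nonneg mult_nonneg_nonpos) (simp_all only: diff_le_0_iff_le zero_le_numeral exp_ge_zero)
        qed
      qed
      moreover have "(1 - exp (c n - q)) * ?l x * ?d x \<le> \<bar>1 - exp (c n - q)\<bar> * ?l x"
        by (rule dm[OF d1[OF x] lr_pos])
      moreover have "(1 - exp (c' n - q)) * ?l' x * ?d x \<le> \<bar>1 - exp (c' n - q)\<bar> * ?l' x"
        by (rule dm[OF d1[OF x] lr_pos])
      ultimately show ?thesis unfolding a a' by (simp add: algebra_simps)
    qed
    have il: "integrable (Pn n \<theta>) ?l" "integrable (Pn n \<theta>) ?l'"
      using lr_integrable[OF \<theta>] t by auto
    have bint: "integrable (Pn n \<theta>) (\<lambda>x. g x * f x)"
      if "integrable (Pn n \<theta>) g" "f \<in> borel_measurable (Pn n \<theta>)" "\<And>x. x \<in> space (Pn n \<theta>) \<Longrightarrow> \<bar>f x\<bar> \<le> 1" for f g :: "(nat \<Rightarrow> 'a) \<Rightarrow> real"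
      using that(1)
      by (rule Bochner_Integration.integrable_bound)
         (use that in \<open>auto simp: abs_mult intro!: mult_left_le\<close>)
    have \<psi>1: "\<bar>\<psi> n x\<bar> \<le> 1" "\<bar>\<phi> n x\<bar> \<le> 1" if "x \<in> space (Pn n \<theta>)" for x
      using \<psi>01[of x n] that by (auto simp: \<phi>_def indicator_def space_Pn)
    have mP[measurable]: "\<psi> n \<in> borel_measurable (Pn n \<theta>)" "\<phi> n \<in> borel_measurable (Pn n \<theta>)" by measurable
    have ip: "integrable (Pn n \<theta>) (\<psi> n)" "integrable (Pn n \<theta>) (\<phi> n)"
      using \<psi>1 by (auto intro!: integrable_const_bound[where B=1])
    note ii = bint[OF il(1) mP(1) \<psi>1(1)] bint[OF il(2) mP(1) \<psi>1(1)] bint[OF il(1) mP(2) \<psi>1(2)] bint[OF il(2) mP(2) \<psi>1(2)]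
    have "E n (t n) (\<psi> n) + E n (t' n) (\<psi> n) - (E n (t n) (\<phi> n) + E n (t' n) (\<phi> n))
        = (\<integral>x. ?l x * \<psi> n x \<partial>Pn n \<theta>) + (\<integral>x. ?l' x * \<psi> n x \<partial>Pn n \<theta>)
         - ((\<integral>x. ?l x * \<phi> n x \<partial>Pn n \<theta>) + (\<integral>x. ?l' x * \<phi> n x \<partial>Pn n \<theta>))"
      unfolding E_def by (simp add: integral_Pn[OF \<theta> t(1) \<psi>] integral_Pn[OF \<theta> t(2) \<psi>] integral_Pn[OF \<theta> t(1) \<phi>m] integral_Pn[OF \<theta> t(2) \<phi>m])
    also have "\<dots> = (\<integral>x. ?l x * \<psi> n x + ?l' x * \<psi> n x - (?l x * \<phi> n x + ?l' x * \<phi> n x) \<partial>Pn n \<theta>)"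
      using ii by simp
    also have "\<dots> \<le> (\<integral>x. k * (\<psi> n x - \<phi> n x) + (\<bar>1 - exp (c n - q)\<bar> * ?l x + \<bar>1 - exp (c' n - q)\<bar> * ?l' x) \<partial>Pn n \<theta>)"
    proof (rule integral_mono)
      show "integrable (Pn n \<theta>) (\<lambda>x. ?l x * \<psi> n x + ?l' x * \<psi> n x - (?l x * \<phi> n x + ?l' x * \<phi> n x))"
        using ii by simp
      show "integrable (Pn n \<theta>) (\<lambda>x. k * (\<psi> n x - \<phi> n x) + (\<bar>1 - exp (c n - q)\<bar> * ?l x + \<bar>1 - exp (c' n - q)\<bar> * ?l' x))"
        using ip il by simp
      fix x assume "x \<in> space (Pn n \<theta>)"
      from bnd[OF this] show "?l x * \<psi> n x + ?l' x * \<psi> n x - (?l x * \<phi> n x + ?l' x * \<phi> n x)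
          \<le> k * (\<psi> n x - \<phi> n x) + (\<bar>1 - exp (c n - q)\<bar> * ?l x + \<bar>1 - exp (c' n - q)\<bar> * ?l' x)"
        by (simp add: algebra_simps)
    qed
    also have "\<dots> = k * (E n \<theta> (\<psi> n) - E n \<theta> (\<phi> n)) + r n"
      using ip il t by (simp add: E_def r_def integral_lr[OF \<theta>])
    finally show ?case by linarith
  qed
  then show ?thesis using r k by blast
qed

end

section \<open>The generalized inverse Gaussian family\<close>

lemma vector_3_eq: "(vector [x, y, z] :: real ^ 3) = x *\<^sub>R axis 1 1 + y *\<^sub>R axis 2 1 + z *\<^sub>R axis 3 1"
  by (simp add: vec_eq_iff forall_3 axis_def)

lemma inner_vec_3: "(u :: real ^ 3) \<bullet> w = u $ 1 * w $ 1 + u $ 2 * w $ 2 + u $ 3 * w $ 3"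
  by (simp add: inner_vec_def sum_3)

lemma borel_measurable_vector_3 [measurable (raw)]:
  fixes f g h :: "'a \<Rightarrow> real"
  assumes [measurable]: "f \<in> borel_measurable M" "g \<in> borel_measurable M" "h \<in> borel_measurable M"
  shows "(\<lambda>x. vector [f x, g x, h x] :: real ^ 3) \<in> borel_measurable M"
  unfolding vector_3_eq by measurable

text \<open>The weight 1 / x absorbs the -1 in the exponent p - 1, so that the natural parameter is
  (p, a, b) itself.\<close>

definition gig_base :: "real measure" where
  "gig_base = density (restrict_space lborel {0<..}) (\<lambda>x. ennreal (1 / x))"

definition gig_stat :: "real \<Rightarrow> real ^ 3" where
  "gig_stat x = vector [ln x, - x / 2, - 1 / (2 * x)]"

definition gig_params :: "(real ^ 3) set" where
  "gig_params = {\<theta>. \<theta> $ 2 > 0 \<and> \<theta> $ 3 > 0}"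

lemma vector_in_gig_params [simp]: "vector [p, a, b] \<in> gig_params \<longleftrightarrow> a > 0 \<and> b > 0"
  by (simp add: gig_params_def)

lemma sets_gig_base: "sets gig_base = sets (restrict_space borel {0<..})"
  unfolding gig_base_def by (simp add: sets_restrict_space)

lemma space_gig_base [simp]: "space gig_base = {0<..}"
  unfolding gig_base_def by (simp add: space_restrict_space)

lemma gig_stat_measurable: "gig_stat \<in> borel_measurable gig_base"
proof -
  have [measurable]: "gig_stat \<in> borel_measurable borel"
    unfolding gig_stat_def[abs_def] by measurable
  show ?thesis unfolding measurable_cong_sets[OF sets_gig_base refl]
    by (rule measurable_restrict_space1) measurable
qed

lemma inner_gig_stat: "x > 0 \<Longrightarrow> exp (\<theta> \<bullet> gig_stat x) = x powr (\<theta> $ 1) * exp (- (\<theta> $ 2 * x + \<theta> $ 3 / x) / 2)"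
  by (simp add: inner_vec_3 gig_stat_def powr_def exp_add[symmetric] field_simps)

lemma exp_mult_half: "exp u * exp (- w / 2) = exp (u - w / 2)" for u w :: real
  by (simp flip: exp_add)

text \<open>The power of x is at most a polynomial in x plus one in 1 / x. Part of the decay in x
  absorbs the first and the decay in 1 / x absorbs the second, and exp (- a x / 4) remains as an
  integrable majorant.\<close>

lemma gig_kernel_integrable:
  fixes p a b :: real
  assumes "a > 0" "b > 0"
  shows "integrable lborel (\<lambda>x. indicator {0<..} x *\<^sub>R (x powr (p - 1) * exp (- (a * x + b / x) / 2)))"
proof -
  define m where "m = nat \<lceil>\<bar>p - 1\<bar>\<rceil>"
  have m: "\<bar>p - 1\<bar> \<le> real m" unfolding m_def by linarith
  \<comment> \<open>The constants of \<open>power_one_plus_le_exp\<close> at rate a / 4 for x and b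
    / 2 for 1 / x: the first uses half of the decay a / 2 in x, the second all of the decay in 1 /
    x.\<close>
  define K where "K = fact m / (a / 4) ^ m * exp (a / 4)"
  define K' where "K' = fact m / (b / 2) ^ m * exp (b / 2)"
  have K: "K \<ge> 0" "K' \<ge> 0" using assms by (auto simp: K_def K'_def)
  have int: "integrable lborel (\<lambda>x. indicator {0<..} x *\<^sub>R exp (- (x * (a / 4))))"
    using integrable_I0i_exp_mscale[of "a / 4"] assms by (simp add: set_integrable_def)
  show ?thesis
  proof (rule Bochner_Integration.integrable_bound)
    show "integrable lborel (\<lambda>x. (K + K') * (indicator {0<..} x *\<^sub>R exp (- (x * (a / 4)))))"
      using int by (rule integrable_mult_right)
    show "AE x in lborel. norm (indicator {0<..} x *\<^sub>R (x powr (p - 1) * exp (- (a * x + b / x) / 2)))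
        \<le> norm ((K + K') * (indicator {0<..} x *\<^sub>R exp (- (x * (a / 4)))))"
    proof (rule AE_I2)
      fix x :: real
      show "norm (indicator {0<..} x *\<^sub>R (x powr (p - 1) * exp (- (a * x + b / x) / 2)))
        \<le> norm ((K + K') * (indicator {0<..} x *\<^sub>R exp (- (x * (a / 4)))))"
      proof (cases "x > 0")
        case True
        have "x powr (p - 1) \<le> (1 + x) ^ m + (1 + 1 / x) ^ m"
        proof (cases "x \<ge> 1")
          case ge: True
          have "x powr (p - 1) \<le> x powr (real m)" using ge m by (intro powr_mono) auto
          also have "\<dots> = x ^ m" using True by (simp add: powr_realpow)
          also have "\<dots> \<le> (1 + x) ^ m" using True by (intro power_mono) auto
          finally show ?thesis using True by (simp add: add_increasing2)
        next
          case False
          have "x powr (p - 1) \<le> x powr (- real m)" using False True m by (intro powr_mono') auto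
          also have "\<dots> = (1 / x) ^ m" using True by (simp add: powr_minus powr_realpow power_one_over divide_inverse power_inverse)
          also have "\<dots> \<le> (1 + 1 / x) ^ m" using True by (intro power_mono) auto
          finally show ?thesis using True by (simp add: add_increasing)
        qed
        also have "\<dots> \<le> K * exp (a / 4 * x) + K' * exp (b / 2 * (1 / x))"
          unfolding K_def K'_def using True assms by (intro add_mono power_one_plus_le_exp) auto
        finally have "x powr (p - 1) * exp (- (a * x + b / x) / 2)
            \<le> (K * exp (a / 4 * x) + K' * exp (b / 2 * (1 / x))) * exp (- (a * x + b / x) / 2)"
          by (intro mult_right_mono) auto
        also have "\<dots> = K * exp (a / 4 * x - (a * x + b / x) / 2) + K' * exp (b / 2 * (1 / x) - (a * x + b / x) / 2)"
          by (simp only: distrib_right mult.assoc exp_mult_half)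
        also have "\<dots> \<le> K * exp (- (x * (a / 4))) + K' * exp (- (x * (a / 4)))"
          using True assms K by (intro add_mono mult_left_mono) (auto simp: field_simps)
        finally have "x powr (p - 1) * exp (- (a * x + b / x) / 2) \<le> (K + K') * exp (- (x * (a / 4)))"
          by (simp add: distrib_right)
        then show ?thesis using True K by simp
      qed simp
    qed
  qed measurable
qed

lemma gig_base_integrable_iff:
  fixes f :: "real \<Rightarrow> real"
  assumes "f \<in> borel_measurable gig_base"
  shows "integrable gig_base f \<longleftrightarrow> integrable lborel (\<lambda>x. indicator {0<..} x *\<^sub>R (1 / x * f x))"
proof -
  have "f \<in> borel_measurable (restrict_space lborel {0<..})"
    using assms unfolding gig_base_def by simp
  then show ?thesis unfolding gig_base_def
    by (subst integrable_density)
       (auto simp: integrable_restrict_space intro!: AE_I2 simp: space_restrict_space measurable_restrict_space1)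
qed

lemma gig_base_integral:
  fixes f :: "real \<Rightarrow> real"
  assumes "f \<in> borel_measurable gig_base"
  shows "integral\<^sup>L gig_base f = (\<integral>x. indicator {0<..} x *\<^sub>R (1 / x * f x) \<partial>lborel)"
proof -
  have "f \<in> borel_measurable (restrict_space lborel {0<..})"
    using assms unfolding gig_base_def by simp
  then show ?thesis unfolding gig_base_def
    by (subst integral_density)
       (auto simp: integral_restrict_space intro!: AE_I2 simp: space_restrict_space measurable_restrict_space1)
qed

lemma gig_base_kernel:
  "indicator {0<..} x *\<^sub>R (1 / x * exp (\<theta> \<bullet> gig_stat x))
    = indicator {0<..} x *\<^sub>R (x powr (\<theta> $ 1 - 1) * exp (- (\<theta> $ 2 * x + \<theta> $ 3 / x) / 2))"
  by (cases "x > 0") (simp_all add: inner_gig_stat powr_diff)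

interpretation GIG: exponential_family gig_base gig_stat gig_params
proof
  show T[measurable]: "gig_stat \<in> borel_measurable gig_base" by (rule gig_stat_measurable)
  show "open gig_params" unfolding gig_params_def
    by (intro open_Collect_conj open_Collect_less continuous_intros)
  show "integrable gig_base (\<lambda>x. exp (\<theta> \<bullet> gig_stat x))" if "\<theta> \<in> gig_params" for \<theta>
    using gig_kernel_integrable[of "\<theta> $ 2" "\<theta> $ 3" "\<theta> $ 1"] that
    by (subst gig_base_integrable_iff) (simp_all only: gig_base_kernel gig_params_def mem_Collect_eq, measurable)
  have "emeasure gig_base (space gig_base) \<noteq> 0"
  proof
    assume "emeasure gig_base (space gig_base) = 0"
    then have "AE x in gig_base. False" by (intro AE_I[OF _ _ sets.top]) auto
    then have "AE x in restrict_space lborel {0<..}. \<not> 0 < ennreal (1 / x)"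
      unfolding gig_base_def by (subst (asm) AE_density) (auto simp: measurable_restrict_space1)
    then have "AE x in lborel. x \<in> {0<..} \<longrightarrow> \<not> 0 < ennreal (1 / x)"
      by (subst (asm) AE_restrict_space_iff) auto
    then have "AE x in lborel. x \<notin> {0<..<1::real}" by (rule eventually_mono) auto
    then have "emeasure lborel {0<..<1::real} = 0" by (subst (asm) AE_iff_measurable[of "{0<..<1}"]) auto
    then show False by simp
  qed
  then show "emeasure gig_base (space gig_base) \<noteq> 0" .
qed

lemma gig_Z:
  assumes "a > 0" "b > 0"
  shows "GIG.Z (vector [p, a, b]) = 2 * besselK p (sqrt (a * b)) * (b / a) powr (p / 2)"
proof -
  \<comment> \<open>The substitution x = s t balances the two terms of the exponent: a * s and b / s
    both equal sqrt (a * b), which gives the Bessel integrand.\<close>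
  define s where "s = sqrt (b / a)"
  have s: "s > 0" using assms by (simp add: s_def)
  have as: "a * s = sqrt (a * b)"
    using assms by (simp add: s_def real_sqrt_divide real_sqrt_mult field_simps)
  have bs: "b / s = sqrt (a * b)"
    using assms by (simp add: s_def real_sqrt_divide real_sqrt_mult field_simps)
  let ?f = "\<lambda>x. indicator {0<..} x *\<^sub>R (x powr (p - 1) * exp (- (a * x + b / x) / 2))"
  have "GIG.Z (vector [p, a, b]) = (\<integral>x. exp (vector [p, a, b] \<bullet> gig_stat x) \<partial>gig_base)"
    by (simp add: GIG.Z_def GIG.expint_def)
  also have "\<dots> = (\<integral>x. ?f x \<partial>lborel)"
    by (subst gig_base_integral, use gig_stat_measurable in measurable) (simp only: gig_base_kernel vector_3)
  also have "\<dots> = s * (\<integral>x. ?f (0 + s * x) \<partial>lborel)"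
    using lborel_integral_real_affine[of s ?f 0] s by simp
  also have "(\<lambda>x. ?f (0 + s * x)) = (\<lambda>x. s powr (p - 1) *
      (indicator {0<..} x *\<^sub>R (x powr (p - 1) * exp (- sqrt (a * b) * (x + 1 / x) / 2))))"
  proof
    fix x :: real
    show "?f (0 + s * x) = s powr (p - 1) *
      (indicator {0<..} x *\<^sub>R (x powr (p - 1) * exp (- sqrt (a * b) * (x + 1 / x) / 2)))"
    proof (cases "x > 0")
      case True
      have "a * (s * x) + b / (s * x) = sqrt (a * b) * (x + 1 / x)"
        using True s by (simp add: as[symmetric] distrib_left) (simp add: as bs[symmetric])
      then have "- (a * (s * x) + b / (s * x)) / 2 = - sqrt (a * b) * (x + 1 / x) / 2" by simp
      then show ?thesis using True s by (simp add: powr_mult zero_less_mult_iff)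
    qed (use s in \<open>simp add: zero_less_mult_iff\<close>)
  qed
  also have "s * (\<integral>x. s powr (p - 1) *
      (indicator {0<..} x *\<^sub>R (x powr (p - 1) * exp (- sqrt (a * b) * (x + 1 / x) / 2))) \<partial>lborel)
      = s * s powr (p - 1) * (2 * besselK p (sqrt (a * b)))"
    by (simp add: besselK_def set_lebesgue_integral_def)
  also have "s * s powr (p - 1) = s powr p" using s by (simp add: powr_mult_base)
  also have "\<dots> = (b / a) powr (p / 2)"
    unfolding s_def using assms by (simp add: powr_half_sqrt[symmetric] powr_powr)
  finally show ?thesis by simp
qed

lemma besselK_pos: "a > 0 \<Longrightarrow> b > 0 \<Longrightarrow> besselK p (sqrt (a * b)) > 0"
  using GIG.Z_pos[of "vector [p, a, b]"] by (simp add: gig_Z zero_less_mult_iff)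

lemma gig_eq_P:
  assumes "a > 0" "b > 0"
  shows "gig p a b = GIG.P (vector [p, a, b])"
proof -
  have [measurable]: "gig_stat \<in> borel_measurable (restrict_space lborel {0<..})"
    using gig_stat_measurable unfolding gig_base_def by simp
  have [measurable]: "(\<lambda>x. ennreal (1 / x)) \<in> borel_measurable (restrict_space lborel {0<..})"
    by (intro measurable_restrict_space1) measurable
  have base: "density gig_base g = density (restrict_space lborel {0<..}) (\<lambda>x. ennreal (1 / x) * g x)"
    if [measurable]: "g \<in> borel_measurable (restrict_space lborel {0<..})" for g
    unfolding gig_base_def by (rule density_density_eq) measurable
  have "GIG.P (vector [p, a, b]) = density (restrict_space lborel {0<..})
      (\<lambda>x. ennreal (1 / x) * ennreal (exp (vector [p, a, b] \<bullet> gig_stat x - GIG.L (vector [p, a, b]))))"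
    unfolding GIG.P_def by (rule base) measurable
  also have "\<dots> = gig p a b"
    unfolding gig_def
  proof (rule density_cong)
    show "(\<lambda>x. ennreal (1 / x) * ennreal (exp (vector [p, a, b] \<bullet> gig_stat x - GIG.L (vector [p, a, b]))))
        \<in> borel_measurable (restrict_space lborel {0<..})" by measurable
    show "(\<lambda>x. ennreal (gig_density p a b x)) \<in> borel_measurable (restrict_space lborel {0<..})"
      unfolding gig_density_def by (intro measurable_restrict_space1) measurable
    have eq: "1 / x * exp (vector [p, a, b] \<bullet> gig_stat x - GIG.L (vector [p, a, b])) = gig_density p a b x" if "x > 0" for x
    proof -
      have "(b / a) powr (p / 2) = 1 / (a / b) powr (p / 2)"
        using assms by (simp add: powr_divide)
      then show ?thesis
        using that assms besselK_pos[OF assms, of p]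
        by (simp add: exp_diff GIG.exp_L inner_gig_stat gig_Z gig_density_def powr_diff field_simps)
    qed
    show "AE x in restrict_space lborel {0<..}. ennreal (1 / x) *
        ennreal (exp (vector [p, a, b] \<bullet> gig_stat x - GIG.L (vector [p, a, b]))) = ennreal (gig_density p a b x)"
      by (rule AE_I2) (auto simp: space_restrict_space eq[symmetric] ennreal_mult[symmetric])
  qed
  finally show ?thesis by simp
qed

lemma gig_sample_eq_Pn: "a > 0 \<Longrightarrow> b > 0 \<Longrightarrow> gig_sample n p a b = GIG.Pn n (vector [p, a, b])"
  by (simp add: gig_sample_def GIG.Pn_def gig_eq_P)

lemma sets_sample_space: "sets (sample_space n) = sets (PiM {..<n} (\<lambda>_. gig_base))"
  unfolding sample_space_def by (intro sets_PiM_cong) (simp_all add: sets_gig_base)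

lemma space_sample_space: "space (sample_space n) = space (PiM {..<n} (\<lambda>_. gig_base))"
  by (rule sets_eq_imp_space_eq[OF sets_sample_space])

section \<open>Central sequence and information as score and covariance\<close>

text \<open>The non-Bessel terms in the central sequence and in the information are derivatives of
  the elementary part of this identity; adding them turns derivatives of log K into derivatives of
  \<open>L\<close>.\<close>

lemma logK_eq:
  assumes "a > 0" "b > 0"
  shows "logK p a b = GIG.L (vector [p, a, b]) - ln 2 - p / 2 * (ln b - ln a)"
  using besselK_pos[OF assms, of p] assms
  by (simp add: logK_def GIG.L_def gig_Z ln_mult ln_powr ln_div)

lemma has_derivative_vector_3:
  fixes f :: "real ^ 3 \<Rightarrow> 'b::real_normed_vector"
  assumes f: "(f has_derivative f') (at (vector [p, a, b]))"
  shows "((\<lambda>q. f (vector [q, a, b])) has_derivative (\<lambda>s. f' (s *\<^sub>R axis 1 1))) (at p)"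
    and "((\<lambda>q. f (vector [p, q, b])) has_derivative (\<lambda>s. f' (s *\<^sub>R axis 2 1))) (at a)"
    and "((\<lambda>q. f (vector [p, a, q])) has_derivative (\<lambda>s. f' (s *\<^sub>R axis 3 1))) (at b)"
  using f unfolding vector_3_eq
  by (auto intro!: has_derivative_compose[where g=f] derivative_eq_intros)

lemma DERIV_L:
  assumes "a > 0" "b > 0"
  shows "((\<lambda>q. GIG.L (vector [q, a, b])) has_real_derivative GIG.mean (vector [p, a, b]) $ 1) (at p)"
    and "((\<lambda>q. GIG.L (vector [p, q, b])) has_real_derivative GIG.mean (vector [p, a, b]) $ 2) (at a)"
    and "((\<lambda>q. GIG.L (vector [p, a, q])) has_real_derivative GIG.mean (vector [p, a, b]) $ 3) (at b)"
  using has_derivative_vector_3[OF GIG.L_has_derivative[of "vector [p, a, b]"]] assms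
  by (simp_all add: has_field_derivative_def inner_axis' mult_commute_abs)

lemma DERIV_mean:
  assumes "a > 0" "b > 0"
  shows "((\<lambda>q. GIG.mean (vector [q, a, b]) $ i) has_real_derivative GIG.cov (vector [p, a, b]) (axis 1 1) $ i) (at p)"
    and "((\<lambda>q. GIG.mean (vector [p, q, b]) $ i) has_real_derivative GIG.cov (vector [p, a, b]) (axis 2 1) $ i) (at a)"
    and "((\<lambda>q. GIG.mean (vector [p, a, q]) $ i) has_real_derivative GIG.cov (vector [p, a, b]) (axis 3 1) $ i) (at b)"
proof -
  have "((\<lambda>\<theta>. GIG.mean \<theta> $ i) has_derivative (\<lambda>u. GIG.cov (vector [p, a, b]) u $ i)) (at (vector [p, a, b]))"
    using assms by (intro bounded_linear.has_derivative[OF bounded_linear_vec_nth] GIG.mean_has_derivative) simp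
  from has_derivative_vector_3[OF this] linear_cmul[OF GIG.linear_cov[of "vector [p, a, b]"]] assms
  show "((\<lambda>q. GIG.mean (vector [q, a, b]) $ i) has_real_derivative GIG.cov (vector [p, a, b]) (axis 1 1) $ i) (at p)"
    "((\<lambda>q. GIG.mean (vector [p, q, b]) $ i) has_real_derivative GIG.cov (vector [p, a, b]) (axis 2 1) $ i) (at a)"
    "((\<lambda>q. GIG.mean (vector [p, a, q]) $ i) has_real_derivative GIG.cov (vector [p, a, b]) (axis 3 1) $ i) (at b)"
    by (simp_all add: has_field_derivative_def mult_commute_abs)
qed

lemma eventually_pos_nhds: "a > 0 \<Longrightarrow> \<forall>\<^sub>F s in nhds a. s > (0::real)"
  using eventually_nhds_in_open[of "{0<..}" a] by simp

text \<open>The identity with \<open>L\<close> holds for positive a and b only, so in these two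
  variables it is differentiated as an equality on a neighbourhood.\<close>

lemma DERIV_logK:
  assumes "a > 0" "b > 0"
  shows "((\<lambda>q. logK q a b) has_real_derivative GIG.mean (vector [p, a, b]) $ 1 - (ln b - ln a) / 2) (at p)"
    and "((\<lambda>q. logK p q b) has_real_derivative GIG.mean (vector [p, a, b]) $ 2 + p / (2 * a)) (at a)"
    and "((\<lambda>q. logK p a q) has_real_derivative GIG.mean (vector [p, a, b]) $ 3 - p / (2 * b)) (at b)"
proof -
  show "((\<lambda>q. logK q a b) has_real_derivative GIG.mean (vector [p, a, b]) $ 1 - (ln b - ln a) / 2) (at p)"
    unfolding logK_eq[OF assms] by (auto intro!: derivative_eq_intros DERIV_L assms)
  have "((\<lambda>q. GIG.L (vector [p, q, b]) - ln 2 - p / 2 * (ln b - ln q)) has_real_derivative GIG.mean (vector [p, a, b]) $ 2 + p / (2 * a)) (at a)"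
    using assms by (auto intro!: derivative_eq_intros DERIV_L)
  then show "((\<lambda>q. logK p q b) has_real_derivative GIG.mean (vector [p, a, b]) $ 2 + p / (2 * a)) (at a)"
    by (subst DERIV_cong_ev[OF refl _ refl])
       (use assms in \<open>auto intro: eventually_mono[OF eventually_pos_nhds] simp: logK_eq\<close>)
  have "((\<lambda>q. GIG.L (vector [p, a, q]) - ln 2 - p / 2 * (ln q - ln a)) has_real_derivative GIG.mean (vector [p, a, b]) $ 3 - p / (2 * b)) (at b)"
    using assms by (auto intro!: derivative_eq_intros DERIV_L)
  then show "((\<lambda>q. logK p a q) has_real_derivative GIG.mean (vector [p, a, b]) $ 3 - p / (2 * b)) (at b)"
    by (subst DERIV_cong_ev[OF refl _ refl])
       (use assms in \<open>auto intro: eventually_mono[OF eventually_pos_nhds] simp: logK_eq\<close>)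
qed

lemma deriv_logK:
  assumes "a > 0" "b > 0"
  shows "deriv (\<lambda>q. logK q a b) p = GIG.mean (vector [p, a, b]) $ 1 - (ln b - ln a) / 2"
    and "deriv (\<lambda>q. logK p q b) a = GIG.mean (vector [p, a, b]) $ 2 + p / (2 * a)"
    and "deriv (\<lambda>q. logK p a q) b = GIG.mean (vector [p, a, b]) $ 3 - p / (2 * b)"
  using DERIV_logK[OF assms] by (auto intro: DERIV_imp_deriv)

lemma Delta_eq_S:
  assumes "a > 0" "b > 0"
  shows "Delta_p n p a b x = GIG.S n (vector [p, a, b]) x $ 1"
    and "Delta_a n p a b x = GIG.S n (vector [p, a, b]) x $ 2"
    and "Delta_b n p a b x = GIG.S n (vector [p, a, b]) x $ 3"
proof -
  let ?m = "GIG.mean (vector [p, a, b])"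
  have S: "GIG.S n (vector [p, a, b]) x $ k = (\<Sum>i<n. gig_stat (x i) $ k - ?m $ k) / sqrt (real n)" for k
    by (simp add: GIG.S_def sum_component divide_inverse mult.commute)
  show "Delta_p n p a b x = GIG.S n (vector [p, a, b]) x $ 1"
    unfolding S Delta_p_def deriv_logK[OF assms]
    by (intro arg_cong2[where f="(/)"] sum.cong refl) (use assms in \<open>simp add: gig_stat_def ln_div diff_divide_distrib\<close>)
  show "Delta_a n p a b x = GIG.S n (vector [p, a, b]) x $ 2"
    unfolding S Delta_a_def deriv_logK[OF assms]
    by (intro arg_cong2[where f="(/)"] sum.cong refl) (simp add: gig_stat_def)
  show "Delta_b n p a b x = GIG.S n (vector [p, a, b]) x $ 3"
    unfolding S Delta_b_def deriv_logK[OF assms]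
    by (intro arg_cong2[where f="(/)"] sum.cong refl) (simp add: gig_stat_def)
qed

text \<open>The inner derivative is a coordinate of \<open>mean\<close> plus an elementary term. In
  a and b this is known only near the point, so the outer derivative is taken of functions that
  agree eventually.\<close>

lemma Gamma_eq_cov:
  fixes p a b :: real
  assumes "a > 0" "b > 0"
  defines "C \<equiv> GIG.cov (vector [p, a, b])"
  shows "Gamma_pp p a b = C (axis 1 1) $ 1"
    and "Gamma_aa p a b = C (axis 2 1) $ 2"
    and "Gamma_bb p a b = C (axis 3 1) $ 3"
    and "Gamma_pa p a b = C (axis 2 1) $ 1"
    and "Gamma_pb p a b = C (axis 3 1) $ 1"
    and "Gamma_ab p a b = C (axis 2 1) $ 3"
proof -
  note D = DERIV_mean[OF assms(1,2)]
  note ev = eventually_mono[OF eventually_pos_nhds[OF assms(1)]] eventually_mono[OF eventually_pos_nhds[OF assms(2)]]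
  have "((\<lambda>q. GIG.mean (vector [q, a, b]) $ 1 - (ln b - ln a) / 2) has_real_derivative C (axis 1 1) $ 1) (at p)"
    unfolding C_def by (auto intro!: derivative_eq_intros D)
  then show "Gamma_pp p a b = C (axis 1 1) $ 1"
    by (simp add: Gamma_pp_def deriv_logK assms DERIV_imp_deriv)
  have "((\<lambda>s. GIG.mean (vector [p, s, b]) $ 2 + p / (2 * s)) has_real_derivative C (axis 2 1) $ 2 - p / (2 * a\<^sup>2)) (at a)"
    unfolding C_def using assms by (auto intro!: derivative_eq_intros D simp: power2_eq_square)
  moreover have "deriv (\<lambda>s. deriv (\<lambda>t. logK p t b) s) a = deriv (\<lambda>s. GIG.mean (vector [p, s, b]) $ 2 + p / (2 * s)) a"
    by (intro deriv_cong_ev ev refl) (simp add: deriv_logK assms)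
  ultimately show "Gamma_aa p a b = C (axis 2 1) $ 2"
    by (simp add: Gamma_aa_def DERIV_imp_deriv)
  have "((\<lambda>s. GIG.mean (vector [p, a, s]) $ 3 - p / (2 * s)) has_real_derivative C (axis 3 1) $ 3 + p / (2 * b\<^sup>2)) (at b)"
    unfolding C_def using assms by (auto intro!: derivative_eq_intros D simp: power2_eq_square)
  moreover have "deriv (\<lambda>s. deriv (\<lambda>t. logK p a t) s) b = deriv (\<lambda>s. GIG.mean (vector [p, a, s]) $ 3 - p / (2 * s)) b"
    by (intro deriv_cong_ev ev refl) (simp add: deriv_logK assms)
  ultimately show "Gamma_bb p a b = C (axis 3 1) $ 3"
    by (simp add: Gamma_bb_def DERIV_imp_deriv)
  have "((\<lambda>s. GIG.mean (vector [p, s, b]) $ 1 - (ln b - ln s) / 2) has_real_derivative C (axis 2 1) $ 1 + 1 / (2 * a)) (at a)"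
    unfolding C_def using assms by (auto intro!: derivative_eq_intros D)
  moreover have "deriv (\<lambda>s. deriv (\<lambda>q. logK q s b) p) a = deriv (\<lambda>s. GIG.mean (vector [p, s, b]) $ 1 - (ln b - ln s) / 2) a"
    by (intro deriv_cong_ev ev refl) (simp add: deriv_logK assms)
  ultimately show "Gamma_pa p a b = C (axis 2 1) $ 1"
    by (simp add: Gamma_pa_def DERIV_imp_deriv)
  have "((\<lambda>s. GIG.mean (vector [p, a, s]) $ 1 - (ln s - ln a) / 2) has_real_derivative C (axis 3 1) $ 1 - 1 / (2 * b)) (at b)"
    unfolding C_def using assms by (auto intro!: derivative_eq_intros D)
  moreover have "deriv (\<lambda>s. deriv (\<lambda>q. logK q a s) p) b = deriv (\<lambda>s. GIG.mean (vector [p, a, s]) $ 1 - (ln s - ln a) / 2) b"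
    by (intro deriv_cong_ev ev refl) (simp add: deriv_logK assms)
  ultimately show "Gamma_pb p a b = C (axis 3 1) $ 1"
    by (simp add: Gamma_pb_def DERIV_imp_deriv)
  have "((\<lambda>s. GIG.mean (vector [p, s, b]) $ 3 - p / (2 * b)) has_real_derivative C (axis 2 1) $ 3) (at a)"
    unfolding C_def by (auto intro!: derivative_eq_intros D)
  moreover have "deriv (\<lambda>s. deriv (\<lambda>t. logK p s t) b) a = deriv (\<lambda>s. GIG.mean (vector [p, s, b]) $ 3 - p / (2 * b)) a"
    by (intro deriv_cong_ev ev refl) (simp add: deriv_logK assms)
  ultimately show "Gamma_ab p a b = C (axis 2 1) $ 3"
    by (simp add: Gamma_ab_def DERIV_imp_deriv)
qed

section \<open>Positive definiteness of the information\<close>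

text \<open>An exceptional point would, by continuity, bring an interval of exceptional points, and
  intervals are not null.\<close>

lemma AE_lborel_open_continuous:
  fixes g :: "real \<Rightarrow> real"
  assumes ae: "AE x in lborel. x \<in> U \<longrightarrow> g x = c" and U: "open U" and g: "continuous_on U g" and x: "x \<in> U"
  shows "g x = c"
proof (rule ccontr)
  assume ne: "g x \<noteq> c"
  have "open (- {c})" by (intro open_Compl closed_singleton)
  then have "open (g -` (- {c}) \<inter> U)" using g unfolding continuous_on_open_vimage[OF U] by blast
  moreover have "x \<in> g -` (- {c}) \<inter> U" using ne x by simp
  ultimately obtain e where e: "e > 0" "ball x e \<subseteq> g -` (- {c}) \<inter> U"
    using open_contains_ball by blast
  have "AE y in lborel. y \<notin> {x - e<..<x + e}"
    using ae by (rule eventually_mono) (use e(2) in \<open>auto simp: ball_eq_greaterThanLessThan\<close>)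
  then have "emeasure lborel {x - e<..<x + e} = 0" by (subst (asm) AE_iff_measurable[of "{x - e<..<x + e}"]) auto
  then show False using e(1) by simp
qed

text \<open>Sampling at the powers 1, 2, 1/2 and 4 of 2 makes every logarithm a multiple of ln 2.
  The four equations are then linear with rational coefficients in u $ 1 * ln 2, u $ 2, u $ 3 and
  c.\<close>

lemma gig_stat_affinely_independent:
  fixes u :: "real ^ 3"
  assumes "\<And>x. x > 0 \<Longrightarrow> u \<bullet> gig_stat x = c"
  shows "u = 0"
proof -
  have l: "ln (4::real) = 2 * ln 2" "ln (1 / 2 :: real) = - ln 2"
    using ln_powr[of 2 2] by (simp_all add: ln_div)
  have "ln (2::real) > 0" by simp
  define s where "s = u $ 1 * ln 2"
  have 1: "- u $ 2 / 2 - u $ 3 / 2 = c"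
    using assms[of 1] by (simp add: inner_vec_3 gig_stat_def)
  have 2: "s - u $ 2 - u $ 3 / 4 = c"
    using assms[of 2] by (simp add: inner_vec_3 gig_stat_def s_def)
  have 3: "- s - u $ 2 / 4 - u $ 3 = c"
    using assms[of "1 / 2"] by (simp add: inner_vec_3 gig_stat_def s_def l)
  have 4: "2 * s - 2 * u $ 2 - u $ 3 / 8 = c"
    using assms[of 4] by (simp add: inner_vec_3 gig_stat_def s_def l)
  have "u $ 2 = 0" "u $ 3 = 0" "s = 0" using 1 2 3 4 by linarith+
  then show ?thesis using \<open>ln 2 > 0\<close> by (simp add: vec_eq_iff forall_3 s_def)
qed

text \<open>A vanishing quadratic form is a vanishing variance, so u . T is almost everywhere
  constant, hence constant on the half line by continuity, which affine independence
  excludes.\<close>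

lemma cov_pos:
  assumes \<theta>: "\<theta> \<in> gig_params" and u: "u \<noteq> 0"
  shows "u \<bullet> GIG.cov \<theta> u > 0"
proof -
  have "u \<bullet> GIG.cov \<theta> u \<noteq> 0"
  proof
    assume zero: "u \<bullet> GIG.cov \<theta> u = 0"
    let ?g = "\<lambda>x. (u \<bullet> (gig_stat x - GIG.mean \<theta>))\<^sup>2"
    have [measurable]: "gig_stat \<in> borel_measurable gig_base" by (rule gig_stat_measurable)
    have "GIG.poly_growth (\<lambda>x. (u \<bullet> gig_stat x) *\<^sub>R (u \<bullet> gig_stat x))"
      by (intro GIG.poly_growth_scaleR GIG.poly_growth_inner)
    from GIG.integrable_P[OF \<theta> this] have "integrable (GIG.P \<theta>) (\<lambda>x. (u \<bullet> gig_stat x)\<^sup>2)"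
      by (simp add: power2_eq_square)
    moreover have "integrable (GIG.P \<theta>) (\<lambda>x. u \<bullet> gig_stat x)"
      by (rule GIG.integrable_P[OF \<theta> GIG.poly_growth_inner])
    moreover have "integrable (GIG.P \<theta>) (\<lambda>x. (u \<bullet> GIG.mean \<theta>)\<^sup>2)"
      by (rule GIG.integrable_P[OF \<theta> GIG.poly_growth_const])
    ultimately have int: "integrable (GIG.P \<theta>) ?g"
      by (simp add: inner_diff_right power2_diff)
    have "(\<integral>x. ?g x \<partial>GIG.P \<theta>) = 0"
      using zero GIG.inner_cov[OF \<theta>, of u u] by (simp add: power2_eq_square)
    then have "AE x in GIG.P \<theta>. ?g x = 0"
      using integral_nonneg_eq_0_iff_AE[OF int] by simp
    then have "AE x in gig_base. u \<bullet> gig_stat x = u \<bullet> GIG.mean \<theta>"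
      unfolding GIG.P_def by (subst (asm) AE_density) (auto simp: inner_diff_right)
    then have "AE x in restrict_space lborel {0<..}. 0 < ennreal (1 / x) \<longrightarrow> u \<bullet> gig_stat x = u \<bullet> GIG.mean \<theta>"
      unfolding gig_base_def by (subst (asm) AE_density) (auto simp: measurable_restrict_space1)
    then have "AE x in lborel. x \<in> {0<..} \<longrightarrow> 0 < ennreal (1 / x) \<longrightarrow> u \<bullet> gig_stat x = u \<bullet> GIG.mean \<theta>"
      by (subst (asm) AE_restrict_space_iff) auto
    then have ae: "AE x in lborel. x \<in> {0<..} \<longrightarrow> u \<bullet> gig_stat x = u \<bullet> GIG.mean \<theta>"
      by (rule eventually_mono) auto
    have "continuous_on {0<..} (\<lambda>x. u \<bullet> gig_stat x)"
      unfolding inner_vec_3 gig_stat_def vector_3 by (intro continuous_intros) auto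
    from AE_lborel_open_continuous[OF ae _ this] have "u = 0"
      by (intro gig_stat_affinely_independent[of u "u \<bullet> GIG.mean \<theta>"]) auto
    then show False using u by simp
  qed
  then show ?thesis using GIG.cov_nonneg[OF \<theta>, of u] by simp
qed

section \<open>The efficient direction and the efficient information\<close>

lemma cov_vector_3:
  assumes "a > 0" "b > 0"
  shows "GIG.cov (vector [p, a, b]) (vector [x, y, z]) = vector
    [x * Gamma_pp p a b + y * Gamma_pa p a b + z * Gamma_pb p a b,
     x * Gamma_pa p a b + y * Gamma_aa p a b + z * Gamma_ab p a b,
     x * Gamma_pb p a b + y * Gamma_ab p a b + z * Gamma_bb p a b]"
proof -
  let ?C = "GIG.cov (vector [p, a, b])"
  have \<theta>: "vector [p, a, b] \<in> gig_params" using assms by simp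
  have sym: "?C (axis i 1) $ j = ?C (axis j 1) $ i" for i j
    using GIG.cov_commute[OF \<theta>, of "axis j 1" "axis i 1"] by (simp add: inner_axis')
  have "?C (vector [x, y, z]) = x *\<^sub>R ?C (axis 1 1) + y *\<^sub>R ?C (axis 2 1) + z *\<^sub>R ?C (axis 3 1)"
    unfolding vector_3_eq[of x y z]
    by (simp only: linear_add[OF GIG.linear_cov[OF \<theta>]] linear_cmul[OF GIG.linear_cov[OF \<theta>]])
  then show ?thesis
    by (simp add: vec_eq_iff forall_3 Gamma_eq_cov[OF assms] sym[of 1 2] sym[of 1 3] sym[of 3 2])
qed

lemma Gamma_minor_pos:
  assumes "a > 0" "b > 0"
  shows "Gamma_aa p a b * Gamma_bb p a b - (Gamma_ab p a b)\<^sup>2 > 0"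
proof -
  have \<theta>: "vector [p, a, b] \<in> gig_params" using assms by simp
  have b: "Gamma_bb p a b > 0"
    using cov_pos[OF \<theta>, of "vector [0, 0, 1]"]
    by (simp add: cov_vector_3 assms inner_vec_3 vec_eq_iff forall_3)
  \<comment> \<open>At the vector (0, bb, - ab) the quadratic form completes the square: its value
    is \<open>Gamma_bb\<close> times the minor.\<close>
  have "0 < Gamma_bb p a b * (Gamma_aa p a b * Gamma_bb p a b - (Gamma_ab p a b)\<^sup>2)"
    using cov_pos[OF \<theta>, of "vector [0, Gamma_bb p a b, - Gamma_ab p a b]"] b
    by (simp add: cov_vector_3 assms inner_vec_3 vec_eq_iff forall_3 algebra_simps power2_eq_square)
  then show ?thesis using b by (simp add: zero_less_mult_iff)
qed

text \<open>The influence direction of the efficient central sequence: the residual of the score for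
  \<open>p\<close> after projection on the scores for \<open>a\<close> and \<open>b\<close>, normalised below to unit variance.\<close>

definition residual_dir :: "real ^ 3 \<Rightarrow> real ^ 3" where
  "residual_dir \<theta> =
    (let p = \<theta> $ 1; a = \<theta> $ 2; b = \<theta> $ 3;
         d = Gamma_aa p a b * Gamma_bb p a b - (Gamma_ab p a b)\<^sup>2 in
     vector [1, - ((Gamma_pa p a b * Gamma_bb p a b - Gamma_pb p a b * Gamma_ab p a b) / d),
       - ((Gamma_pb p a b * Gamma_aa p a b - Gamma_pa p a b * Gamma_ab p a b) / d)])"

definition efficient_dir :: "real ^ 3 \<Rightarrow> real ^ 3" where
  "efficient_dir \<theta> = residual_dir \<theta> /\<^sub>R sqrt (Gamma_eff (\<theta> $ 1) (\<theta> $ 2) (\<theta> $ 3))"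

text \<open>Expansion of the determinant along the first row, grouped so that the brackets are the
  numerators of \<open>residual_dir\<close>. It exhibits \<open>Gamma_eff\<close> as the Schur
  complement of the nuisance block.\<close>

lemma Gamma_eff_eq:
  "Gamma_eff p a b = (Gamma_pp p a b * (Gamma_aa p a b * Gamma_bb p a b - (Gamma_ab p a b)\<^sup>2)
    - Gamma_pa p a b * (Gamma_pa p a b * Gamma_bb p a b - Gamma_pb p a b * Gamma_ab p a b)
    - Gamma_pb p a b * (Gamma_pb p a b * Gamma_aa p a b - Gamma_pa p a b * Gamma_ab p a b))
    / (Gamma_aa p a b * Gamma_bb p a b - (Gamma_ab p a b)\<^sup>2)"
  unfolding Gamma_eff_def fisher_info_def det_3 vector_3
  by (intro arg_cong2[where f="(/)"] refl) (simp add: algebra_simps power2_eq_square)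

text \<open>The two zeros are the normal equations of the projection: the residual score is
  uncorrelated with the scores for a and b, and its covariance with the score for p is the efficient
  information.\<close>

lemma cov_residual_dir:
  assumes "a > 0" "b > 0"
  shows "GIG.cov (vector [p, a, b]) (residual_dir (vector [p, a, b])) = vector [Gamma_eff p a b, 0, 0]"
proof -
  define d where "d = Gamma_aa p a b * Gamma_bb p a b - (Gamma_ab p a b)\<^sup>2"
  have d: "d > 0" unfolding d_def by (rule Gamma_minor_pos[OF assms])
  have 1: "Gamma_pp p a b - (Gamma_pa p a b * Gamma_bb p a b - Gamma_pb p a b * Gamma_ab p a b) / d * Gamma_pa p a b
      - (Gamma_pb p a b * Gamma_aa p a b - Gamma_pa p a b * Gamma_ab p a b) / d * Gamma_pb p a b = Gamma_eff p a b"
    unfolding Gamma_eff_eq d_def[symmetric] using d by (simp add: field_simps)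
  have 2: "Gamma_pa p a b - (Gamma_pa p a b * Gamma_bb p a b - Gamma_pb p a b * Gamma_ab p a b) / d * Gamma_aa p a b
      - (Gamma_pb p a b * Gamma_aa p a b - Gamma_pa p a b * Gamma_ab p a b) / d * Gamma_ab p a b = 0"
    using d by (simp add: field_simps) (simp add: d_def algebra_simps power2_eq_square)
  have 3: "Gamma_pb p a b - (Gamma_pa p a b * Gamma_bb p a b - Gamma_pb p a b * Gamma_ab p a b) / d * Gamma_ab p a b
      - (Gamma_pb p a b * Gamma_aa p a b - Gamma_pa p a b * Gamma_ab p a b) / d * Gamma_bb p a b = 0"
    using d by (simp add: field_simps) (simp add: d_def algebra_simps power2_eq_square)
  show ?thesis
    unfolding residual_dir_def Let_def vector_3 d_def[symmetric] cov_vector_3[OF assms]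
    using 1 2 3 by (simp add: vec_eq_iff forall_3)
qed

lemma residual_dir_1 [simp]: "residual_dir \<theta> $ 1 = 1"
  by (simp add: residual_dir_def Let_def)

lemma Gamma_eff_pos:
  assumes "a > 0" "b > 0"
  shows "Gamma_eff p a b > 0"
proof -
  let ?r = "residual_dir (vector [p, a, b])"
  have "?r \<noteq> 0" using residual_dir_1[of "vector [p, a, b]"] by (metis zero_index zero_neq_one)
  then have "?r \<bullet> GIG.cov (vector [p, a, b]) ?r > 0" using assms by (intro cov_pos) auto
  then show ?thesis by (simp add: cov_residual_dir[OF assms] inner_vec_3)
qed

lemma cov_efficient_dir:
  assumes "a > 0" "b > 0"
  shows "GIG.cov (vector [p, a, b]) (efficient_dir (vector [p, a, b])) = vector [sqrt (Gamma_eff p a b), 0, 0]"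
proof -
  have "GIG.cov (vector [p, a, b]) (efficient_dir (vector [p, a, b])) = vector [Gamma_eff p a b, 0, 0] /\<^sub>R sqrt (Gamma_eff p a b)"
    unfolding efficient_dir_def
    using linear_cmul[OF GIG.linear_cov[of "vector [p, a, b]"]] assms by (simp add: cov_residual_dir)
  then show ?thesis
    using Gamma_eff_pos[OF assms, of p] by (simp add: vec_eq_iff forall_3 real_div_sqrt divide_inverse[symmetric] mult.commute)
qed

lemma efficient_dir_1: "efficient_dir (vector [p, a, b]) $ 1 = 1 / sqrt (Gamma_eff p a b)"
  by (simp add: efficient_dir_def divide_inverse)

lemma efficient_dir_unit:
  assumes "a > 0" "b > 0"
  shows "efficient_dir (vector [p, a, b]) \<bullet> GIG.cov (vector [p, a, b]) (efficient_dir (vector [p, a, b])) = 1"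
  using Gamma_eff_pos[OF assms, of p]
  by (simp add: cov_efficient_dir[OF assms] inner_vec_3 efficient_dir_1)

lemma Q_eff_eq:
  assumes "a > 0" "b > 0"
  shows "Q_eff n p a b x = efficient_dir (vector [p, a, b]) \<bullet> GIG.S n (vector [p, a, b]) x"
  unfolding Q_eff_def Delta_eff_def efficient_dir_def residual_dir_def Let_def
  by (simp add: Delta_eq_S[OF assms] inner_vec_3 inner_vec_def sum_2 matrix_vector_mult_def
      divide_inverse algebra_simps)

lemma continuous_on_Gamma:
  "continuous_on gig_params (\<lambda>\<theta>. Gamma_pp (\<theta> $ 1) (\<theta> $ 2) (\<theta> $ 3))"
  "continuous_on gig_params (\<lambda>\<theta>. Gamma_aa (\<theta> $ 1) (\<theta> $ 2) (\<theta> $ 3))"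
  "continuous_on gig_params (\<lambda>\<theta>. Gamma_bb (\<theta> $ 1) (\<theta> $ 2) (\<theta> $ 3))"
  "continuous_on gig_params (\<lambda>\<theta>. Gamma_pa (\<theta> $ 1) (\<theta> $ 2) (\<theta> $ 3))"
  "continuous_on gig_params (\<lambda>\<theta>. Gamma_pb (\<theta> $ 1) (\<theta> $ 2) (\<theta> $ 3))"
  "continuous_on gig_params (\<lambda>\<theta>. Gamma_ab (\<theta> $ 1) (\<theta> $ 2) (\<theta> $ 3))"
proof -
  have v: "vector [\<theta> $ 1, \<theta> $ 2, \<theta> $ 3] = \<theta>" for \<theta> :: "real ^ 3" by (simp add: vec_eq_iff forall_3)
  have c: "continuous_on gig_params (\<lambda>\<theta>. GIG.cov \<theta> u $ i)" for u i
    by (intro continuous_on_component GIG.continuous_on_cov)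
  show "continuous_on gig_params (\<lambda>\<theta>. Gamma_pp (\<theta> $ 1) (\<theta> $ 2) (\<theta> $ 3))"
    by (rule continuous_on_eq[OF c[of "axis 1 1" 1]]) (simp add: Gamma_eq_cov v gig_params_def)
  show "continuous_on gig_params (\<lambda>\<theta>. Gamma_aa (\<theta> $ 1) (\<theta> $ 2) (\<theta> $ 3))"
    by (rule continuous_on_eq[OF c[of "axis 2 1" 2]]) (simp add: Gamma_eq_cov v gig_params_def)
  show "continuous_on gig_params (\<lambda>\<theta>. Gamma_bb (\<theta> $ 1) (\<theta> $ 2) (\<theta> $ 3))"
    by (rule continuous_on_eq[OF c[of "axis 3 1" 3]]) (simp add: Gamma_eq_cov v gig_params_def)
  show "continuous_on gig_params (\<lambda>\<theta>. Gamma_pa (\<theta> $ 1) (\<theta> $ 2) (\<theta> $ 3))"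
    by (rule continuous_on_eq[OF c[of "axis 2 1" 1]]) (simp add: Gamma_eq_cov v gig_params_def)
  show "continuous_on gig_params (\<lambda>\<theta>. Gamma_pb (\<theta> $ 1) (\<theta> $ 2) (\<theta> $ 3))"
    by (rule continuous_on_eq[OF c[of "axis 3 1" 1]]) (simp add: Gamma_eq_cov v gig_params_def)
  show "continuous_on gig_params (\<lambda>\<theta>. Gamma_ab (\<theta> $ 1) (\<theta> $ 2) (\<theta> $ 3))"
    by (rule continuous_on_eq[OF c[of "axis 2 1" 3]]) (simp add: Gamma_eq_cov v gig_params_def)
qed

lemma continuous_on_efficient_dir: "continuous_on gig_params efficient_dir"
proof -
  have minor: "Gamma_aa (\<theta> $ 1) (\<theta> $ 2) (\<theta> $ 3) * Gamma_bb (\<theta> $ 1) (\<theta> $ 2) (\<theta> $ 3) - (Gamma_ab (\<theta> $ 1) (\<theta> $ 2) (\<theta> $ 3))\<^sup>2 \<noteq> 0"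
    if "\<theta> \<in> gig_params" for \<theta>
    using Gamma_minor_pos[of "\<theta> $ 2" "\<theta> $ 3" "\<theta> $ 1"] that by (simp add: gig_params_def)
  have pos: "sqrt (Gamma_eff (\<theta> $ 1) (\<theta> $ 2) (\<theta> $ 3)) \<noteq> 0" if "\<theta> \<in> gig_params" for \<theta>
    using Gamma_eff_pos[of "\<theta> $ 2" "\<theta> $ 3" "\<theta> $ 1"] that by (simp add: gig_params_def)
  have "continuous_on gig_params (\<lambda>\<theta>. Gamma_eff (\<theta> $ 1) (\<theta> $ 2) (\<theta> $ 3))"
    unfolding Gamma_eff_eq by (intro continuous_intros continuous_on_Gamma) (use minor in auto)
  moreover have "continuous_on gig_params residual_dir"
    unfolding residual_dir_def Let_def vector_3_eq
    by (intro continuous_intros continuous_on_Gamma) (use minor in auto)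
  ultimately show ?thesis
    unfolding efficient_dir_def[abs_def] using pos by (intro continuous_intros) auto
qed

section \<open>The efficient test\<close>

lemma sets_gig_sample: "sets (gig_sample n p a b) = sets (sample_space n)"
  unfolding gig_sample_def sample_space_def
  by (intro sets_PiM_cong) (simp_all add: gig_def sets_restrict_space)

lemma bounded_in_prob_norm_vector:
  fixes X Y :: "nat \<Rightarrow> 'a \<Rightarrow> real"
  assumes M: "\<And>n. prob_space (M n)"
    and [measurable]: "\<And>n. X n \<in> borel_measurable (M n)" "\<And>n. Y n \<in> borel_measurable (M n)"
    and X: "bounded_in_prob M (\<lambda>n x. sqrt (real n) * X n x)"
    and Y: "bounded_in_prob M (\<lambda>n x. sqrt (real n) * Y n x)"
  shows "bounded_in_prob M (\<lambda>n x. sqrt (real n) * norm (vector [0, X n x, Y n x] :: real ^ 3))"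
  unfolding bounded_in_prob_def
proof (intro allI impI)
  fix e :: real assume "e > 0"
  then have e: "e / 2 > 0" by simp
  obtain C1 where C1: "\<forall>\<^sub>F n in sequentially. measure (M n) {x \<in> space (M n). \<bar>sqrt (real n) * X n x\<bar> > C1} \<le> e / 2"
    using X[unfolded bounded_in_prob_def, rule_format, OF e] by blast
  obtain C2 where C2: "\<forall>\<^sub>F n in sequentially. measure (M n) {x \<in> space (M n). \<bar>sqrt (real n) * Y n x\<bar> > C2} \<le> e / 2"
    using Y[unfolded bounded_in_prob_def, rule_format, OF e] by blast
  show "\<exists>C. \<forall>\<^sub>F n in sequentially. measure (M n)
      {x \<in> space (M n). \<bar>sqrt (real n) * norm (vector [0, X n x, Y n x] :: real ^ 3)\<bar> > C} \<le> e"
  proof (rule exI[of _ "C1 + C2"], use C1 C2 in eventually_elim)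
    case (elim n)
    interpret prob_space "M n" by (rule M)
    let ?A = "{x \<in> space (M n). \<bar>sqrt (real n) * X n x\<bar> > C1}"
    let ?B = "{x \<in> space (M n). \<bar>sqrt (real n) * Y n x\<bar> > C2}"
    have "{x \<in> space (M n). \<bar>sqrt (real n) * norm (vector [0, X n x, Y n x] :: real ^ 3)\<bar> > C1 + C2} \<subseteq> ?A \<union> ?B"
    proof
      fix x assume x: "x \<in> {x \<in> space (M n). \<bar>sqrt (real n) * norm (vector [0, X n x, Y n x] :: real ^ 3)\<bar> > C1 + C2}"
      have "norm (vector [0, X n x, Y n x] :: real ^ 3) \<le> \<bar>X n x\<bar> + \<bar>Y n x\<bar>"
        using norm_le_l1_cart[of "vector [0, X n x, Y n x] :: real ^ 3"] by (simp add: sum_3)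
      then have "sqrt (real n) * norm (vector [0, X n x, Y n x] :: real ^ 3) \<le> sqrt (real n) * (\<bar>X n x\<bar> + \<bar>Y n x\<bar>)"
        by (intro mult_left_mono) auto
      then show "x \<in> ?A \<union> ?B" using x by (auto simp: abs_mult distrib_left)
    qed
    then have "measure (M n) {x \<in> space (M n). \<bar>sqrt (real n) * norm (vector [0, X n x, Y n x] :: real ^ 3)\<bar> > C1 + C2}
        \<le> measure (M n) (?A \<union> ?B)" by (intro finite_measure_mono) measurable
    also have "\<dots> \<le> measure (M n) ?A + measure (M n) ?B" by (rule measure_Un_le) measurable
    also have "\<dots> \<le> e" using elim by linarith
    finally show ?case .
  qed
qed

lemma vector_tendsto_scaled:
  assumes "\<tau>seq \<longlonglongrightarrow> (\<tau>1::real)"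
  shows "(\<lambda>n. sqrt (real n) *\<^sub>R (vector [p0 + \<tau>seq n / sqrt (real n), a, b] - vector [p0, a, b] :: real ^ 3))
    \<longlonglongrightarrow> vector [\<tau>1, 0, 0]"
proof (rule Lim_transform_eventually)
  show "(\<lambda>n. vector [\<tau>seq n, 0, 0] :: real ^ 3) \<longlonglongrightarrow> vector [\<tau>1, 0, 0]"
    unfolding vector_3_eq by (intro tendsto_intros assms)
  show "\<forall>\<^sub>F n in sequentially. (vector [\<tau>seq n, 0, 0] :: real ^ 3)
      = sqrt (real n) *\<^sub>R (vector [p0 + \<tau>seq n / sqrt (real n), a, b] - vector [p0, a, b])"
    by (rule eventually_sequentiallyI[of 1]) (simp add: vec_eq_iff forall_3)
qed

locale gig_plugin =
  fixes p0 :: real and ahat bhat :: "nat \<Rightarrow> (nat \<Rightarrow> real) \<Rightarrow> real"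
  assumes A: "assumption_A p0 ahat bhat"
begin

abbreviation Q :: "nat \<Rightarrow> (nat \<Rightarrow> real) \<Rightarrow> real" where
  "Q n x \<equiv> Q_eff n p0 (ahat n x) (bhat n x) x"

definition est :: "nat \<Rightarrow> (nat \<Rightarrow> real) \<Rightarrow> real ^ 3" where
  "est n x = vector [p0, ahat n x, bhat n x]"

lemma hat_measurable [measurable]:
  "ahat n \<in> borel_measurable (sample_space n)" "bhat n \<in> borel_measurable (sample_space n)"
  using A by (auto simp: assumption_A_def estimator_seq_def)

lemma hat_pos: "x \<in> space (sample_space n) \<Longrightarrow> ahat n x > 0" "x \<in> space (sample_space n) \<Longrightarrow> bhat n x > 0"
  using A by (auto simp: assumption_A_def estimator_seq_def)

lemma est_measurable: "est n \<in> borel_measurable (PiM {..<n} (\<lambda>_. gig_base))"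
  unfolding est_def[abs_def] measurable_cong_sets[OF sets_sample_space[symmetric] refl] by measurable

text \<open>\<open>efficient_dir\<close> and \<open>mean\<close> are known to be continuous only on
  \<open>gig_params\<close>, so measurability of their compositions goes through the restricted
  space; positivity of the estimators on the sample space puts \<open>est\<close> there.\<close>

lemma est_restrict_measurable:
  "est n \<in> measurable (PiM {..<n} (\<lambda>_. gig_base)) (restrict_space borel gig_params)"
  using est_measurable hat_pos
  by (intro measurable_restrict_space2) (auto simp: est_def space_sample_space)

lemma plugin_measurable:
  "(\<lambda>x. efficient_dir (est n x) \<bullet> GIG.S n (est n x) x) \<in> borel_measurable (PiM {..<n} (\<lambda>_. gig_base))"
proof -
  have [measurable]: "gig_stat \<in> borel_measurable gig_base" by (rule gig_stat_measurable)
  have [measurable]: "(\<lambda>x. efficient_dir (est n x)) \<in> borel_measurable (PiM {..<n} (\<lambda>_. gig_base))"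
    by (rule measurable_compose[OF est_restrict_measurable borel_measurable_continuous_on_restrict[OF continuous_on_efficient_dir]])
  have [measurable]: "(\<lambda>x. GIG.mean (est n x)) \<in> borel_measurable (PiM {..<n} (\<lambda>_. gig_base))"
    by (rule measurable_compose[OF est_restrict_measurable borel_measurable_continuous_on_restrict[OF GIG.continuous_on_mean]])
  show ?thesis unfolding GIG.S_def by measurable
qed

lemma Q_eq: "x \<in> space (sample_space n) \<Longrightarrow> Q n x = efficient_dir (est n x) \<bullet> GIG.S n (est n x) x"
  using Q_eff_eq[OF hat_pos(1) hat_pos(2)] by (simp add: est_def)

lemma Q_measurable [measurable]: "Q n \<in> borel_measurable (sample_space n)"
  using plugin_measurable unfolding measurable_cong_sets[OF sets_sample_space[symmetric] refl]
  by (subst measurable_cong[OF Q_eq])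

lemma Q_measurable_Pn: "Q n \<in> borel_measurable (GIG.Pn n \<theta>)"
  using Q_measurable unfolding measurable_cong_sets[OF trans[OF GIG.sets_Pn sets_sample_space[symmetric]] refl] .

context
  fixes a b :: real
  assumes ab: "a > 0" "b > 0"
begin

abbreviation \<theta> :: "real ^ 3" where "\<theta> \<equiv> vector [p0, a, b]"

lemma est_tight: "bounded_in_prob (\<lambda>n. GIG.Pn n \<theta>) (\<lambda>n x. sqrt (real n) * norm (est n x - \<theta>))"
proof -
  have eq: "est n x - \<theta> = vector [0, ahat n x - a, bhat n x - b]" for n x
    by (simp add: est_def vec_eq_iff forall_3)
  have gs: "GIG.Pn n \<theta> = gig_sample n p0 a b" for n using gig_sample_eq_Pn[OF ab] by simp
  have ps: "prob_space (gig_sample n p0 a b)" for n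
    using GIG.prob_space_Pn[of \<theta> n] ab by (simp add: gs)
  show ?thesis unfolding eq gs
  proof (rule bounded_in_prob_norm_vector[OF ps])
    show "(\<lambda>x. ahat n x - a) \<in> borel_measurable (gig_sample n p0 a b)"
      "(\<lambda>x. bhat n x - b) \<in> borel_measurable (gig_sample n p0 a b)" for n
      unfolding measurable_cong_sets[OF sets_gig_sample refl] by measurable
  qed (use A ab in \<open>auto simp: assumption_A_def root_n_consistent_def\<close>)
qed

text \<open>By symmetry of \<open>cov\<close> the pairing reads off only the first coordinate of the
  shift, so local changes of a and b do not move the limit law.\<close>

lemma cov_pair: "efficient_dir \<theta> \<bullet> GIG.cov \<theta> h = sqrt (Gamma_eff p0 a b) * h $ 1"
  using GIG.cov_commute[of \<theta> "efficient_dir \<theta>" h] ab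
  by (simp add: cov_efficient_dir inner_vec_3 mult.commute)

lemma isCont_efficient_dir: "isCont efficient_dir \<theta>"
  using continuous_on_efficient_dir GIG.open_\<Theta> ab by (simp add: continuous_on_eq_continuous_at)

lemma Q_weak_conv:
  assumes t: "\<And>n. t n \<in> gig_params" and lim: "(\<lambda>n. sqrt (real n) *\<^sub>R (t n - \<theta>)) \<longlonglongrightarrow> h"
  shows "weak_conv_m (\<lambda>n. distr (GIG.Pn n (t n)) borel (Q n)) (normal_law (sqrt (Gamma_eff p0 a b) * h $ 1))"
proof -
  have "weak_conv_m (\<lambda>n. distr (GIG.Pn n (t n)) borel (\<lambda>x. efficient_dir (est n x) \<bullet> GIG.S n (est n x) x))
    (normal_law (efficient_dir \<theta> \<bullet> GIG.cov \<theta> h))"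
  proof (rule GIG.plugin_score_normal[OF _ isCont_efficient_dir est_measurable plugin_measurable _ est_tight _ t lim])
    show "\<theta> \<in> gig_params" using ab by simp
    show "(est n x - \<theta>) \<bullet> GIG.cov \<theta> (efficient_dir \<theta>) = 0" for n x
      using ab by (simp add: cov_efficient_dir inner_vec_3 est_def)
    show "efficient_dir \<theta> \<bullet> GIG.cov \<theta> (efficient_dir \<theta>) = 1" by (rule efficient_dir_unit[OF ab])
  qed
  moreover have "distr (GIG.Pn n (t n)) borel (\<lambda>x. efficient_dir (est n x) \<bullet> GIG.S n (est n x) x)
      = distr (GIG.Pn n (t n)) borel (Q n)" for n
    by (intro distr_cong refl) (simp add: Q_eq GIG.space_Pn space_sample_space)
  ultimately show ?thesis by (simp only: cov_pair)
qed

text \<open>The case of a constant estimator. It gives the limiting size and power of the test with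
  known a and b, the benchmark in the maximin bound.\<close>

lemma score_weak_conv:
  assumes t: "\<And>n. t n \<in> gig_params" and lim: "(\<lambda>n. sqrt (real n) *\<^sub>R (t n - \<theta>)) \<longlonglongrightarrow> h"
  shows "weak_conv_m (\<lambda>n. distr (GIG.Pn n (t n)) borel (\<lambda>x. efficient_dir \<theta> \<bullet> GIG.S n \<theta> x))
    (normal_law (sqrt (Gamma_eff p0 a b) * h $ 1))"
  unfolding cov_pair[symmetric]
proof (rule GIG.plugin_score_normal[where est="\<lambda>_ _. \<theta>", OF _ isCont_efficient_dir _ _ _ _ _ t lim])
  show "\<theta> \<in> gig_params" using ab by simp
  show "efficient_dir \<theta> \<bullet> GIG.cov \<theta> (efficient_dir \<theta>) = 1" by (rule efficient_dir_unit[OF ab])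
  show "bounded_in_prob (\<lambda>n. GIG.Pn n \<theta>) (\<lambda>n x. sqrt (real n) * norm (\<theta> - \<theta>))"
    by (auto simp: bounded_in_prob_def intro!: exI[of _ 0])
qed (auto intro: borel_measurable_inner GIG.S_measurable)

lemma two_sided_limit:
  fixes X :: "nat \<Rightarrow> (nat \<Rightarrow> real) \<Rightarrow> real"
  assumes t: "\<And>n. t n \<in> gig_params" and X: "\<And>n. X n \<in> borel_measurable (GIG.Pn n (t n))"
    and wc: "weak_conv_m (\<lambda>n. distr (GIG.Pn n (t n)) borel (X n)) (normal_law \<mu>)" and z: "z > 0"
  shows "(\<lambda>n. integral\<^sup>L (GIG.Pn n (t n)) (\<lambda>x. if \<bar>X n x\<bar> > z then 1 else 0 :: real)) \<longlonglongrightarrow> two_sided_power z \<mu>"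
proof -
  have rd: "real_distribution (distr (GIG.Pn n (t n)) borel (X n))" for n
  proof -
    interpret prob_space "GIG.Pn n (t n)" by (rule GIG.prob_space_Pn[OF t])
    show ?thesis by (rule real_distribution_distr) (rule X)
  qed
  have "integral\<^sup>L (GIG.Pn n (t n)) (\<lambda>x. if \<bar>X n x\<bar> > z then 1 else 0 :: real)
      = measure (distr (GIG.Pn n (t n)) borel (X n)) {x. \<bar>x\<bar> > z}" for n
  proof -
    have [measurable]: "X n \<in> borel_measurable (GIG.Pn n (t n))" by (rule X)
    have "integral\<^sup>L (GIG.Pn n (t n)) (\<lambda>x. if \<bar>X n x\<bar> > z then 1 else 0 :: real)
        = integral\<^sup>L (GIG.Pn n (t n)) (indicator {x \<in> space (GIG.Pn n (t n)). \<bar>X n x\<bar> > z})"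
      by (intro Bochner_Integration.integral_cong refl) (auto simp: indicator_def)
    also have "\<dots> = measure (GIG.Pn n (t n)) {x \<in> space (GIG.Pn n (t n)). \<bar>X n x\<bar> > z}"
      by (subst Bochner_Integration.integral_indicator) (auto intro!: arg_cong[where f="measure _"])
    also have "\<dots> = measure (distr (GIG.Pn n (t n)) borel (X n)) {x. \<bar>x\<bar> > z}"
      by (subst measure_distr) (auto intro!: arg_cong[where f="measure _"])
    finally show ?thesis .
  qed
  then show ?thesis using weak_conv_two_sided[OF rd wc z] by simp
qed

section \<open>Local power and the maximin property\<close>

lemma local_expectation_eventually:
  obtains t where "\<And>n. t n \<in> gig_params"
    "\<forall>\<^sub>F n in sequentially. sqrt (real n) *\<^sub>R (t n - \<theta>) = \<tau>"
    "\<And>f. \<forall>\<^sub>F n in sequentially. local_expectation p0 a b \<tau> n (f n) = integral\<^sup>L (GIG.Pn n (t n)) (f n)"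
proof -
  define s where "s n = \<theta> + \<tau> /\<^sub>R sqrt (real n)" for n
  \<comment> \<open>The finitely many local parameters with nonpositive a or b are replaced by
    \<open>\<theta>\<close>, since the limit theorems ask for parameters in the family at every
    n.\<close>
  define t where "t n = (if s n \<in> gig_params then s n else \<theta>)" for n
  have \<theta>: "\<theta> \<in> gig_params" using ab by simp
  have "\<forall>\<^sub>F n in sequentially. sqrt (real n) *\<^sub>R (s n - \<theta>) = \<tau>"
    by (rule eventually_sequentiallyI[of 1]) (simp add: s_def)
  note lim = this tendsto_eventually[OF this]
  have ev: "\<forall>\<^sub>F n in sequentially. s n \<in> gig_params" by (rule GIG.eventually_in_\<Theta>[OF \<theta> lim(2)])
  show thesis
  proof
    show "t n \<in> gig_params" for n using \<theta> by (simp add: t_def)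
    show "\<forall>\<^sub>F n in sequentially. sqrt (real n) *\<^sub>R (t n - \<theta>) = \<tau>"
      using ev lim(1) by eventually_elim (simp add: t_def)
    fix f :: "nat \<Rightarrow> (nat \<Rightarrow> real) \<Rightarrow> real"
    show "\<forall>\<^sub>F n in sequentially. local_expectation p0 a b \<tau> n (f n) = integral\<^sup>L (GIG.Pn n (t n)) (f n)"
      using ev
    proof eventually_elim
      case (elim n)
      have s: "s n = vector [p0 + \<tau> $ 1 / sqrt (real n), a + \<tau> $ 2 / sqrt (real n), b + \<tau> $ 3 / sqrt (real n)]"
        by (simp add: s_def vec_eq_iff forall_3 divide_inverse mult.commute)
      then show ?case using elim by (simp add: local_expectation_def t_def gig_sample_eq_Pn)
    qed
  qed
qed

lemma local_power:
  assumes \<alpha>: "0 < \<alpha>" "\<alpha> < 1"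
  shows "(\<lambda>n. local_expectation p0 a b \<tau> n (phi_test \<alpha> p0 ahat bhat n))
    \<longlonglongrightarrow> two_sided_power (normal_upper_quantile (\<alpha> / 2)) (sqrt (Gamma_eff p0 a b) * \<tau> $ 1)"
proof -
  obtain t where t: "\<And>n. t n \<in> gig_params"
    "\<forall>\<^sub>F n in sequentially. sqrt (real n) *\<^sub>R (t n - \<theta>) = \<tau>"
    "\<And>f. \<forall>\<^sub>F n in sequentially. local_expectation p0 a b \<tau> n (f n) = integral\<^sup>L (GIG.Pn n (t n)) (f n)"
    using local_expectation_eventually by blast
  have "(\<lambda>n. integral\<^sup>L (GIG.Pn n (t n)) (phi_test \<alpha> p0 ahat bhat n))
    \<longlonglongrightarrow> two_sided_power (normal_upper_quantile (\<alpha> / 2)) (sqrt (Gamma_eff p0 a b) * \<tau> $ 1)"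
    unfolding phi_test_def
    by (rule two_sided_limit[OF t(1) Q_measurable_Pn Q_weak_conv[OF t(1) tendsto_eventually[OF t(2)]] two_sided_power_quantile(1)[OF \<alpha>]])
  then show ?thesis
    by (rule Lim_transform_eventually) (use t(3)[of "phi_test \<alpha> p0 ahat bhat"] in \<open>auto elim: eventually_mono\<close>)
qed

text \<open>Nuisance shifts have first coordinate 0, where the limiting power is the value
  \<open>\<alpha>\<close> of the two-sided power function at the origin.\<close>

lemma phi_test_level_class:
  assumes \<alpha>: "0 < \<alpha>" "\<alpha> < 1"
  shows "phi_test \<alpha> p0 ahat bhat \<in> level_class \<alpha> p0 a b"
proof -
  have "test_seq (phi_test \<alpha> p0 ahat bhat)"
    unfolding test_seq_def phi_test_def[abs_def] by auto
  moreover have "limsup (\<lambda>n. ereal (local_expectation p0 a b (vector [0, \<tau>2, \<tau>3]) n (phi_test \<alpha> p0 ahat bhat n))) = ereal \<alpha>" for \<tau>2 \<tau>3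
    using local_power[OF \<alpha>, of "vector [0, \<tau>2, \<tau>3]"] two_sided_power_quantile(2)[OF \<alpha>]
    by (intro lim_imp_Limsup) auto
  ultimately show ?thesis by (simp add: level_class_def)
qed

text \<open>The limiting power depends on |\<open>\<tau>\<close> $ 1| only and is increasing in it,
  so it is smallest on the boundary |\<open>\<tau>\<close> $ 1| = \<open>\<delta>\<close>.\<close>

lemma maximin_power_phi_ge:
  assumes \<alpha>: "0 < \<alpha>" "\<alpha> < 1" and \<delta>: "\<delta> > 0"
  shows "ereal (two_sided_power (normal_upper_quantile (\<alpha> / 2)) (sqrt (Gamma_eff p0 a b) * \<delta>))
    \<le> maximin_power p0 a b \<delta> (phi_test \<alpha> p0 ahat bhat)"
  unfolding maximin_power_def
proof (rule INF_greatest)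
  fix \<tau> :: "real ^ 3" assume "\<tau> \<in> {\<tau>. \<bar>\<tau> $ 1\<bar> \<ge> \<delta>}"
  then have \<tau>: "\<delta> \<le> \<bar>\<tau> $ 1\<bar>" by simp
  let ?z = "normal_upper_quantile (\<alpha> / 2)"
  let ?g = "sqrt (Gamma_eff p0 a b)"
  have g: "?g > 0" using Gamma_eff_pos[OF ab] by simp
  have "two_sided_power ?z (?g * \<delta>) \<le> two_sided_power ?z (?g * \<bar>\<tau> $ 1\<bar>)"
    using two_sided_power_quantile(1)[OF \<alpha>] g \<delta> \<tau> by (intro two_sided_power_mono mult_left_mono) auto
  also have "?g * \<bar>\<tau> $ 1\<bar> = \<bar>?g * \<tau> $ 1\<bar>" using g by (simp add: abs_mult)
  finally have "two_sided_power ?z (?g * \<delta>) \<le> two_sided_power ?z (?g * \<tau> $ 1)"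
    by (simp only: two_sided_power_abs)
  moreover have "liminf (\<lambda>n. ereal (local_expectation p0 a b \<tau> n (phi_test \<alpha> p0 ahat bhat n))) = ereal (two_sided_power ?z (?g * \<tau> $ 1))"
    using local_power[OF \<alpha>, of \<tau>] by (intro lim_imp_Liminf) auto
  ultimately show "ereal (two_sided_power ?z (?g * \<delta>)) \<le> liminf (\<lambda>n. ereal (local_expectation p0 a b \<tau> n (phi_test \<alpha> p0 ahat bhat n)))"
    by simp
qed

text \<open>Only the null point and the two alternatives \<open>w\<close> and \<open>- w\<close> along the least favourable
  direction are needed: there the likelihood ratio of the symmetric mixture is asymptotically
  \<open>cosh (w \<bullet> S)\<close> up to a constant, an increasing function of the absolute efficient score.\<close>

lemma maximin_power_le:
  assumes \<alpha>: "0 < \<alpha>" "\<alpha> < 1" and \<delta>: "\<delta> > 0" and \<psi>: "\<psi> \<in> level_class \<alpha> p0 a b"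
  shows "maximin_power p0 a b \<delta> \<psi>
    \<le> ereal (two_sided_power (normal_upper_quantile (\<alpha> / 2)) (sqrt (Gamma_eff p0 a b) * \<delta>))"
proof (rule ccontr)
  define z where "z = normal_upper_quantile (\<alpha> / 2)"
  define g where "g = sqrt (Gamma_eff p0 a b)"
  define \<beta> where "\<beta> = two_sided_power z (g * \<delta>)"
  \<comment> \<open>The first coordinate of the efficient direction is 1 / g, so this multiple has
    first coordinate \<open>\<delta>\<close>. It multiplies the normalised score by
    \<open>\<delta>\<close> * g, and the threshold z becomes \<open>\<delta>\<close> * g *
    z.\<close>
  define w where "w = (\<delta> * g) *\<^sub>R efficient_dir \<theta>"
  have \<theta>: "\<theta> \<in> gig_params" using ab by simp
  have z: "z > 0" unfolding z_def by (rule two_sided_power_quantile(1)[OF \<alpha>])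
  have g: "g > 0" using Gamma_eff_pos[OF ab] by (simp add: g_def)
  have w1: "w $ 1 = \<delta>" using g by (simp add: w_def efficient_dir_1 g_def)
  assume "\<not> maximin_power p0 a b \<delta> \<psi>
    \<le> ereal (two_sided_power (normal_upper_quantile (\<alpha> / 2)) (sqrt (Gamma_eff p0 a b) * \<delta>))"
  then have "ereal \<beta> < maximin_power p0 a b \<delta> \<psi>" by (simp add: \<beta>_def z_def g_def)
  \<comment> \<open>Room strictly between the benchmark power and the supposed maximin power absorbs
    the error terms below.\<close>
  then obtain c where c: "\<beta> < c" "ereal c < maximin_power p0 a b \<delta> \<psi>"
    using ereal_dense2 by (metis less_ereal.simps(1))
  have powc: "\<forall>\<^sub>F n in sequentially. c < local_expectation p0 a b \<tau> n (\<psi> n)" if "\<bar>\<tau> $ 1\<bar> = \<delta>" for \<tau>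
  proof -
    have "maximin_power p0 a b \<delta> \<psi> \<le> liminf (\<lambda>n. ereal (local_expectation p0 a b \<tau> n (\<psi> n)))"
      unfolding maximin_power_def by (rule INF_lower) (use that in simp)
    then have "ereal c < liminf (\<lambda>n. ereal (local_expectation p0 a b \<tau> n (\<psi> n)))" using c(2) by simp
    from less_LiminfD[OF this] show ?thesis by simp
  qed
  obtain t where t: "\<And>n. t n \<in> gig_params" "\<forall>\<^sub>F n in sequentially. sqrt (real n) *\<^sub>R (t n - \<theta>) = w"
    "\<And>f. \<forall>\<^sub>F n in sequentially. local_expectation p0 a b w n (f n) = integral\<^sup>L (GIG.Pn n (t n)) (f n)"
    using local_expectation_eventually[of w] by blast
  obtain t' where t': "\<And>n. t' n \<in> gig_params" "\<forall>\<^sub>F n in sequentially. sqrt (real n) *\<^sub>R (t' n - \<theta>) = - w"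
    "\<And>f. \<forall>\<^sub>F n in sequentially. local_expectation p0 a b (- w) n (f n) = integral\<^sup>L (GIG.Pn n (t' n)) (f n)"
    using local_expectation_eventually[of "- w"] by blast
  have ts: "test_seq \<psi>" and lev: "\<And>\<tau>2 \<tau>3. limsup (\<lambda>n. ereal (local_expectation p0 a b (vector [0, \<tau>2, \<tau>3]) n (\<psi> n))) \<le> ereal \<alpha>"
    using \<psi> by (auto simp: level_class_def)
  have \<psi>m: "\<psi> n \<in> borel_measurable (PiM {..<n} (\<lambda>_. gig_base))" for n
    using ts unfolding test_seq_def measurable_cong_sets[OF sets_sample_space refl] by blast
  have \<psi>01: "0 \<le> \<psi> n x \<and> \<psi> n x \<le> 1" if "x \<in> space (PiM {..<n} (\<lambda>_. gig_base))" for n x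
    using ts that unfolding test_seq_def space_sample_space by blast
  let ?\<phi> = "\<lambda>n x. indicator {x. \<bar>w \<bullet> GIG.S n \<theta> x\<bar> > \<delta> * g * z} x :: real"
  let ?E = "\<lambda>n \<theta> f. integral\<^sup>L (GIG.Pn n \<theta>) f"
  obtain r k where rk: "r \<longlonglongrightarrow> 0" "k \<ge> 0" "\<forall>\<^sub>F n in sequentially.
     ?E n (t n) (\<psi> n) + ?E n (t' n) (\<psi> n) \<le> ?E n (t n) (?\<phi> n) + ?E n (t' n) (?\<phi> n) + k * (?E n \<theta> (\<psi> n) - ?E n \<theta> (?\<phi> n)) + r n"
    using GIG.neyman_pearson_two_sided[OF \<theta> t(1) t'(1) t(2) t'(2) \<psi>m \<psi>01, of "\<delta> * g * z"] \<delta> g z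
    by (auto simp: mult_nonneg_nonneg)
  have \<phi>: "?\<phi> n = (\<lambda>x. if \<bar>efficient_dir \<theta> \<bullet> GIG.S n \<theta> x\<bar> > z then 1 else 0)" for n
    using \<delta> g by (auto simp: fun_eq_iff w_def indicator_def abs_mult)
  have Xm: "(\<lambda>x. efficient_dir \<theta> \<bullet> GIG.S n \<theta> x) \<in> borel_measurable (GIG.Pn n s)" for n s
    unfolding measurable_cong_sets[OF GIG.sets_Pn refl] by (intro borel_measurable_inner GIG.S_measurable) simp
  have lim\<phi>: "(\<lambda>n. ?E n (s n) (?\<phi> n)) \<longlonglongrightarrow> two_sided_power z (g * h $ 1)"
    if "\<And>n. s n \<in> gig_params" "\<forall>\<^sub>F n in sequentially. sqrt (real n) *\<^sub>R (s n - \<theta>) = h" for s h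
    unfolding \<phi>
    by (rule two_sided_limit[OF that(1) Xm score_weak_conv[OF that(1) tendsto_eventually[OF that(2)], folded g_def] z])
  have 1: "(\<lambda>n. ?E n (t n) (?\<phi> n)) \<longlonglongrightarrow> \<beta>" using lim\<phi>[OF t(1,2)] by (simp add: w1 \<beta>_def)
  have 2: "(\<lambda>n. ?E n (t' n) (?\<phi> n)) \<longlonglongrightarrow> \<beta>"
    using lim\<phi>[OF t'(1,2)] two_sided_power_abs[of z "- (g * \<delta>)"] g \<delta> by (simp add: w1 \<beta>_def)
  have 3: "(\<lambda>n. ?E n \<theta> (?\<phi> n)) \<longlonglongrightarrow> \<alpha>"
    using lim\<phi>[of "\<lambda>_. \<theta>" 0] \<theta> two_sided_power_quantile(2)[OF \<alpha>] by (simp add: z_def)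
  \<comment> \<open>Each limit is used with tolerance e: the two powers of the benchmark test and
    the remainder r n cost 3 e, and the difference in level costs 2 e times k.\<close>
  define e where "e = (c - \<beta>) / (3 + 2 * k)"
  have e: "e > 0" using c(1) rk(2) by (auto simp: e_def)
  have ek: "e * (3 + 2 * k) = c - \<beta>" using rk(2) by (simp add: e_def)
  \<comment> \<open>The level constraint enters only at the null point itself, the zero nuisance
    shift.\<close>
  have 4: "\<forall>\<^sub>F n in sequentially. ?E n \<theta> (\<psi> n) < \<alpha> + e"
  proof -
    have "limsup (\<lambda>n. ereal (local_expectation p0 a b (vector [0, 0, 0]) n (\<psi> n))) < ereal (\<alpha> + e)"
      by (rule order.strict_trans1[OF lev[of 0 0]]) (use e in simp)
    from Limsup_lessD[OF this] show ?thesis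
      by (simp add: local_expectation_def gig_sample_eq_Pn ab)
  qed
  have 5: "\<forall>\<^sub>F n in sequentially. ?E n (t n) (?\<phi> n) < \<beta> + e" by (rule order_tendstoD(2)[OF 1]) (use e in simp)
  have 6: "\<forall>\<^sub>F n in sequentially. ?E n (t' n) (?\<phi> n) < \<beta> + e" by (rule order_tendstoD(2)[OF 2]) (use e in simp)
  have 7: "\<forall>\<^sub>F n in sequentially. \<alpha> - e < ?E n \<theta> (?\<phi> n)" by (rule order_tendstoD(1)[OF 3]) (use e in simp)
  have 8: "\<forall>\<^sub>F n in sequentially. r n < e" by (rule order_tendstoD(2)[OF rk(1)]) (use e in simp)
  have 9: "\<forall>\<^sub>F n in sequentially. c < local_expectation p0 a b w n (\<psi> n)" by (rule powc) (use w1 \<delta> in simp)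
  have 10: "\<forall>\<^sub>F n in sequentially. c < local_expectation p0 a b (- w) n (\<psi> n)" by (rule powc) (use w1 \<delta> in simp)
  have "\<forall>\<^sub>F n in sequentially. False"
    using 4 5 6 7 8 9 10 t(3)[of \<psi>] t'(3)[of \<psi>] rk(3)
  proof eventually_elim
    case (elim n)
    have "k * (?E n \<theta> (\<psi> n) - ?E n \<theta> (?\<phi> n)) \<le> k * (2 * e)"
      using elim rk(2) by (intro mult_left_mono) auto
    then have "2 * c < 2 * \<beta> + e * (3 + 2 * k)" using elim by (simp add: algebra_simps)
    then show False using ek c(1) by simp
  qed
  then show False by simp
qed

end

end

theorem theorem3p1:
  fixes p0 \<alpha> :: real
    and ahat bhat :: "nat \<Rightarrow> (nat \<Rightarrow> real) \<Rightarrow> real"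
  assumes "assumption_A p0 ahat bhat"
    and "0 < \<alpha>" and "\<alpha> < 1"
  shows "(\<forall>a>0. \<forall>b>0.
            asymp_normal (\<lambda>n. gig_sample n p0 a b)
              (\<lambda>n x. Q_eff n p0 (ahat n x) (bhat n x) x) 0 1)
       \<and> (\<forall>a>0. \<forall>b>0. \<forall>(\<tau>seq :: nat \<Rightarrow> real) \<tau>1. bounded (range \<tau>seq) \<longrightarrow> \<tau>seq \<longlonglongrightarrow> \<tau>1 \<longrightarrow>
            asymp_normal (\<lambda>n. gig_sample n (p0 + \<tau>seq n / sqrt (real n)) a b)
              (\<lambda>n x. Q_eff n p0 (ahat n x) (bhat n x) x)
              (\<tau>1 * sqrt (Gamma_eff p0 a b)) 1)
       \<and> has_asymptotic_level \<alpha> p0 (phi_test \<alpha> p0 ahat bhat)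
       \<and> locally_asymptotically_maximin \<alpha> p0 (phi_test \<alpha> p0 ahat bhat)"
proof -
  interpret gig_plugin p0 ahat bhat by standard (rule assms(1))
  \<comment> \<open>Only p is shifted, so the law stays in the family at every n; at n = 0 the
    quotient is 0 and the shift disappears.\<close>
  have alt: "asymp_normal (\<lambda>n. gig_sample n (p0 + \<tau>seq n / sqrt (real n)) a b) Q (\<tau>1 * sqrt (Gamma_eff p0 a b)) 1"
    if ab: "a > 0" "b > 0" and \<tau>: "\<tau>seq \<longlonglongrightarrow> \<tau>1" for a b \<tau>1 and \<tau>seq :: "nat \<Rightarrow> real"
    unfolding asymp_normal_def
    using Q_weak_conv[OF ab _ vector_tendsto_scaled[OF \<tau>]] ab
    by (simp add: gig_sample_eq_Pn Q_measurable_Pn mult.commute)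
  have null: "asymp_normal (\<lambda>n. gig_sample n p0 a b) Q 0 1" if "a > 0" "b > 0" for a b
    using alt[OF that, of "\<lambda>_. 0" 0] by simp
  have "has_asymptotic_level \<alpha> p0 (phi_test \<alpha> p0 ahat bhat)"
    unfolding has_asymptotic_level_def
  proof (intro allI impI)
    fix a b :: real assume ab: "a > 0" "b > 0"
    show "(\<lambda>n. integral\<^sup>L (gig_sample n p0 a b) (phi_test \<alpha> p0 ahat bhat n)) \<longlonglongrightarrow> \<alpha>"
      using local_power[OF ab assms(2,3), of 0] two_sided_power_quantile(2)[OF assms(2,3)]
      by (simp add: local_expectation_def)
  qed
  moreover have "locally_asymptotically_maximin \<alpha> p0 (phi_test \<alpha> p0 ahat bhat)"
    unfolding locally_asymptotically_maximin_def
    using phi_test_level_class[OF _ _ assms(2,3)]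
      order_trans[OF maximin_power_le[OF _ _ assms(2,3)] maximin_power_phi_ge[OF _ _ assms(2,3)]] by simp
  ultimately show ?thesis using alt null by simp
qed

end
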